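(* Let $X$ be a reduced Stein space, let $k\in\mathbb{N}=\{1,2,\ldots\}$ and $n>1$, and let $P\colon X\to J^k_{0,0}(\mathbb{C}^n)$, $x\mapsto P_x$, be a holomorphic family of nondegenerate $k$-jets at the origin fixing the origin of $\mathbb{C}^n$. Then there exists a holomorphic map $F\colon X\to\mathrm{Aut}(\mathbb{C}^n)$ such that for every $x\in X$ $$F_x(z)=P_x(z)+O(|z|^{k+1})\quad\text{for } z\to 0.$$ Furthermore, if $JP_x(z)=1+O(|z|^{k+1})$ as $z\to 0$ for every $x\in X$, then $F$ can be chosen such that $F_x\in\mathrm{Aut}(\mathbb{C}^n)$ is volume preserving for all $x\in X$.
   Context: Automorphisms: $\mathrm{Aut}(\mathbb{C}^n)$ is the group of holomorphic automorphisms of $\mathbb{C}^n$. An automorphism $F$ is volume preserving if its Jacobian determinant $JF=\det F'(z)$ equals $1$ at every $z\in\mathbb{C}^n$. A map $F\colon X\to\mathrm{Aut}(\mathbb{C}^n)$ is holomorphic if $X\times\mathbb{C}^n\to\mathbb{C}^n$, $(x,z)\mapsto F_x(z):=F(x)(z)$, is holomorphic. Jets: the $k$-jet at $p$ of a holomorphic map from a neighborhood of $p\in\mathbb{C}^n$ to $\mathbb{C}^n$ is its Taylor polynomial of order $k$ at $p$; it is nondegenerate if its linear part has nonzero determinant. $J^k_{p,q}(\mathbb{C}^n)$ is the set of nondegenerate $k$-jets $P$ at $p$ with $P(p)=q$; its elements are identified with polynomial maps $\mathbb{C}^n\to\mathbb{C}^n$ of degree at most $k$, and it is an open subset of a complex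 Euclidean space. A holomorphic family of jets is a holomorphic map from $X$ to this space. $J$ denotes the Jacobian determinant with respect to $z\in\mathbb{C}^n$. *)

theory Defs
  imports "HOL-Analysis.Analysis" "HOL-Library.Landau_Symbols"
begin

section \<open>Holomorphic functions and analytic sets in coordinate spaces\<close>

text \<open>
  The dimension of the local models of a complex space varies from chart to chart, so it cannot be
  a type. For a finite set I of indices, the coordinate space of dimension card I is the set
  of functions that vanish off I, with the topology of pointwise convergence.
\<close>

definition coord_space :: "'i set \<Rightarrow> ('i \<Rightarrow> complex) set" where
  "coord_space I = {w. \<forall>i. i \<notin> I \<longrightarrow> w i = 0}"

text \<open>
  Holomorphic functions of several variables: continuous, and holomorphic in each variable
  separately. Meant for relatively open subsets W of the coordinate space.
\<close>

definition holomorphic_coord ::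
    "'i set \<Rightarrow> ('i \<Rightarrow> complex) set \<Rightarrow> (('i \<Rightarrow> complex) \<Rightarrow> complex) \<Rightarrow> bool" where
  "holomorphic_coord I W g \<longleftrightarrow>
     continuous_on W g \<and>
     (\<forall>w\<in>W. \<forall>i\<in>I. (\<lambda>t. g (w(i := t))) holomorphic_on {t. w(i := t) \<in> W})"

text \<open>A is a closed analytic subset of the open set D: locally in D it is the common zero
  set of finitely many holomorphic functions.\<close>

definition analytic_subset ::
    "'i set \<Rightarrow> ('i \<Rightarrow> complex) set \<Rightarrow> ('i \<Rightarrow> complex) set \<Rightarrow> bool" where
  "analytic_subset I D A \<longleftrightarrow>
     A \<subseteq> D \<and>
     (\<forall>p\<in>D. \<exists>V G. openin (top_of_set (coord_space I)) V \<and> p \<in> V \<and> V \<subseteq> D \<and>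
        finite G \<and> (\<forall>g\<in>G. holomorphic_coord I V g) \<and>
        A \<inter> V = {w \<in> V. \<forall>g\<in>G. g w = 0})"


section \<open>Reduced complex spaces\<close>

text \<open>
  A chart identifies an open set of the space with a closed analytic subset of an open set
  chart_amb of a coordinate space. The space is reduced: its structure sheaf is the sheaf
  of those continuous functions that in charts are local restrictions of ambient holomorphic
  functions, so it is determined by the atlas.
\<close>

record ('a, 'i) cchart =
  chart_dom :: "'a set"
  chart_idx :: "'i set"
  chart_amb :: "('i \<Rightarrow> complex) set"
  chart_map :: "'a \<Rightarrow> 'i \<Rightarrow> complex"

record ('a, 'i) cspace =
  cs_top :: "'a topology"
  cs_atlas :: "('a, 'i) cchart set"

definition is_chart :: "'a topology \<Rightarrow> ('a, 'i) cchart \<Rightarrow> bool" where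
  "is_chart T c \<longleftrightarrow>
     openin T (chart_dom c) \<and>
     finite (chart_idx c) \<and>
     openin (top_of_set (coord_space (chart_idx c))) (chart_amb c) \<and>
     analytic_subset (chart_idx c) (chart_amb c) (chart_map c ` chart_dom c) \<and>
     homeomorphic_map (subtopology T (chart_dom c))
       (top_of_set (chart_map c ` chart_dom c)) (chart_map c)"

text \<open>On U, and as far as the chart c sees it, f is locally the restriction of an
  ambient holomorphic function.\<close>

definition holomorphic_in_chart ::
    "('a, 'i) cchart \<Rightarrow> 'a set \<Rightarrow> ('a \<Rightarrow> complex) \<Rightarrow> bool" where
  "holomorphic_in_chart c U f \<longleftrightarrow>
     (\<forall>x \<in> U \<inter> chart_dom c.
        \<exists>V g. openin (top_of_set (coord_space (chart_idx c))) V \<and> chart_map c x \<in> V \<and>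
          holomorphic_coord (chart_idx c) V g \<and>
          (\<forall>y \<in> U \<inter> chart_dom c. chart_map c y \<in> V \<longrightarrow> f y = g (chart_map c y)))"

definition reduced_complex_space :: "('a, 'i) cspace \<Rightarrow> bool" where
  "reduced_complex_space X \<longleftrightarrow>
     Hausdorff_space (cs_top X) \<and>
     (\<forall>c \<in> cs_atlas X. is_chart (cs_top X) c) \<and>
     (\<Union>c \<in> cs_atlas X. chart_dom c) = topspace (cs_top X) \<and>
     (\<forall>c \<in> cs_atlas X. \<forall>d \<in> cs_atlas X. \<forall>i \<in> chart_idx d.
        holomorphic_in_chart c (chart_dom d) (\<lambda>x. chart_map d x i))"

definition holomorphic_fun :: "('a, 'i) cspace \<Rightarrow> ('a \<Rightarrow> complex) \<Rightarrow> bool" where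
  "holomorphic_fun X f \<longleftrightarrow>
     (\<forall>c \<in> cs_atlas X. holomorphic_in_chart c (topspace (cs_top X)) f)"

definition holomorphic_map :: "('a, 'i) cspace \<Rightarrow> ('a \<Rightarrow> complex ^ 'n) \<Rightarrow> bool" where
  "holomorphic_map X f \<longleftrightarrow> (\<forall>i. holomorphic_fun X (\<lambda>x. f x $ i))"


section \<open>Stein spaces\<close>

definition holomorphic_hull :: "('a, 'i) cspace \<Rightarrow> 'a set \<Rightarrow> 'a set" where
  "holomorphic_hull X K =
     {x \<in> topspace (cs_top X).
        \<forall>f. holomorphic_fun X f \<longrightarrow> norm (f x) \<le> (SUP y\<in>K. norm (f y))}"

text \<open>The empty set is excluded because the supremum of the empty set of reals is unspecified.\<close>

definition holomorphically_convex :: "('a, 'i) cspace \<Rightarrow> bool" where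
  "holomorphically_convex X \<longleftrightarrow>
     (\<forall>K. compactin (cs_top X) K \<and> K \<noteq> {} \<longrightarrow> compactin (cs_top X) (holomorphic_hull X K))"

definition holomorphically_separable :: "('a, 'i) cspace \<Rightarrow> bool" where
  "holomorphically_separable X \<longleftrightarrow>
     (\<forall>x \<in> topspace (cs_top X). \<forall>y \<in> topspace (cs_top X).
        x \<noteq> y \<longrightarrow> (\<exists>f. holomorphic_fun X f \<and> f x \<noteq> f y))"

definition reduced_stein_space :: "('a, 'i) cspace \<Rightarrow> bool" where
  "reduced_stein_space X \<longleftrightarrow>
     reduced_complex_space X \<and> second_countable (cs_top X) \<and>
     holomorphically_convex X \<and> holomorphically_separable X"


section \<open>Complex Euclidean space and products\<close>

definition affine_cspace :: "(complex ^ 'n, 'n) cspace" where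
  "affine_cspace =
     \<lparr>cs_top = euclidean,
      cs_atlas =
        {\<lparr>chart_dom = UNIV, chart_idx = UNIV, chart_amb = UNIV, chart_map = (\<lambda>z i. z $ i)\<rparr>}\<rparr>"

definition prod_chart ::
    "('a, 'i) cchart \<Rightarrow> ('b, 'j) cchart \<Rightarrow> ('a \<times> 'b, 'i + 'j) cchart" where
  "prod_chart c d =
     \<lparr>chart_dom = chart_dom c \<times> chart_dom d,
      chart_idx = chart_idx c <+> chart_idx d,
      chart_amb = {case_sum u v | u v. u \<in> chart_amb c \<and> v \<in> chart_amb d},
      chart_map = (\<lambda>(x, y). case_sum (chart_map c x) (chart_map d y))\<rparr>"

definition prod_cspace ::
    "('a, 'i) cspace \<Rightarrow> ('b, 'j) cspace \<Rightarrow> ('a \<times> 'b, 'i + 'j) cspace" where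
  "prod_cspace X Y =
     \<lparr>cs_top = prod_topology (cs_top X) (cs_top Y),
      cs_atlas = {prod_chart c d | c d. c \<in> cs_atlas X \<and> d \<in> cs_atlas Y}\<rparr>"


section \<open>Automorphisms of complex Euclidean space\<close>

text \<open>For holomorphic f the matrix of the real Frechet derivative on the standard complex
  basis is the complex Jacobian matrix, so this is the complex Jacobian determinant.\<close>

definition jacobian_det :: "(complex ^ 'n \<Rightarrow> complex ^ 'n) \<Rightarrow> complex ^ 'n \<Rightarrow> complex" where
  "jacobian_det f z = det (matrix (frechet_derivative f (at z)))"

definition Aut :: "(complex ^ 'n \<Rightarrow> complex ^ 'n) set" where
  "Aut = {f. bij f \<and> holomorphic_map affine_cspace f \<and> holomorphic_map affine_cspace (inv f)}"

definition volume_preserving :: "(complex ^ 'n \<Rightarrow> complex ^ 'n) \<Rightarrow> bool" where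
  "volume_preserving f \<longleftrightarrow> (\<forall>z. jacobian_det f z = 1)"

definition holomorphic_Aut_family ::
    "('a, 'i) cspace \<Rightarrow> ('a \<Rightarrow> complex ^ 'n \<Rightarrow> complex ^ 'n) \<Rightarrow> bool" where
  "holomorphic_Aut_family X F \<longleftrightarrow>
     (\<forall>x \<in> topspace (cs_top X). F x \<in> Aut) \<and>
     holomorphic_map (prod_cspace X affine_cspace) (\<lambda>(x, z). F x z)"


section \<open>Jets at the origin\<close>

text \<open>A k-jet at the origin is given by its Taylor coefficients, one vector for each
  multi-index of order at most k; jet_poly is the associated polynomial map.\<close>

type_synonym 'n jet = "('n \<Rightarrow> nat) \<Rightarrow> complex ^ 'n"

definition jet_poly :: "nat \<Rightarrow> 'n::finite jet \<Rightarrow> complex ^ 'n \<Rightarrow> complex ^ 'n" where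
  "jet_poly k a z =
     (\<Sum>\<alpha> | (\<Sum>i\<in>UNIV. \<alpha> i) \<le> k. (\<Prod>i\<in>UNIV. (z $ i) ^ \<alpha> i) *s a \<alpha>)"

definition jet_linear_part :: "'n::finite jet \<Rightarrow> complex ^ 'n ^ 'n" where
  "jet_linear_part a = (\<chi> i j. a ((\<lambda>_. 0)(j := 1)) $ i)"

definition nondegenerate_jets_00 :: "nat \<Rightarrow> 'n::finite jet set" where
  "nondegenerate_jets_00 k =
     {a. (\<forall>\<alpha>. k < (\<Sum>i\<in>UNIV. \<alpha> i) \<longrightarrow> a \<alpha> = 0) \<and>
         jet_poly k a 0 = 0 \<and> det (jet_linear_part a) \<noteq> 0}"

definition holomorphic_jet_family ::
    "('a, 'i) cspace \<Rightarrow> nat \<Rightarrow> ('a \<Rightarrow> 'n::finite jet) \<Rightarrow> bool" where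
  "holomorphic_jet_family X k P \<longleftrightarrow>
     (\<forall>x \<in> topspace (cs_top X). P x \<in> nondegenerate_jets_00 k) \<and>
     (\<forall>\<alpha>. holomorphic_map X (\<lambda>x. P x \<alpha>))"

end

theory Submission
  imports Defs
begin

text \<open>
  After composing with the inverse of the linear part, which depends holomorphically on x, the jets
  are tangent to the identity. Their terms are then corrected degree by degree: composing with maps
  that add c(x) m(z) to a coordinate on which the monomial m does not depend, or that multiply it by
  exp (c(x) m(z)), adds a homogeneous polynomial field with coefficients c(x) up to higher order.
  Conjugating by the linear shear that adds t z_j to z_i and extracting the coefficients of the
  powers of t, the shears yield all divergence free monomial fields, and together with the overshears
  all monomial fields. If the jets have Jacobian 1, the homogeneous error of a composition of shears
  is divergence free, since the linearisation of the determinant at the identity is the trace; so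
  shears suffice and the family is volume preserving.
\<close>

section \<open>Holomorphic functions on complex spaces\<close>

text \<open>The fields that are added, the conjugating constants t and the linear relations between
  monomial fields do not depend on x; only the scalar coefficients c(x) do. Hence finitely many
  compositions serve all of X at once, and their parameters come from the jets by ring operations
  and one division by the determinant of the linear part. The linear part is not factored into
  shears; it is applied as a linear automorphism at the very end. After each composition the Taylor
  coefficients must again be holomorphic in x. This is not obtained by differentiating but by
  approximating with polynomials in z whose coefficients are holomorphic in x. In the volume
  preserving case an O-term cannot simply be differentiated in order to compare Jacobians.
  Compositions of shears are polynomial maps, so their Jacobians are computed exactly instead. A
  monomial that avoids one coordinate is nonconstant only if there is another coordinate: this is
  how n > 1 enters. For n = 1 all automorphisms are affine.\<close>

lemma holomorphic_coord_subset:
  assumes "holomorphic_coord I V g" "V' \<subseteq> V"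
  shows "holomorphic_coord I V' g"
  unfolding holomorphic_coord_def
proof (intro conjI ballI)
  show "continuous_on V' g"
    using assms continuous_on_subset by (auto simp: holomorphic_coord_def)
  fix w i assume "w \<in> V'" "i \<in> I"
  then have "(\<lambda>t. g (w(i := t))) holomorphic_on {t. w(i := t) \<in> V}"
    using assms by (auto simp: holomorphic_coord_def)
  then show "(\<lambda>t. g (w(i := t))) holomorphic_on {t. w(i := t) \<in> V'}"
    by (rule holomorphic_on_subset) (use assms in auto)
qed

lemma holomorphic_coord_const: "holomorphic_coord I V (\<lambda>w. c)"
  by (auto simp: holomorphic_coord_def)

lemma holomorphic_coord_add:
  "holomorphic_coord I V f \<Longrightarrow> holomorphic_coord I V g \<Longrightarrow> holomorphic_coord I V (\<lambda>w. f w + g w)"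
  by (auto simp: holomorphic_coord_def intro!: continuous_intros holomorphic_intros)

lemma holomorphic_coord_mult:
  "holomorphic_coord I V f \<Longrightarrow> holomorphic_coord I V g \<Longrightarrow> holomorphic_coord I V (\<lambda>w. f w * g w)"
  by (auto simp: holomorphic_coord_def intro!: continuous_intros holomorphic_intros)

lemma holomorphic_coord_exp:
  "holomorphic_coord I V f \<Longrightarrow> holomorphic_coord I V (\<lambda>w. exp (f w))"
  by (auto simp: holomorphic_coord_def intro!: continuous_intros holomorphic_intros)

lemma holomorphic_coord_inverse:
  "holomorphic_coord I V f \<Longrightarrow> (\<And>w. w \<in> V \<Longrightarrow> f w \<noteq> 0) \<Longrightarrow> holomorphic_coord I V (\<lambda>w. inverse (f w))"
  by (auto simp: holomorphic_coord_def intro!: continuous_intros holomorphic_intros)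

text \<open>The two ambient extensions are combined on the intersection of their neighbourhoods.
  Unary operations such as \<open>exp\<close> are the case in which \<open>\<phi>\<close> ignores
  its second argument.\<close>

lemma holomorphic_in_chart_compose2:
  assumes f: "holomorphic_in_chart c U f" and g: "holomorphic_in_chart c U g"
    and \<phi>: "\<And>V a b. holomorphic_coord (chart_idx c) V a \<Longrightarrow> holomorphic_coord (chart_idx c) V b \<Longrightarrow>
               holomorphic_coord (chart_idx c) V (\<lambda>w. \<phi> (a w) (b w))"
  shows "holomorphic_in_chart c U (\<lambda>x. \<phi> (f x) (g x))"
  unfolding holomorphic_in_chart_def
proof
  fix x assume x: "x \<in> U \<inter> chart_dom c"
  obtain V a where V: "openin (top_of_set (coord_space (chart_idx c))) V" "chart_map c x \<in> V"
    "holomorphic_coord (chart_idx c) V a"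
    "\<forall>y \<in> U \<inter> chart_dom c. chart_map c y \<in> V \<longrightarrow> f y = a (chart_map c y)"
    using f[unfolded holomorphic_in_chart_def, rule_format, OF x] by blast
  obtain W b where W: "openin (top_of_set (coord_space (chart_idx c))) W" "chart_map c x \<in> W"
    "holomorphic_coord (chart_idx c) W b"
    "\<forall>y \<in> U \<inter> chart_dom c. chart_map c y \<in> W \<longrightarrow> g y = b (chart_map c y)"
    using g[unfolded holomorphic_in_chart_def, rule_format, OF x] by blast
  show "\<exists>V h. openin (top_of_set (coord_space (chart_idx c))) V \<and> chart_map c x \<in> V \<and>
      holomorphic_coord (chart_idx c) V h \<and>
      (\<forall>y \<in> U \<inter> chart_dom c. chart_map c y \<in> V \<longrightarrow> \<phi> (f y) (g y) = h (chart_map c y))"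
  proof (intro exI conjI)
    show "openin (top_of_set (coord_space (chart_idx c))) (V \<inter> W)"
      using V W by auto
    show "holomorphic_coord (chart_idx c) (V \<inter> W) (\<lambda>w. \<phi> (a w) (b w))"
      using V(3) W(3) by (intro \<phi>) (auto elim: holomorphic_coord_subset)
  qed (use V W in auto)
qed

lemma holomorphic_fun_add:
  "holomorphic_fun X f \<Longrightarrow> holomorphic_fun X g \<Longrightarrow> holomorphic_fun X (\<lambda>x. f x + g x)"
  unfolding holomorphic_fun_def
  by (intro ballI holomorphic_in_chart_compose2[where \<phi> = "(+)"] holomorphic_coord_add) auto

lemma holomorphic_fun_mult:
  "holomorphic_fun X f \<Longrightarrow> holomorphic_fun X g \<Longrightarrow> holomorphic_fun X (\<lambda>x. f x * g x)"
  unfolding holomorphic_fun_def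
  by (intro ballI holomorphic_in_chart_compose2[where \<phi> = "(*)"] holomorphic_coord_mult) auto

lemma holomorphic_fun_exp:
  "holomorphic_fun X f \<Longrightarrow> holomorphic_fun X (\<lambda>x. exp (f x))"
  unfolding holomorphic_fun_def
  by (intro ballI holomorphic_in_chart_compose2[where \<phi> = "\<lambda>u v. exp u" and g = f]
      holomorphic_coord_exp) auto

lemma holomorphic_fun_inverse:
  assumes f: "holomorphic_fun X f" and nz: "\<And>x. x \<in> topspace (cs_top X) \<Longrightarrow> f x \<noteq> 0"
  shows "holomorphic_fun X (\<lambda>x. inverse (f x))"
  unfolding holomorphic_fun_def holomorphic_in_chart_def
proof (intro ballI)
  fix c x assume c: "c \<in> cs_atlas X" and x: "x \<in> topspace (cs_top X) \<inter> chart_dom c"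
  obtain V a where V: "openin (top_of_set (coord_space (chart_idx c))) V" "chart_map c x \<in> V"
    "holomorphic_coord (chart_idx c) V a"
    "\<forall>y \<in> topspace (cs_top X) \<inter> chart_dom c. chart_map c y \<in> V \<longrightarrow> f y = a (chart_map c y)"
    using f[unfolded holomorphic_fun_def holomorphic_in_chart_def, rule_format, OF c x] by blast
  \<comment> \<open>The extension \<open>a\<close> is nonzero at the image of \<open>x\<close>, but
    it may have zeros elsewhere in \<open>V\<close>, even off the image of the chart. By continuity,
    removing them leaves an open neighbourhood.\<close>
  let ?W = "V \<inter> a -` (- {0})"
  show "\<exists>V h. openin (top_of_set (coord_space (chart_idx c))) V \<and> chart_map c x \<in> V \<and>
      holomorphic_coord (chart_idx c) V h \<and>
      (\<forall>y \<in> topspace (cs_top X) \<inter> chart_dom c. chart_map c y \<in> V \<longrightarrow> inverse (f y) = h (chart_map c y))"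
  proof (intro exI conjI)
    have "openin (top_of_set V) ?W"
      using V(3) by (intro continuous_openin_preimage_gen) (auto simp: holomorphic_coord_def)
    then show "openin (top_of_set (coord_space (chart_idx c))) ?W"
      using V(1) openin_trans by blast
    show "holomorphic_coord (chart_idx c) ?W (\<lambda>w. inverse (a w))"
      using V(3) by (intro holomorphic_coord_inverse) (auto elim: holomorphic_coord_subset)
    show "chart_map c x \<in> ?W"
      using V nz x by auto
  qed (use V in auto)
qed

text \<open>Isolates what the closure lemmas use about charts: a constant extends to the whole
  coordinate space, which is a neighbourhood of the chart point only if the point lies in it. The
  condition passes to products at once, so no complex space structure on \<open>prod_cspace\<close>
  has to be verified.\<close>

definition charts_in_coord_space :: "('a, 'i) cspace \<Rightarrow> bool" where
  "charts_in_coord_space X \<longleftrightarrow>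
     (\<forall>c \<in> cs_atlas X. chart_map c ` chart_dom c \<subseteq> coord_space (chart_idx c))"

lemma charts_in_coord_space_reduced:
  "reduced_complex_space X \<Longrightarrow> charts_in_coord_space X"
  unfolding charts_in_coord_space_def reduced_complex_space_def is_chart_def analytic_subset_def
  by (blast dest: openin_imp_subset)

lemma holomorphic_fun_const:
  assumes "charts_in_coord_space X"
  shows "holomorphic_fun X (\<lambda>x. a)"
  unfolding holomorphic_fun_def holomorphic_in_chart_def
proof (intro ballI)
  fix c x assume "c \<in> cs_atlas X" and "x \<in> topspace (cs_top X) \<inter> chart_dom c"
  then have "chart_map c x \<in> coord_space (chart_idx c)"
    using assms by (auto simp: charts_in_coord_space_def)
  then show "\<exists>V h. openin (top_of_set (coord_space (chart_idx c))) V \<and> chart_map c x \<in> V \<and>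
      holomorphic_coord (chart_idx c) V h \<and>
      (\<forall>y \<in> topspace (cs_top X) \<inter> chart_dom c. chart_map c y \<in> V \<longrightarrow> a = h (chart_map c y))"
    by (intro exI[of _ "coord_space (chart_idx c)"] exI[of _ "\<lambda>w. a"])
       (auto simp: holomorphic_coord_const)
qed

lemma holomorphic_fun_sum:
  assumes "charts_in_coord_space X" "\<And>i. i \<in> S \<Longrightarrow> holomorphic_fun X (f i)"
  shows "holomorphic_fun X (\<lambda>x. \<Sum>i\<in>S. f i x)"
  using assms(2) by (induction S rule: infinite_finite_induct)
    (auto intro!: holomorphic_fun_add holomorphic_fun_const[OF assms(1)])

lemma holomorphic_fun_prod:
  assumes "charts_in_coord_space X" "\<And>i. i \<in> S \<Longrightarrow> holomorphic_fun X (f i)"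
  shows "holomorphic_fun X (\<lambda>x. \<Prod>i\<in>S. f i x)"
  using assms(2) by (induction S rule: infinite_finite_induct)
    (auto intro!: holomorphic_fun_mult holomorphic_fun_const[OF assms(1)])

lemma holomorphic_fun_power:
  assumes "charts_in_coord_space X" "holomorphic_fun X f"
  shows "holomorphic_fun X (\<lambda>x. f x ^ m)"
  by (induction m) (auto intro!: holomorphic_fun_mult holomorphic_fun_const assms)

lemma holomorphic_fun_det:
  assumes "charts_in_coord_space X" "\<And>i j. holomorphic_fun X (\<lambda>x. M x $ i $ j)"
  shows "holomorphic_fun X (\<lambda>x. det (M x :: complex ^ 'n ^ 'n))"
  unfolding det_def
  by (intro holomorphic_fun_sum holomorphic_fun_mult holomorphic_fun_prod holomorphic_fun_const
      assms)

section \<open>Coordinate functions and functions on product spaces\<close>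

lemma holomorphic_coord_component: "holomorphic_coord I V (\<lambda>w. w i)"
  unfolding holomorphic_coord_def
proof (intro conjI ballI)
  show "continuous_on V (\<lambda>w. w i)"
    by (rule continuous_on_product_then_coordinatewise) (rule continuous_on_id)
  fix w :: "'a \<Rightarrow> complex" and j
  show "(\<lambda>t. (w(j := t)) i) holomorphic_on {t. w(j := t) \<in> V}"
    by (cases "j = i") (simp_all add: holomorphic_on_ident)
qed

lemma holomorphic_fun_coordinate: "holomorphic_fun affine_cspace (\<lambda>z. z $ i)"
  unfolding holomorphic_fun_def holomorphic_in_chart_def
proof (intro ballI exI conjI)
  fix c :: "(complex ^ 'a, 'a) cchart" and z
  assume c: "c \<in> cs_atlas affine_cspace"
  show "openin (top_of_set (coord_space (chart_idx c))) UNIV" "chart_map c z \<in> UNIV"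
    using c by (simp_all add: affine_cspace_def coord_space_def)
  show "holomorphic_coord (chart_idx c) UNIV (\<lambda>w. w i)"
    by (rule holomorphic_coord_component)
  fix y show "chart_map c y \<in> UNIV \<longrightarrow> y $ i = chart_map c y i"
    using c by (simp add: affine_cspace_def)
qed

lemma charts_in_coord_space_affine: "charts_in_coord_space affine_cspace"
  by (auto simp: charts_in_coord_space_def affine_cspace_def coord_space_def)

lemma charts_in_coord_space_prod:
  assumes "charts_in_coord_space X" "charts_in_coord_space Y"
  shows "charts_in_coord_space (prod_cspace X Y)"
  unfolding charts_in_coord_space_def
proof (intro ballI subsetI)
  fix e w assume "e \<in> cs_atlas (prod_cspace X Y)" and w: "w \<in> chart_map e ` chart_dom e"
  then obtain c d where cd: "e = prod_chart c d" "c \<in> cs_atlas X" "d \<in> cs_atlas Y"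
    by (auto simp: prod_cspace_def)
  obtain x y where "x \<in> chart_dom c" "y \<in> chart_dom d"
    "w = case_sum (chart_map c x) (chart_map d y)"
    using w by (auto simp: cd prod_chart_def)
  moreover from this have "chart_map c x \<in> coord_space (chart_idx c)"
    "chart_map d y \<in> coord_space (chart_idx d)"
    using assms cd unfolding charts_in_coord_space_def by blast+
  ultimately show "w \<in> coord_space (chart_idx e)"
    by (auto simp: cd prod_chart_def coord_space_def split: sum.split)
qed

lemma continuous_on_compose_left:
  "continuous_on S (\<lambda>w i. (w (h i) :: 'b::topological_space))"
  by (intro continuous_on_coordinatewise_then_product continuous_on_product_then_coordinatewise[OF continuous_on_id])

text \<open>The ambient extension is pulled back along the restriction to the \<open>Inl\<close>
  coordinates. Varying an \<open>Inl\<close> coordinate varies a coordinate of the first factor, and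
  varying an \<open>Inr\<close> coordinate leaves the pullback constant; this settles separate
  holomorphy.\<close>

lemma holomorphic_fun_fst:
  assumes f: "holomorphic_fun X f" and Y: "charts_in_coord_space Y"
  shows "holomorphic_fun (prod_cspace X Y) (\<lambda>(x, y). f x)"
  unfolding holomorphic_fun_def holomorphic_in_chart_def
proof (intro ballI)
  fix e p assume e: "e \<in> cs_atlas (prod_cspace X Y)"
    and p: "p \<in> topspace (cs_top (prod_cspace X Y)) \<inter> chart_dom e"
  obtain c d where cd: "e = prod_chart c d" "c \<in> cs_atlas X" "d \<in> cs_atlas Y"
    using e by (auto simp: prod_cspace_def)
  obtain x y where xy: "p = (x, y)" "x \<in> topspace (cs_top X) \<inter> chart_dom c" "y \<in> chart_dom d"
    using p by (auto simp: prod_cspace_def cd prod_chart_def)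
  obtain V a where V: "openin (top_of_set (coord_space (chart_idx c))) V" "chart_map c x \<in> V"
    "holomorphic_coord (chart_idx c) V a"
    "\<forall>y \<in> topspace (cs_top X) \<inter> chart_dom c. chart_map c y \<in> V \<longrightarrow> f y = a (chart_map c y)"
    using f[unfolded holomorphic_fun_def holomorphic_in_chart_def, rule_format, OF cd(2) xy(2)] by blast
  let ?l = "\<lambda>(w :: 'b + 'd \<Rightarrow> complex) i. w (Inl i)"
  let ?C = "coord_space (chart_idx c <+> chart_idx d)"
  let ?W = "?C \<inter> ?l -` V"
  have cont: "continuous_on S ?l" for S
    by (rule continuous_on_compose_left)
  have upd: "?l (w(Inl i := t)) = (?l w)(i := t)" "?l (w(Inr j := t)) = ?l w" for w i j t
    by auto
  show "\<exists>V h. openin (top_of_set (coord_space (chart_idx e))) V \<and> chart_map e p \<in> V \<and>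
      holomorphic_coord (chart_idx e) V h \<and>
      (\<forall>y \<in> topspace (cs_top (prod_cspace X Y)) \<inter> chart_dom e. chart_map e y \<in> V \<longrightarrow>
         (case y of (x, y) \<Rightarrow> f x) = h (chart_map e y))"
  proof (intro exI conjI)
    have "openin (top_of_set ?C) ?W"
      by (rule continuous_openin_preimage[OF cont _ V(1)]) (auto simp: coord_space_def)
    then show "openin (top_of_set (coord_space (chart_idx e))) ?W"
      by (simp add: cd prod_chart_def)
    have cx: "chart_map c x \<in> coord_space (chart_idx c)"
      using openin_imp_subset[OF V(1)] V(2) by blast
    have dy: "chart_map d y \<in> coord_space (chart_idx d)"
      using Y cd(3) xy(3) by (auto simp: charts_in_coord_space_def)
    have "case_sum (chart_map c x) (chart_map d y) \<in> ?C"
      using cx dy by (auto simp: coord_space_def image_iff split: sum.split)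
    then show "chart_map e p \<in> ?W"
      using V(2) by (simp add: cd xy prod_chart_def)
    show "holomorphic_coord (chart_idx e) ?W (\<lambda>w. a (?l w))"
      unfolding holomorphic_coord_def
    proof (intro conjI ballI)
      show "continuous_on ?W (\<lambda>w. a (?l w))"
        using V(3) by (intro continuous_on_compose2[OF _ cont]) (auto simp: holomorphic_coord_def)
      fix w i assume w: "w \<in> ?W" "i \<in> chart_idx e"
      show "(\<lambda>t. a (?l (w(i := t)))) holomorphic_on {t. w(i := t) \<in> ?W}"
      proof (cases i)
        case (Inl k)
        with w have "(\<lambda>t. a ((?l w)(k := t))) holomorphic_on {t. (?l w)(k := t) \<in> V}"
          using V(3) by (auto simp: holomorphic_coord_def cd prod_chart_def)
        then show ?thesis
          unfolding Inl upd by (rule holomorphic_on_subset) (auto simp: upd simp del: fun_upd_apply)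
      qed (simp only: upd holomorphic_on_const)
    qed
  qed (use V in \<open>auto simp: cd prod_cspace_def prod_chart_def\<close>)
qed

lemma holomorphic_fun_snd_coordinate:
  fixes i :: "'n::finite"
  assumes X: "charts_in_coord_space X"
  shows "holomorphic_fun (prod_cspace X affine_cspace) (\<lambda>(x, z). z $ i)"
  unfolding holomorphic_fun_def holomorphic_in_chart_def
proof (intro ballI)
  fix e p assume e: "e \<in> cs_atlas (prod_cspace X (affine_cspace :: (complex ^ 'n, 'n) cspace))"
    and p: "p \<in> topspace (cs_top (prod_cspace X (affine_cspace :: (complex ^ 'n, 'n) cspace))) \<inter> chart_dom e"
  obtain c where c: "c \<in> cs_atlas X" and
    ec: "e = prod_chart c \<lparr>chart_dom = UNIV, chart_idx = UNIV, chart_amb = UNIV, chart_map = (\<lambda>z i. z $ i)\<rparr>"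
    using e by (auto simp: prod_cspace_def affine_cspace_def)
  have "chart_map e p \<in> coord_space (chart_idx e)"
    using charts_in_coord_space_prod[OF X charts_in_coord_space_affine] e p
    by (auto simp: charts_in_coord_space_def)
  moreover have "holomorphic_coord (chart_idx e) (coord_space (chart_idx e)) (\<lambda>w. w (Inr i))"
    by (rule holomorphic_coord_component)
  ultimately show "\<exists>V h. openin (top_of_set (coord_space (chart_idx e))) V \<and> chart_map e p \<in> V \<and>
      holomorphic_coord (chart_idx e) V h \<and>
      (\<forall>y \<in> topspace (cs_top (prod_cspace X affine_cspace)) \<inter> chart_dom e. chart_map e y \<in> V \<longrightarrow>
         (case y of (x, z) \<Rightarrow> z $ i) = h (chart_map e y))"
    by (intro exI[of _ "coord_space (chart_idx e)"] exI[of _ "\<lambda>w. w (Inr i)"])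
       (auto simp: ec prod_chart_def)
qed

section \<open>Order of vanishing at the origin\<close>

text \<open>This is O(|z|^m) at the origin. The filter \<open>at 0\<close> is punctured, so nothing
  is said about the value at the origin. With an explicit constant, products and pullbacks are
  estimated directly; \<open>vanishes_iff_bigo\<close> converts to the Landau form of the
  theorem.\<close>

definition vanishes :: "nat \<Rightarrow> (complex ^ 'n \<Rightarrow> 'b::real_normed_vector) \<Rightarrow> bool" where
  "vanishes m f \<longleftrightarrow> (\<exists>C. \<forall>\<^sub>F z in at 0. norm (f z) \<le> C * norm z ^ m)"

lemma vanishesI:
  assumes "\<And>z. norm (f z) \<le> C * norm z ^ m"
  shows "vanishes m f"
  unfolding vanishes_def using assms by (intro exI[of _ C] always_eventually allI)

lemma vanishesE:
  assumes "vanishes m f"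
  obtains C where "C > 0" "\<forall>\<^sub>F z in at 0. norm (f z) \<le> C * norm z ^ m"
proof -
  obtain C where C: "\<forall>\<^sub>F z in at 0. norm (f z) \<le> C * norm z ^ m"
    using assms by (auto simp: vanishes_def)
  have "\<forall>\<^sub>F z in at 0. norm (f z) \<le> (\<bar>C\<bar> + 1) * norm z ^ m"
    using C
  proof eventually_elim
    case (elim z)
    moreover have "C * norm z ^ m \<le> (\<bar>C\<bar> + 1) * norm z ^ m"
      by (intro mult_right_mono) auto
    ultimately show ?case by linarith
  qed
  then show ?thesis by (intro that[of "\<bar>C\<bar> + 1"]) auto
qed

lemma vanishes_iff_bigo: "vanishes m f \<longleftrightarrow> (\<lambda>z. norm (f z)) \<in> O[at 0](\<lambda>z. norm z ^ m)"
proof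
  assume "vanishes m f"
  then obtain C where "C > 0" "\<forall>\<^sub>F z in at 0. norm (f z) \<le> C * norm z ^ m"
    by (rule vanishesE)
  then show "(\<lambda>z. norm (f z)) \<in> O[at 0](\<lambda>z. norm z ^ m)"
    by (intro bigoI[of _ C]) simp
next
  assume "(\<lambda>z. norm (f z)) \<in> O[at 0](\<lambda>z. norm z ^ m)"
  then show "vanishes m f"
    by (elim landau_o.bigE) (auto simp: vanishes_def)
qed

lemma vanishes_mono:
  assumes "vanishes m f" "l \<le> m"
  shows "vanishes l f"
proof -
  obtain C where C: "C > 0" "\<forall>\<^sub>F z in at 0. norm (f z) \<le> C * norm z ^ m"
    using assms(1) by (rule vanishesE)
  have "\<forall>\<^sub>F z :: complex ^ 'a in at 0. norm z < 1"
    using eventually_at_ball[of 1 "0 :: complex ^ 'a" UNIV] by (simp add: dist_norm)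
  with C(2) have "\<forall>\<^sub>F z in at 0. norm (f z) \<le> C * norm z ^ l"
  proof eventually_elim
    case (elim z)
    have "C * norm z ^ m \<le> C * norm z ^ l"
      using elim C(1) assms(2) by (intro mult_left_mono power_decreasing) auto
    then show ?case using elim by linarith
  qed
  then show ?thesis by (auto simp: vanishes_def)
qed

lemma vanishes_zero [simp]: "vanishes m (\<lambda>z. 0)"
  by (rule vanishesI[where C = 0]) simp

lemma vanishes_const: "vanishes 0 (\<lambda>z. c)"
  by (rule vanishesI[where C = "norm c"]) simp

lemma vanishes_add:
  assumes "vanishes m f" "vanishes m g"
  shows "vanishes m (\<lambda>z. f z + g z)"
proof -
  obtain C where C: "\<forall>\<^sub>F z in at 0. norm (f z) \<le> C * norm z ^ m"
    using assms(1) by (auto simp: vanishes_def)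
  obtain D where D: "\<forall>\<^sub>F z in at 0. norm (g z) \<le> D * norm z ^ m"
    using assms(2) by (auto simp: vanishes_def)
  have "\<forall>\<^sub>F z in at 0. norm (f z + g z) \<le> (C + D) * norm z ^ m"
    using C D
  proof eventually_elim
    case (elim z)
    then show ?case
      using norm_triangle_ineq[of "f z" "g z"] by (simp add: distrib_right)
  qed
  then show ?thesis by (auto simp: vanishes_def)
qed

lemma vanishes_minus: "vanishes m f \<Longrightarrow> vanishes m (\<lambda>z. - f z)"
  unfolding vanishes_def by (simp only: norm_minus_cancel)

lemma vanishes_diff: "vanishes m f \<Longrightarrow> vanishes m g \<Longrightarrow> vanishes m (\<lambda>z. f z - g z)"
  using vanishes_add[OF _ vanishes_minus, of m f g] by simp

lemma vanishes_sum: "(\<And>i. i \<in> S \<Longrightarrow> vanishes m (f i)) \<Longrightarrow> vanishes m (\<lambda>z. \<Sum>i\<in>S. f i z)"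
  by (induction S rule: infinite_finite_induct) (auto intro: vanishes_add)

lemma vanishes_trans:
  "vanishes m (\<lambda>z. f z - g z) \<Longrightarrow> vanishes m (\<lambda>z. g z - h z) \<Longrightarrow> vanishes m (\<lambda>z. f z - h z)"
  using vanishes_add[of m "\<lambda>z. f z - g z" "\<lambda>z. g z - h z"] by simp

lemma vanishes_mult:
  fixes f g :: "complex ^ 'n \<Rightarrow> complex"
  assumes "vanishes m f" "vanishes l g"
  shows "vanishes (m + l) (\<lambda>z. f z * g z)"
proof -
  obtain C where C: "C > 0" "\<forall>\<^sub>F z in at 0. norm (f z) \<le> C * norm z ^ m"
    using assms(1) by (rule vanishesE)
  obtain D where D: "D > 0" "\<forall>\<^sub>F z in at 0. norm (g z) \<le> D * norm z ^ l"
    using assms(2) by (rule vanishesE)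
  have "\<forall>\<^sub>F z in at 0. norm (f z * g z) \<le> (C * D) * norm z ^ (m + l)"
    using C(2) D(2)
  proof eventually_elim
    case (elim z)
    then have "norm (f z) * norm (g z) \<le> (C * norm z ^ m) * (D * norm z ^ l)"
      using C(1) by (intro mult_mono) auto
    then show ?case by (simp add: norm_mult power_add mult_ac)
  qed
  then show ?thesis by (auto simp: vanishes_def)
qed

lemma vanishes_cmult:
  fixes f :: "complex ^ 'n \<Rightarrow> complex"
  shows "vanishes m f \<Longrightarrow> vanishes m (\<lambda>z. c * f z)"
  using vanishes_mult[OF vanishes_const[of c], of m f] by simp

lemma vanishes_vec_iff:
  fixes f :: "complex ^ 'n \<Rightarrow> complex ^ 'm"
  shows "vanishes m f \<longleftrightarrow> (\<forall>i. vanishes m (\<lambda>z. f z $ i))"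
proof (intro iffI allI)
  fix i assume "vanishes m f"
  then obtain C where "\<forall>\<^sub>F z in at 0. norm (f z) \<le> C * norm z ^ m"
    by (auto simp: vanishes_def)
  then have "\<forall>\<^sub>F z in at 0. norm (f z $ i) \<le> C * norm z ^ m"
    by eventually_elim (rule order_trans[OF Finite_Cartesian_Product.norm_nth_le])
  then show "vanishes m (\<lambda>z. f z $ i)" by (auto simp: vanishes_def)
next
  assume "\<forall>i. vanishes m (\<lambda>z. f z $ i)"
  then obtain C where C: "\<And>i. \<forall>\<^sub>F z in at 0. norm (f z $ i) \<le> C i * norm z ^ m"
    unfolding vanishes_def by metis
  have "\<forall>\<^sub>F z in at 0. \<forall>i. norm (f z $ i) \<le> C i * norm z ^ m"
    using C by (rule eventually_all_finite)
  then have "\<forall>\<^sub>F z in at 0. norm (f z) \<le> (\<Sum>i\<in>UNIV. C i) * norm z ^ m"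
  proof eventually_elim
    case (elim z)
    have "norm (f z) \<le> (\<Sum>i\<in>UNIV. norm (f z $ i))"
      by (simp add: norm_vec_def L2_set_le_sum)
    also have "\<dots> \<le> (\<Sum>i\<in>UNIV. C i * norm z ^ m)"
      using elim by (intro sum_mono) auto
    finally show ?case by (simp add: sum_distrib_right)
  qed
  then show "vanishes m f" by (auto simp: vanishes_def)
qed

lemma vanishes_coordinate: "vanishes 1 (\<lambda>z :: complex ^ 'n. z $ i)"
  by (rule vanishesI[where C = 1]) (simp add: Finite_Cartesian_Product.norm_nth_le)

lemma vanishes_power:
  fixes f :: "complex ^ 'n \<Rightarrow> complex"
  shows "vanishes m f \<Longrightarrow> vanishes (j * m) (\<lambda>z. f z ^ j)"
  by (induction j) (auto intro: vanishes_const vanishes_mult)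

lemma vanishes_prod:
  fixes f :: "'i \<Rightarrow> complex ^ 'n \<Rightarrow> complex"
  shows "(\<And>i. i \<in> S \<Longrightarrow> vanishes (m i) (f i)) \<Longrightarrow> vanishes (\<Sum>i\<in>S. m i) (\<lambda>z. \<Prod>i\<in>S. f i z)"
  by (induction S rule: infinite_finite_induct) (auto intro: vanishes_const vanishes_mult)

text \<open>The Taylor estimate bounds the remainder by exp |Re u| times the first omitted power of
  \<open>u\<close>, which has order (k + 1) m. The exponential factor is harmless because
  \<open>u\<close> is bounded near the origin, even for \<open>m = 0\<close>.\<close>

lemma vanishes_exp_remainder:
  fixes u :: "complex ^ 'n \<Rightarrow> complex"
  assumes "vanishes m u"
  shows "vanishes (Suc k * m) (\<lambda>z. exp (u z) - (\<Sum>j\<le>k. u z ^ j / fact j))"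
proof -
  obtain B where B: "B > 0" "\<forall>\<^sub>F z in at 0. norm (u z) \<le> B * norm z ^ 0"
    using vanishes_mono[OF assms, of 0] by (auto elim: vanishesE)
  obtain C where C: "C > 0" "\<forall>\<^sub>F z in at 0. norm (u z ^ Suc k) \<le> C * norm z ^ (Suc k * m)"
    using vanishes_power[OF assms, of "Suc k"] by (rule vanishesE)
  have "\<forall>\<^sub>F z in at 0. norm (exp (u z) - (\<Sum>j\<le>k. u z ^ j / fact j)) \<le> exp B * C * norm z ^ (Suc k * m)"
    using B(2) C(2)
  proof eventually_elim
    case (elim z)
    have "norm (exp (u z) - (\<Sum>j\<le>k. u z ^ j / fact j)) \<le> exp \<bar>Re (u z)\<bar> * norm (u z) ^ Suc k / fact k"
      by (rule Taylor_exp)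
    also have "\<dots> \<le> exp \<bar>Re (u z)\<bar> * norm (u z) ^ Suc k"
      using mult_left_mono[OF fact_ge_1[of k, where 'a = real], of "exp \<bar>Re (u z)\<bar> * norm (u z) ^ Suc k"]
      by (simp add: divide_le_eq)
    also have "\<dots> \<le> exp B * (C * norm z ^ (Suc k * m))"
      using elim abs_Re_le_cmod[of "u z"] by (intro mult_mono) (auto simp: norm_power norm_mult)
    finally show ?case by (simp add: mult.assoc)
  qed
  then show ?thesis by (auto simp: vanishes_def)
qed

lemma vanishes_imp_tendsto:
  assumes "vanishes (Suc m) f"
  shows "(f \<longlongrightarrow> 0) (at 0)"
proof -
  obtain C where C: "\<forall>\<^sub>F z in at 0. norm (f z) \<le> C * norm z ^ Suc m"
    using assms by (auto simp: vanishes_def)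
  have "((\<lambda>z :: complex ^ 'a. C * norm z ^ Suc m) \<longlongrightarrow> 0) (at 0)"
    by (auto intro!: tendsto_eq_intros)
  then show ?thesis by (rule Lim_null_comparison[OF C])
qed

text \<open>Here \<open>v\<close> plays the part of the terms of order \<open>m\<close> of
  \<open>u\<close>, without being required to be homogeneous. The bound on \<open>v\<close> itself
  is what makes leading terms multiplicative.\<close>

definition leading :: "nat \<Rightarrow> (complex ^ 'n \<Rightarrow> complex) \<Rightarrow> (complex ^ 'n \<Rightarrow> complex) \<Rightarrow> bool" where
  "leading m u v \<longleftrightarrow> vanishes m v \<and> vanishes (Suc m) (\<lambda>z. u z - v z)"

lemma leading_vanishes: "leading m u v \<Longrightarrow> vanishes m u"
  unfolding leading_def
  using vanishes_add[of m "\<lambda>z. u z - v z" v] vanishes_mono[of "Suc m" "\<lambda>z. u z - v z" m] by simp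

lemma leading_const: "leading 0 (\<lambda>z. c) (\<lambda>z. c)"
  by (simp add: leading_def vanishes_const)

lemma leading_add: "leading m u v \<Longrightarrow> leading m u' v' \<Longrightarrow> leading m (\<lambda>z. u z + u' z) (\<lambda>z. v z + v' z)"
  unfolding leading_def using vanishes_add[of "Suc m" "\<lambda>z. u z - v z" "\<lambda>z. u' z - v' z"]
  by (auto intro: vanishes_add simp: algebra_simps)

lemma leading_mult:
  assumes "leading m u v" "leading l u' v'"
  shows "leading (m + l) (\<lambda>z. u z * u' z) (\<lambda>z. v z * v' z)"
proof -
  have "vanishes (Suc m + l) (\<lambda>z. (u z - v z) * u' z)" "vanishes (m + Suc l) (\<lambda>z. v z * (u' z - v' z))"
    using assms leading_vanishes[OF assms(2)] by (auto simp: leading_def intro: vanishes_mult simp del: add_Suc add_Suc_right)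
  then have "vanishes (Suc (m + l)) (\<lambda>z. (u z - v z) * u' z + v z * (u' z - v' z))"
    by (intro vanishes_add) simp_all
  moreover have "(u z - v z) * u' z + v z * (u' z - v' z) = u z * u' z - v z * v' z" for z
    by (simp add: algebra_simps)
  ultimately show ?thesis
    using assms by (simp add: leading_def vanishes_mult)
qed

lemma leading_cmult: "leading m u v \<Longrightarrow> leading m (\<lambda>z. c * u z) (\<lambda>z. c * v z)"
  using leading_mult[OF leading_const[of c], of m u v] by simp

lemma leading_power: "leading m u v \<Longrightarrow> leading (j * m) (\<lambda>z. u z ^ j) (\<lambda>z. v z ^ j)"
  by (induction j) (auto intro: leading_const leading_mult)

lemma leading_prod:
  "(\<And>i. i \<in> S \<Longrightarrow> leading (m i) (u i) (v i)) \<Longrightarrow>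
   leading (\<Sum>i\<in>S. m i) (\<lambda>z. \<Prod>i\<in>S. u i z) (\<lambda>z. \<Prod>i\<in>S. v i z)"
  by (induction S rule: infinite_finite_induct) (auto intro: leading_const leading_mult)

text \<open>The remainder exp u - 1 - u has order 2 m, and 2 m is at least m + 1 because m is
  positive.\<close>

lemma leading_exp_minus_one:
  assumes "leading m u v" "m \<ge> 1"
  shows "leading m (\<lambda>z. exp (u z) - 1) v"
proof -
  have "vanishes (Suc 1 * m) (\<lambda>z. exp (u z) - (\<Sum>j\<le>1. u z ^ j / fact j))"
    using leading_vanishes[OF assms(1)] by (rule vanishes_exp_remainder)
  then have "vanishes (Suc m) (\<lambda>z. exp (u z) - (\<Sum>j\<le>1. u z ^ j / fact j))"
    by (rule vanishes_mono) (use assms in simp)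
  from vanishes_add[OF this, of "\<lambda>z. u z - v z"] assms
  show ?thesis by (simp add: leading_def algebra_simps)
qed


section \<open>Monomials and polynomial families\<close>

definition monomial :: "('n::finite \<Rightarrow> nat) \<Rightarrow> complex ^ 'n \<Rightarrow> complex" where
  "monomial \<alpha> z = (\<Prod>i\<in>UNIV. (z $ i) ^ \<alpha> i)"

abbreviation mdegree :: "('n::finite \<Rightarrow> nat) \<Rightarrow> nat" where
  "mdegree \<alpha> \<equiv> (\<Sum>i\<in>UNIV. \<alpha> i)"

abbreviation unit_index :: "'n \<Rightarrow> 'n \<Rightarrow> nat" where
  "unit_index i \<equiv> (\<lambda>_. 0)(i := 1)"

lemma finite_mdegree_le: "finite {\<alpha> :: 'n::finite \<Rightarrow> nat. mdegree \<alpha> \<le> k}"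
proof (rule finite_subset)
  show "finite (PiE (UNIV :: 'n set) (\<lambda>_. {..k}))"
    by (intro finite_PiE) auto
  have "\<alpha> i \<le> mdegree \<alpha>" for \<alpha> :: "'n \<Rightarrow> nat" and i
    by (rule member_le_sum) auto
  then show "{\<alpha> :: 'n \<Rightarrow> nat. mdegree \<alpha> \<le> k} \<subseteq> PiE UNIV (\<lambda>_. {..k})"
    by (auto simp: PiE_UNIV_domain intro: order_trans)
qed

lemma monomial_zero [simp]: "monomial (\<lambda>_. 0) z = 1"
  by (simp add: monomial_def)

lemma monomial_unit_index [simp]: "monomial (unit_index i) z = z $ i"
proof -
  have "monomial (unit_index i) z = (\<Prod>l\<in>UNIV. if l = i then z $ i else 1)"
    unfolding monomial_def by (intro prod.cong) auto
  then show ?thesis by simp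
qed

text \<open>The simplifier turns the \<open>1\<close> inside \<open>unit_index\<close> into
  \<open>Suc 0\<close>, so the rule has to be available in that form as well.\<close>

declare monomial_unit_index [unfolded One_nat_def, simp]

lemma monomial_add: "monomial (\<lambda>i. \<alpha> i + \<beta> i) z = monomial \<alpha> z * monomial \<beta> z"
  by (simp add: monomial_def power_add prod.distrib)

lemma monomial_upd: "monomial (\<alpha>(i := m)) z = z $ i ^ m * monomial (\<alpha>(i := 0)) z"
proof -
  have "monomial (\<alpha>(i := m)) z = (z $ i) ^ m * (\<Prod>l\<in>UNIV - {i}. (z $ l) ^ \<alpha> l)" for m
    unfolding monomial_def by (subst prod.remove[of _ i]) (auto intro!: prod.cong)
  from this[of m] this[of 0] show ?thesis by simp
qed

lemma mdegree_upd: "mdegree (\<alpha>(i := m)) = m + mdegree (\<alpha>(i := 0))"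
proof -
  have "mdegree (\<alpha>(i := m)) = m + (\<Sum>l\<in>UNIV - {i}. \<alpha> l)" for m
    by (subst sum.remove[of _ i]) (auto intro!: sum.cong)
  from this[of m] this[of 0] show ?thesis by simp
qed

lemma mdegree_upd_Suc: "mdegree (\<alpha>(i := Suc (\<alpha> i))) = Suc (mdegree \<alpha>)"
  using mdegree_upd[of \<alpha> i "Suc (\<alpha> i)"] mdegree_upd[of \<alpha> i "\<alpha> i"] by simp

lemma mdegree_le_1_cases:
  assumes "mdegree \<alpha> \<le> 1"
  shows "\<alpha> = (\<lambda>_. 0) \<or> (\<exists>i. \<alpha> = unit_index i)"
proof (cases "mdegree \<alpha> = 0")
  case False
  then obtain i where i: "\<alpha> i \<noteq> 0" by auto
  have "\<alpha> i + mdegree (\<alpha>(i := 0)) \<le> 1"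
    using assms mdegree_upd[of \<alpha> i "\<alpha> i"] by simp
  then have "\<alpha> i = 1" "mdegree (\<alpha>(i := 0)) = 0"
    using i by linarith+
  then have "(\<alpha>(i := 0)) l = 0" for l
    by (subst (asm) sum_eq_0_iff) auto
  then have "\<alpha> l = unit_index i l" for l
    using \<open>\<alpha> i = 1\<close> by (cases "l = i") (auto dest: meta_spec[of _ l])
  then show ?thesis by blast
qed auto

lemma vanishes_monomial: "vanishes (mdegree \<alpha>) (monomial \<alpha>)"
proof -
  have "vanishes (\<alpha> i) (\<lambda>z :: complex ^ 'a. (z $ i) ^ \<alpha> i)" for i
    using vanishes_power[OF vanishes_coordinate, of "\<alpha> i" i] by simp
  then show ?thesis
    unfolding monomial_def by (intro vanishes_prod)
qed

lemma leading_monomial: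
  assumes "\<And>i. leading 1 (\<lambda>z. F z $ i) (\<lambda>z. z $ i)"
  shows "leading (mdegree \<alpha>) (\<lambda>z. monomial \<alpha> (F z)) (monomial \<alpha>)"
  unfolding monomial_def
  by (rule leading_prod) (use leading_power[OF assms, of "\<alpha> i" i for i] in simp)

text \<open>Doubling one coordinate at most doubles the norm and sends only the origin to the
  origin, so it respects the punctured filter. Monomials are eigenvectors of this pullback
  (\<open>monomial_stretch\<close>), which is how they are separated from each other below.\<close>

lemma vanishes_stretch:
  fixes f :: "complex ^ 'n \<Rightarrow> complex"
  assumes "vanishes m f"
  shows "vanishes m (\<lambda>z. f (\<chi> l. if l = i then 2 * z $ l else z $ l))"
proof -
  let ?D = "\<lambda>z :: complex ^ 'n. \<chi> l. if l = i then 2 * z $ l else z $ l"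
  obtain C where C: "C > 0" "\<forall>\<^sub>F z in at 0. norm (f z) \<le> C * norm z ^ m"
    using assms by (rule vanishesE)
  have le: "norm (?D z) \<le> 2 * norm z" for z
  proof -
    have "norm (?D z) \<le> norm (2 *\<^sub>R z)"
      by (rule norm_le_componentwise_cart) (auto simp: norm_mult)
    then show ?thesis by simp
  qed
  have "(?D \<longlongrightarrow> 0) (at 0)"
    by (rule Lim_null_comparison[where g = "\<lambda>z. 2 * norm z"])
       (use le in \<open>auto intro!: tendsto_eq_intros\<close>)
  moreover have nz: "z = 0" if "?D z = 0" for z
    using that by (auto simp: vec_eq_iff split: if_splits)
  have "\<forall>\<^sub>F z in at 0. ?D z \<noteq> 0"
    unfolding eventually_at_filter by (intro always_eventually allI impI notI) (blast dest: nz)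
  ultimately have "filterlim ?D (at 0) (at 0)"
    by (rule filterlim_atI)
  with C(2) have "\<forall>\<^sub>F z in at 0. norm (f (?D z)) \<le> C * norm (?D z) ^ m"
    by (auto simp: filterlim_iff)
  then have "\<forall>\<^sub>F z in at 0. norm (f (?D z)) \<le> (C * 2 ^ m) * norm z ^ m"
  proof eventually_elim
    case (elim z)
    have "C * norm (?D z) ^ m \<le> C * (2 * norm z) ^ m"
      using C(1) le by (intro mult_left_mono power_mono) auto
    then show ?case using elim by (simp add: power_mult_distrib)
  qed
  then show ?thesis by (auto simp: vanishes_def)
qed

lemma monomial_stretch:
  "monomial \<alpha> (\<chi> l. if l = i then 2 * z $ l else z $ l) = 2 ^ \<alpha> i * monomial \<alpha> z"
proof -
  have "monomial \<alpha> (\<chi> l. if l = i then 2 * z $ l else z $ l) =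
      (\<Prod>l\<in>UNIV. (if l = i then 2 ^ \<alpha> i else 1) * (z $ l) ^ \<alpha> l)"
    unfolding monomial_def by (intro prod.cong) (auto simp: power_mult_distrib)
  then show ?thesis by (simp add: monomial_def prod.distrib)
qed

text \<open>On the diagonal ray s (1, ..., 1) every monomial equals the power of s given by its
  degree. The assumption then bounds |c| by a constant times s, and s tends to 0 from the
  right.\<close>

lemma vanishes_monomial_imp_zero:
  assumes "vanishes (Suc m) (\<lambda>z. c * monomial \<alpha> z)" "mdegree \<alpha> \<le> m"
  shows "c = 0"
proof -
  let ?one = "1 :: complex ^ 'a"
  obtain C where C: "\<forall>\<^sub>F z in at 0. norm (c * monomial \<alpha> z) \<le> C * norm z ^ Suc (mdegree \<alpha>)"
    using vanishes_mono[OF assms(1), of "Suc (mdegree \<alpha>)"] assms(2) by (auto simp: vanishes_def)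
  have "((\<lambda>s. s *\<^sub>R ?one) \<longlongrightarrow> 0) (at_right 0)"
    by (auto intro!: tendsto_eq_intros)
  moreover have "\<forall>\<^sub>F s in at_right 0. s *\<^sub>R ?one \<noteq> 0"
    using eventually_at_right_less[of "0 :: real"] by eventually_elim (simp add: vec_eq_iff)
  ultimately have "filterlim (\<lambda>s. s *\<^sub>R ?one) (at 0) (at_right 0)"
    by (rule filterlim_atI)
  then have "\<forall>\<^sub>F s in at_right 0. norm (c * monomial \<alpha> (s *\<^sub>R ?one)) \<le> C * norm (s *\<^sub>R ?one) ^ Suc (mdegree \<alpha>)"
    using C by (auto simp: filterlim_iff)
  then have "\<forall>\<^sub>F s in at_right 0. norm c \<le> C * norm ?one ^ Suc (mdegree \<alpha>) * s"
    using eventually_at_right_less[of 0]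
  proof eventually_elim
    case (elim s)
    have "monomial \<alpha> (s *\<^sub>R ?one) = of_real s ^ mdegree \<alpha>"
      by (simp add: monomial_def power_sum del: scaleR_conv_of_real) (simp add: scaleR_conv_of_real)
    then have "norm c * s ^ mdegree \<alpha> \<le> (C * norm ?one ^ Suc (mdegree \<alpha>) * s) * s ^ mdegree \<alpha>"
      using elim by (simp add: norm_mult norm_power power_mult_distrib mult_ac)
    then show ?case using elim(2) by (simp add: mult_le_cancel_right)
  qed
  moreover have "((\<lambda>s. C * norm ?one ^ Suc (mdegree \<alpha>) * s) \<longlongrightarrow> 0) (at_right 0)"
    by (auto intro!: tendsto_eq_intros)
  ultimately have "norm c \<le> 0"
    by (intro tendsto_lowerbound) auto
  then show ?thesis by simp
qed

text \<open>Combining the polynomial with its pullback under doubling of one coordinate eliminates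
  one monomial.\<close>

lemma vanishes_polynomial_imp_zero:
  assumes "finite A" "\<And>\<alpha>. \<alpha> \<in> A \<Longrightarrow> mdegree \<alpha> \<le> m"
    and "vanishes (Suc m) (\<lambda>z. \<Sum>\<alpha>\<in>A. c \<alpha> * monomial \<alpha> z)" and "\<beta> \<in> A"
  shows "c \<beta> = 0"
  using assms
proof (induction "card A" arbitrary: A c rule: less_induct)
  case less
  show ?case
  proof (cases "A = {\<beta>}")
    case True
    then show ?thesis using less.prems by (auto intro: vanishes_monomial_imp_zero)
  next
    case False
    then obtain \<alpha> where \<alpha>: "\<alpha> \<in> A" "\<alpha> \<noteq> \<beta>" using less.prems(4) by auto
    then obtain i where i: "\<alpha> i \<noteq> \<beta> i" by auto
    let ?f = "\<lambda>z. \<Sum>\<alpha>\<in>A. c \<alpha> * monomial \<alpha> z"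
    let ?c = "\<lambda>\<gamma>. (2 ^ \<gamma> i - 2 ^ \<alpha> i) * c \<gamma>"
    have "vanishes (Suc m) (\<lambda>z. ?f (\<chi> l. if l = i then 2 * z $ l else z $ l) - 2 ^ \<alpha> i * ?f z)"
      using less.prems(3) by (intro vanishes_diff vanishes_cmult vanishes_stretch)
    moreover have "?f (\<chi> l. if l = i then 2 * z $ l else z $ l) - 2 ^ \<alpha> i * ?f z =
        (\<Sum>\<gamma>\<in>A - {\<alpha>}. ?c \<gamma> * monomial \<gamma> z)" for z
    proof -
      have "?f (\<chi> l. if l = i then 2 * z $ l else z $ l) - 2 ^ \<alpha> i * ?f z = (\<Sum>\<gamma>\<in>A. ?c \<gamma> * monomial \<gamma> z)"
        by (simp add: monomial_stretch sum_distrib_left sum_subtractf[symmetric] algebra_simps)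
      also have "\<dots> = (\<Sum>\<gamma>\<in>A - {\<alpha>}. ?c \<gamma> * monomial \<gamma> z)"
        using less.prems(1) \<alpha>(1) by (simp add: sum.remove)
      finally show ?thesis .
    qed
    ultimately have "vanishes (Suc m) (\<lambda>z. \<Sum>\<gamma>\<in>A - {\<alpha>}. ?c \<gamma> * monomial \<gamma> z)"
      by simp
    then have "?c \<beta> = 0"
      using less.hyps[of "A - {\<alpha>}" ?c] less.prems \<alpha> card_Diff1_less[of A \<alpha>] by auto
    moreover have "(2 ^ \<beta> i :: complex) \<noteq> 2 ^ \<alpha> i"
    proof
      assume "(2 ^ \<beta> i :: complex) = 2 ^ \<alpha> i"
      then have "norm (2 ^ \<beta> i :: complex) = norm (2 ^ \<alpha> i :: complex)" by simp
      then show False using i by (simp add: norm_power)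
    qed
    ultimately show ?thesis by simp
  qed
qed

section \<open>Polynomial families and families with holomorphic Taylor coefficients\<close>

text \<open>Polynomials in z over the ring of holomorphic functions on X. Generating them from
  monomials by addition gives closure properties by rule induction and a degree bound that is
  uniform in x.\<close>

inductive family_poly :: "('a, 'i) cspace \<Rightarrow> ('a \<Rightarrow> complex ^ 'n::finite \<Rightarrow> complex) \<Rightarrow> bool"
  for X where
  family_poly_monomial: "holomorphic_fun X c \<Longrightarrow> family_poly X (\<lambda>x z. c x * monomial \<alpha> z)"
| family_poly_add: "family_poly X f \<Longrightarrow> family_poly X g \<Longrightarrow> family_poly X (\<lambda>x z. f x z + g x z)"

lemma family_poly_param: "holomorphic_fun X c \<Longrightarrow> family_poly X (\<lambda>x z. c x)"
  using family_poly_monomial[of X c "\<lambda>_. 0"] by simp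

lemma family_poly_coordinate: "charts_in_coord_space X \<Longrightarrow> family_poly X (\<lambda>x z. z $ i)"
  using family_poly_monomial[OF holomorphic_fun_const[of X 1], of "unit_index i"]
  by (simp only: monomial_unit_index mult_1)

lemma family_poly_monomial_mult:
  "family_poly X f \<Longrightarrow> holomorphic_fun X c \<Longrightarrow> family_poly X (\<lambda>x z. c x * monomial \<alpha> z * f x z)"
proof (induction rule: family_poly.induct)
  case (family_poly_monomial d \<beta>)
  then have "family_poly X (\<lambda>x z. (c x * d x) * monomial (\<lambda>i. \<alpha> i + \<beta> i) z)"
    by (intro family_poly.intros holomorphic_fun_mult)
  then show ?case by (simp add: monomial_add mult_ac)
next
  case (family_poly_add f g)
  then show ?case
    using family_poly.intros(2)[of X "\<lambda>x z. c x * monomial \<alpha> z * f x z" "\<lambda>x z. c x * monomial \<alpha> z * g x z"]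
    by (simp add: algebra_simps)
qed

lemma family_poly_mult:
  "family_poly X f \<Longrightarrow> family_poly X g \<Longrightarrow> family_poly X (\<lambda>x z. f x z * g x z)"
proof (induction rule: family_poly.induct)
  case (family_poly_monomial c \<alpha>)
  then show ?case by (intro family_poly_monomial_mult)
next
  case (family_poly_add f f')
  then show ?case
    using family_poly.intros(2)[of X "\<lambda>x z. f x z * g x z" "\<lambda>x z. f' x z * g x z"]
    by (simp add: algebra_simps)
qed

lemma family_poly_power:
  "charts_in_coord_space X \<Longrightarrow> family_poly X f \<Longrightarrow> family_poly X (\<lambda>x z. f x z ^ m)"
  by (induction m) (auto intro: family_poly_mult family_poly_param holomorphic_fun_const)

lemma family_poly_prod:
  assumes "charts_in_coord_space X" "\<And>i. i \<in> S \<Longrightarrow> family_poly X (f i)"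
  shows "family_poly X (\<lambda>x z. \<Prod>i\<in>S. f i x z)"
  using assms(2) by (induction S rule: infinite_finite_induct)
    (auto intro: family_poly_mult family_poly_param holomorphic_fun_const[OF assms(1)])

lemma family_poly_monomial_compose:
  assumes "charts_in_coord_space X" "\<And>i. family_poly X (\<lambda>x z. F x z $ i)"
  shows "family_poly X (\<lambda>x z. monomial \<alpha> (F x z))"
  unfolding monomial_def by (intro family_poly_prod family_poly_power assms)

lemma family_poly_vanishes_0: "family_poly X f \<Longrightarrow> vanishes 0 (f x)"
  by (induction rule: family_poly.induct)
     (auto intro: vanishes_add vanishes_cmult vanishes_mono[OF vanishes_monomial])

text \<open>Allowing every truncation degree beyond a threshold lets two expansions be added at a
  common degree. The threshold does not depend on x.\<close>

lemma family_poly_expand: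
  assumes X: "charts_in_coord_space X" and "family_poly X f"
  shows "\<exists>b N. (\<forall>\<alpha>. holomorphic_fun X (\<lambda>x. b x \<alpha>)) \<and>
    (\<forall>M\<ge>N. \<forall>x z. f x z = (\<Sum>\<alpha> | mdegree \<alpha> \<le> M. b x \<alpha> * monomial \<alpha> z))"
  using assms(2)
proof (induction rule: family_poly.induct)
  case (family_poly_monomial c \<beta>)
  let ?b = "\<lambda>x \<alpha>. if \<alpha> = \<beta> then c x else 0"
  have "holomorphic_fun X (\<lambda>x. ?b x \<alpha>)" for \<alpha>
    using family_poly_monomial holomorphic_fun_const[OF X] by (cases "\<alpha> = \<beta>") simp_all
  moreover have "c x * monomial \<beta> z = (\<Sum>\<alpha> | mdegree \<alpha> \<le> M. ?b x \<alpha> * monomial \<alpha> z)"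
    if "M \<ge> mdegree \<beta>" for M x z
  proof -
    have "(\<Sum>\<alpha> | mdegree \<alpha> \<le> M. ?b x \<alpha> * monomial \<alpha> z) =
        (\<Sum>\<alpha> | mdegree \<alpha> \<le> M. if \<alpha> = \<beta> then c x * monomial \<beta> z else 0)"
      by (intro sum.cong) auto
    also have "\<dots> = c x * monomial \<beta> z"
      using that finite_mdegree_le by (subst sum.delta) auto
    finally show ?thesis ..
  qed
  ultimately show ?case by (intro exI[of _ ?b] exI[of _ "mdegree \<beta>"] conjI allI impI)
next
  case (family_poly_add f g)
  then obtain b N b' N' where b: "\<forall>\<alpha>. holomorphic_fun X (\<lambda>x. b x \<alpha>)"
      "\<forall>M\<ge>N. \<forall>x z. f x z = (\<Sum>\<alpha> | mdegree \<alpha> \<le> M. b x \<alpha> * monomial \<alpha> z)"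
    and b': "\<forall>\<alpha>. holomorphic_fun X (\<lambda>x. b' x \<alpha>)"
      "\<forall>M\<ge>N'. \<forall>x z. g x z = (\<Sum>\<alpha> | mdegree \<alpha> \<le> M. b' x \<alpha> * monomial \<alpha> z)"
    by blast
  show ?case
  proof (intro exI conjI allI impI)
    fix M x z assume "max N N' \<le> M"
    then show "f x z + g x z = (\<Sum>\<alpha> | mdegree \<alpha> \<le> M. (b x \<alpha> + b' x \<alpha>) * monomial \<alpha> z)"
      using b(2)[rule_format, of M x z] b'(2)[rule_format, of M x z]
      by (simp add: distrib_right sum.distrib)
  qed (use b b' in \<open>auto intro: holomorphic_fun_add\<close>)
qed

text \<open>Encodes that the Taylor coefficients in z depend holomorphically on x, without
  derivatives or Cauchy integrals. The property is stable under products and exponentials, so it can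
  be carried through compositions.\<close>

definition has_jets :: "('a, 'i) cspace \<Rightarrow> ('a \<Rightarrow> complex ^ 'n::finite \<Rightarrow> complex) \<Rightarrow> bool" where
  "has_jets X f \<longleftrightarrow> (\<forall>k. \<exists>p. family_poly X p \<and>
     (\<forall>x \<in> topspace (cs_top X). vanishes (Suc k) (\<lambda>z. f x z - p x z)))"

lemma family_poly_has_jets: "family_poly X f \<Longrightarrow> has_jets X f"
  unfolding has_jets_def by (auto intro!: exI[of _ f])

lemma has_jets_param: "holomorphic_fun X c \<Longrightarrow> has_jets X (\<lambda>x z. c x)"
  by (intro family_poly_has_jets family_poly_param)

lemma has_jets_add:
  assumes "has_jets X f" "has_jets X g"
  shows "has_jets X (\<lambda>x z. f x z + g x z)"
  unfolding has_jets_def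
proof
  fix k
  obtain p where p: "family_poly X p"
    "\<forall>x \<in> topspace (cs_top X). vanishes (Suc k) (\<lambda>z. f x z - p x z)"
    using assms(1) by (auto simp: has_jets_def)
  obtain q where q: "family_poly X q"
    "\<forall>x \<in> topspace (cs_top X). vanishes (Suc k) (\<lambda>z. g x z - q x z)"
    using assms(2) by (auto simp: has_jets_def)
  have "vanishes (Suc k) (\<lambda>z. f x z + g x z - (p x z + q x z))" if "x \<in> topspace (cs_top X)" for x
    using vanishes_add[of "Suc k" "\<lambda>z. f x z - p x z" "\<lambda>z. g x z - q x z"] p q that
    by (simp add: algebra_simps)
  then show "\<exists>p. family_poly X p \<and>
     (\<forall>x \<in> topspace (cs_top X). vanishes (Suc k) (\<lambda>z. f x z + g x z - p x z))"
    using family_poly_add[OF p(1) q(1)] by (intro exI conjI ballI)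
qed

lemma has_jets_mult:
  assumes "has_jets X f" "has_jets X g"
  shows "has_jets X (\<lambda>x z. f x z * g x z)"
  unfolding has_jets_def
proof
  fix k
  obtain p where p: "family_poly X p"
    "\<forall>x \<in> topspace (cs_top X). vanishes (Suc k) (\<lambda>z. f x z - p x z)"
    using assms(1) by (auto simp: has_jets_def)
  obtain q where q: "family_poly X q"
    "\<forall>x \<in> topspace (cs_top X). vanishes (Suc k) (\<lambda>z. g x z - q x z)"
    using assms(2) by (auto simp: has_jets_def)
  have "vanishes (Suc k) (\<lambda>z. f x z * g x z - (p x z * q x z))" if x: "x \<in> topspace (cs_top X)" for x
  proof -
    let ?u = "\<lambda>z. f x z - p x z" and ?v = "\<lambda>z. g x z - q x z"
    have u: "vanishes (Suc k) ?u" and v: "vanishes (Suc k) ?v"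
      using p q x by auto
    \<comment> \<open>With f = p + u and g = q + v, the difference f g - p q is the sum of these
      three products. Each has a factor of order k + 1, and p and q are bounded near the
      origin.\<close>
    have "vanishes (Suc k) (\<lambda>z. ?u z * ?v z + ?u z * q x z + p x z * ?v z)"
    proof (intro vanishes_add)
      show "vanishes (Suc k) (\<lambda>z. ?u z * ?v z)"
        by (rule vanishes_mono[OF vanishes_mult[OF u v]]) simp
      show "vanishes (Suc k) (\<lambda>z. ?u z * q x z)"
        by (rule vanishes_mono[OF vanishes_mult[OF u family_poly_vanishes_0[OF q(1)]]]) simp
      show "vanishes (Suc k) (\<lambda>z. p x z * ?v z)"
        by (rule vanishes_mono[OF vanishes_mult[OF family_poly_vanishes_0[OF p(1)] v]]) simp
    qed
    then show ?thesis by (simp add: algebra_simps)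
  qed
  then show "\<exists>p. family_poly X p \<and>
     (\<forall>x \<in> topspace (cs_top X). vanishes (Suc k) (\<lambda>z. f x z * g x z - p x z))"
    using family_poly_mult[OF p(1) q(1)] by (intro exI conjI ballI)
qed

lemma has_jets_power:
  "charts_in_coord_space X \<Longrightarrow> has_jets X f \<Longrightarrow> has_jets X (\<lambda>x z. f x z ^ m)"
  by (induction m)
     (auto intro: has_jets_mult has_jets_param holomorphic_fun_const)

lemma has_jets_prod:
  assumes "charts_in_coord_space X" "\<And>i. i \<in> S \<Longrightarrow> has_jets X (f i)"
  shows "has_jets X (\<lambda>x z. \<Prod>i\<in>S. f i x z)"
  using assms(2) by (induction S rule: infinite_finite_induct)
    (auto intro: has_jets_mult has_jets_param holomorphic_fun_const[OF assms(1)])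

lemma has_jets_sum:
  assumes "charts_in_coord_space X" "\<And>i. i \<in> S \<Longrightarrow> has_jets X (f i)"
  shows "has_jets X (\<lambda>x z. \<Sum>i\<in>S. f i x z)"
  using assms(2) by (induction S rule: infinite_finite_induct)
    (auto intro: has_jets_add has_jets_param holomorphic_fun_const[OF assms(1)])

lemma has_jets_monomial_compose:
  assumes "charts_in_coord_space X" "\<And>i. has_jets X (\<lambda>x z. F x z $ i)"
  shows "has_jets X (\<lambda>x z. monomial \<alpha> (F x z))"
  unfolding monomial_def by (intro has_jets_prod has_jets_power assms)

text \<open>Since \<open>u x\<close> vanishes at the origin, the powers of \<open>u x\<close> beyond
  the k-th only contribute O(|z|^(k+1)), so the exponential series may be truncated after its k-th
  term.\<close>

lemma has_jets_exp:
  assumes X: "charts_in_coord_space X" and u: "has_jets X u"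
    and u0: "\<And>x. x \<in> topspace (cs_top X) \<Longrightarrow> vanishes 1 (u x)"
  shows "has_jets X (\<lambda>x z. exp (u x z))"
  unfolding has_jets_def
proof
  fix k
  have "has_jets X (\<lambda>x z. \<Sum>j\<le>k. inverse (fact j) * u x z ^ j)"
    by (intro has_jets_sum has_jets_mult has_jets_power X u has_jets_param
        holomorphic_fun_const)
  then obtain p where p: "family_poly X p" "\<forall>x \<in> topspace (cs_top X).
      vanishes (Suc k) (\<lambda>z. (\<Sum>j\<le>k. inverse (fact j) * u x z ^ j) - p x z)"
    unfolding has_jets_def by blast
  have "vanishes (Suc k) (\<lambda>z. exp (u x z) - p x z)" if x: "x \<in> topspace (cs_top X)" for x
  proof (rule vanishes_trans)
    show "vanishes (Suc k) (\<lambda>z. exp (u x z) - (\<Sum>j\<le>k. inverse (fact j) * u x z ^ j))"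
      using vanishes_exp_remainder[OF u0[OF x], of k] by (simp add: field_simps)
  qed (use p x in auto)
  then show "\<exists>p. family_poly X p \<and>
     (\<forall>x \<in> topspace (cs_top X). vanishes (Suc k) (\<lambda>z. exp (u x z) - p x z))"
    using p(1) by blast
qed

lemma vanishes_polynomial_tail:
  assumes "k \<le> M"
  shows "vanishes (Suc k) (\<lambda>z. (\<Sum>\<alpha> | mdegree \<alpha> \<le> M. b \<alpha> * monomial \<alpha> z) -
    (\<Sum>\<alpha> | mdegree \<alpha> \<le> k. b \<alpha> * monomial \<alpha> z))"
proof -
  have "(\<Sum>\<alpha> | mdegree \<alpha> \<le> M. b \<alpha> * monomial \<alpha> z) - (\<Sum>\<alpha> | mdegree \<alpha> \<le> k. b \<alpha> * monomial \<alpha> z) =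
    (\<Sum>\<alpha>\<in>{\<alpha>. mdegree \<alpha> \<le> M} - {\<alpha>. mdegree \<alpha> \<le> k}. b \<alpha> * monomial \<alpha> z)" for z
    using assms finite_mdegree_le by (subst sum_diff) auto
  moreover have "vanishes (Suc k)
      (\<lambda>z. \<Sum>\<alpha>\<in>{\<alpha>. mdegree \<alpha> \<le> M} - {\<alpha>. mdegree \<alpha> \<le> k}. b \<alpha> * monomial \<alpha> z)"
    by (intro vanishes_sum vanishes_cmult) (auto intro: vanishes_mono[OF vanishes_monomial])
  ultimately show ?thesis by simp
qed

lemma has_jets_expand:
  assumes X: "charts_in_coord_space X" and "has_jets X f"
  shows "\<exists>b. (\<forall>\<alpha>. holomorphic_fun X (\<lambda>x. b x \<alpha>)) \<and> (\<forall>x \<in> topspace (cs_top X).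
     vanishes (Suc k) (\<lambda>z. f x z - (\<Sum>\<alpha> | mdegree \<alpha> \<le> k. b x \<alpha> * monomial \<alpha> z)))"
proof -
  obtain p where p: "family_poly X p"
    "\<forall>x \<in> topspace (cs_top X). vanishes (Suc k) (\<lambda>z. f x z - p x z)"
    using assms(2) by (auto simp: has_jets_def)
  obtain b N where b: "\<forall>\<alpha>. holomorphic_fun X (\<lambda>x. b x \<alpha>)"
    "\<And>M x z. M \<ge> N \<Longrightarrow> p x z = (\<Sum>\<alpha> | mdegree \<alpha> \<le> M. b x \<alpha> * monomial \<alpha> z)"
    using family_poly_expand[OF X p(1)] by blast
  \<comment> \<open>The degree \<open>max k N\<close> is large enough both for the expansion of
    \<open>p\<close> to be exact and for the truncation to degree k to discard only higher
    terms.\<close>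
  have tail: "vanishes (Suc k) (\<lambda>z. p x z - (\<Sum>\<alpha> | mdegree \<alpha> \<le> k. b x \<alpha> * monomial \<alpha> z))" for x
    using vanishes_polynomial_tail[of k "max k N" "b x"] b(2)[of "max k N" x] by simp
  show ?thesis
  proof (intro exI conjI ballI)
    show "vanishes (Suc k) (\<lambda>z. f x z - (\<Sum>\<alpha> | mdegree \<alpha> \<le> k. b x \<alpha> * monomial \<alpha> z))"
      if "x \<in> topspace (cs_top X)" for x
      by (rule vanishes_trans[OF p(2)[rule_format, OF that] tail])
  qed (rule b(1))
qed

section \<open>Shears and overshears\<close>

definition shear :: "'n \<Rightarrow> ('n \<Rightarrow> nat) \<Rightarrow> complex \<Rightarrow> complex ^ 'n::finite \<Rightarrow> complex ^ 'n" where
  "shear i \<alpha> c w = (\<chi> l. w $ l + (if l = i then c * monomial \<alpha> w else 0))"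

definition overshear :: "'n \<Rightarrow> ('n \<Rightarrow> nat) \<Rightarrow> complex \<Rightarrow> complex ^ 'n::finite \<Rightarrow> complex ^ 'n" where
  "overshear i \<alpha> c w = (\<chi> l. w $ l * (if l = i then exp (c * monomial \<alpha> w) else 1))"

lemma shear_nth: "shear i \<alpha> c w $ l = w $ l + (if l = i then c * monomial \<alpha> w else 0)"
  by (simp add: shear_def)

lemma overshear_nth: "overshear i \<alpha> c w $ l = w $ l * (if l = i then exp (c * monomial \<alpha> w) else 1)"
  by (simp add: overshear_def)

lemma monomial_cong_off:
  assumes "\<alpha> i = 0" "\<And>l. l \<noteq> i \<Longrightarrow> w $ l = w' $ l"
  shows "monomial \<alpha> w = monomial \<alpha> w'"
  unfolding monomial_def
proof (intro prod.cong refl)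
  fix l show "w $ l ^ \<alpha> l = w' $ l ^ \<alpha> l"
    using assms by (cases "l = i") auto
qed

lemma monomial_shear: "\<alpha> i = 0 \<Longrightarrow> monomial \<alpha> (shear i \<beta> c w) = monomial \<alpha> w"
  by (rule monomial_cong_off) (auto simp: shear_nth)

lemma monomial_overshear: "\<alpha> i = 0 \<Longrightarrow> monomial \<alpha> (overshear i \<beta> c w) = monomial \<alpha> w"
  by (rule monomial_cong_off) (auto simp: overshear_nth)

text \<open>With \<open>\<alpha> i = 0\<close> the monomial does not see the coordinate that the
  shear changes, so the very same term is subtracted again.\<close>

lemma shear_inverse: "\<alpha> i = 0 \<Longrightarrow> shear i \<alpha> (- c) (shear i \<alpha> c w) = w"
  by (simp add: vec_eq_iff shear_nth monomial_shear)

lemma overshear_inverse: "\<alpha> i = 0 \<Longrightarrow> overshear i \<alpha> (- c) (overshear i \<alpha> c w) = w"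
  by (simp add: vec_eq_iff overshear_nth monomial_overshear exp_add[symmetric] mult.assoc)

section \<open>Holomorphy of shears, overshears and linear maps, and the automorphisms they
  define\<close>

lemma holomorphic_map_nth: "holomorphic_map Y H \<Longrightarrow> holomorphic_fun Y (\<lambda>y. H y $ i)"
  by (simp add: holomorphic_map_def)

lemma holomorphic_fun_monomial_compose:
  assumes "charts_in_coord_space Y" "holomorphic_map Y H"
  shows "holomorphic_fun Y (\<lambda>y. monomial \<alpha> (H y))"
  unfolding monomial_def
  by (intro holomorphic_fun_prod holomorphic_fun_power holomorphic_map_nth assms)

text \<open>The parameter varies over an arbitrary space \<open>Y\<close>. For \<open>Y\<close>
  affine this treats single automorphisms, and for \<open>Y\<close> the product of X with affine
  space it gives joint holomorphy in (x, z).\<close>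

lemma holomorphic_map_shear:
  assumes "charts_in_coord_space Y" "holomorphic_map Y H" "holomorphic_fun Y c"
  shows "holomorphic_map Y (\<lambda>y. shear i \<alpha> (c y) (H y))"
  unfolding holomorphic_map_def shear_nth
proof
  fix l show "holomorphic_fun Y (\<lambda>y. H y $ l + (if l = i then c y * monomial \<alpha> (H y) else 0))"
    using holomorphic_fun_add[OF holomorphic_map_nth[OF assms(2)]
        holomorphic_fun_mult[OF assms(3) holomorphic_fun_monomial_compose[OF assms(1,2)]]]
      holomorphic_map_nth[OF assms(2)] by (cases "l = i") simp_all
qed

lemma holomorphic_map_overshear:
  assumes "charts_in_coord_space Y" "holomorphic_map Y H" "holomorphic_fun Y c"
  shows "holomorphic_map Y (\<lambda>y. overshear i \<alpha> (c y) (H y))"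
  unfolding holomorphic_map_def overshear_nth
proof
  fix l show "holomorphic_fun Y (\<lambda>y. H y $ l * (if l = i then exp (c y * monomial \<alpha> (H y)) else 1))"
    using holomorphic_fun_mult[OF holomorphic_map_nth[OF assms(2)] holomorphic_fun_exp[OF
        holomorphic_fun_mult[OF assms(3) holomorphic_fun_monomial_compose[OF assms(1,2)]]]]
      holomorphic_map_nth[OF assms(2)] by (cases "l = i") simp_all
qed

lemma holomorphic_map_matrix_vector_mult:
  assumes "charts_in_coord_space Y" "holomorphic_map Y H" "\<And>i j. holomorphic_fun Y (\<lambda>y. M y $ i $ j)"
  shows "holomorphic_map Y (\<lambda>y. M y *v H y)"
  unfolding holomorphic_map_def matrix_vector_mult_def vec_lambda_beta
  by (intro allI holomorphic_fun_sum holomorphic_fun_mult holomorphic_map_nth assms)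

text \<open>Asking for stability under composition, rather than holomorphy, avoids the composition theorem
  for separately holomorphic functions.\<close>

definition holomorphic_stable :: "(complex ^ 'n::finite \<Rightarrow> complex ^ 'n) \<Rightarrow> bool" where
  "holomorphic_stable G \<longleftrightarrow>
     (\<forall>H :: complex ^ 'n \<Rightarrow> complex ^ 'n. holomorphic_map affine_cspace H \<longrightarrow> holomorphic_map affine_cspace (\<lambda>z. G (H z)))"

definition stable_aut :: "(complex ^ 'n::finite \<Rightarrow> complex ^ 'n) \<Rightarrow> bool" where
  "stable_aut f \<longleftrightarrow> bij f \<and> holomorphic_stable f \<and> holomorphic_stable (inv f)"

lemma holomorphic_stable_imp_holomorphic: "holomorphic_stable G \<Longrightarrow> holomorphic_map affine_cspace G"
  unfolding holomorphic_stable_def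
  using holomorphic_fun_coordinate by (auto simp: holomorphic_map_def dest: spec[of _ "\<lambda>z. z"])

lemma stable_aut_imp_Aut: "stable_aut f \<Longrightarrow> f \<in> Aut"
  by (simp add: stable_aut_def Aut_def holomorphic_stable_imp_holomorphic)

lemma stable_autI:
  assumes "\<And>z. g (f z) = z" "\<And>z. f (g z) = z" "holomorphic_stable f" "holomorphic_stable g"
  shows "stable_aut f"
proof -
  have "bij f" using assms by (intro o_bij[of g]) (auto simp: fun_eq_iff)
  moreover have "inv f = g" using assms by (intro inv_equality) auto
  ultimately show ?thesis using assms by (simp add: stable_aut_def)
qed

lemma stable_aut_compose:
  assumes "stable_aut f" "stable_aut g"
  shows "stable_aut (\<lambda>z. f (g z))"
proof (rule stable_autI)
  have f: "bij f" and g: "bij g"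
    using assms by (auto simp: stable_aut_def)
  show "inv g (inv f (f (g z))) = z" "f (g (inv g (inv f z))) = z" for z
    using f g by (simp_all add: bij_is_inj bij_is_surj surj_f_inv_f)
  show "holomorphic_stable (\<lambda>z. f (g z))" "holomorphic_stable (\<lambda>z. inv g (inv f z))"
    using assms by (auto simp: stable_aut_def holomorphic_stable_def)
qed

lemma stable_aut_id: "stable_aut (\<lambda>z. z)"
  by (rule stable_autI[where g = "\<lambda>z. z"]) (auto simp: holomorphic_stable_def)

lemma holomorphic_stable_shear: "holomorphic_stable (shear i \<alpha> c)"
  unfolding holomorphic_stable_def
  by (intro allI impI holomorphic_map_shear charts_in_coord_space_affine holomorphic_fun_const)

lemma holomorphic_stable_overshear: "holomorphic_stable (overshear i \<alpha> c)"
  unfolding holomorphic_stable_def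
  by (intro allI impI holomorphic_map_overshear charts_in_coord_space_affine holomorphic_fun_const)

lemma holomorphic_stable_linear: "holomorphic_stable (\<lambda>z. M *v z)"
  unfolding holomorphic_stable_def
  by (intro allI impI holomorphic_map_matrix_vector_mult charts_in_coord_space_affine
      holomorphic_fun_const)

lemma stable_aut_shear: "\<alpha> i = 0 \<Longrightarrow> stable_aut (shear i \<alpha> c)"
  by (rule stable_autI[where g = "shear i \<alpha> (- c)"])
     (use shear_inverse[of \<alpha> i c] shear_inverse[of \<alpha> i "- c"] in \<open>simp_all add: holomorphic_stable_shear\<close>)

lemma stable_aut_overshear: "\<alpha> i = 0 \<Longrightarrow> stable_aut (overshear i \<alpha> c)"
  by (rule stable_autI[where g = "overshear i \<alpha> (- c)"])
     (use overshear_inverse[of \<alpha> i c] overshear_inverse[of \<alpha> i "- c"] in \<open>simp_all add: holomorphic_stable_overshear\<close>)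

lemma stable_aut_linear:
  assumes "M ** N = mat 1" "N ** M = mat 1"
  shows "stable_aut (\<lambda>z. M *v z)"
  by (rule stable_autI[where g = "\<lambda>z. N *v z"])
     (use assms in \<open>simp_all add: holomorphic_stable_linear matrix_vector_mul_assoc\<close>)


section \<open>Derivatives and Jacobians\<close>

text \<open>The componentwise criterion for real Euclidean spaces tests against the real basis. Each
  basis vector is an \<open>axis i u\<close>, and the inner product with it is a real linear
  function of the i-th complex coordinate.\<close>

lemma has_derivative_cvec_iff:
  fixes f :: "'a::real_normed_vector \<Rightarrow> complex ^ 'n"
  shows "(f has_derivative f') (at a) \<longleftrightarrow> (\<forall>i. ((\<lambda>x. f x $ i) has_derivative (\<lambda>h. f' h $ i)) (at a))"
proof
  assume "(f has_derivative f') (at a)"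
  then show "\<forall>i. ((\<lambda>x. f x $ i) has_derivative (\<lambda>h. f' h $ i)) (at a)"
    by (auto intro: bounded_linear.has_derivative[OF bounded_linear_vec_nth])
next
  assume *: "\<forall>i. ((\<lambda>x. f x $ i) has_derivative (\<lambda>h. f' h $ i)) (at a)"
  show "(f has_derivative f') (at a)"
    unfolding has_derivative_componentwise_within[of f f' a UNIV]
  proof
    fix b :: "complex ^ 'n" assume "b \<in> Basis"
    then obtain i u where b: "b = axis i u" by (auto simp: Basis_vec_def)
    show "((\<lambda>x. f x \<bullet> b) has_derivative (\<lambda>x. f' x \<bullet> b)) (at a)"
      using * by (auto simp: b inner_axis intro!: has_derivative_inner_left)
  qed
qed

text \<open>The partial derivative of the monomial in direction j. When
  \<open>\<alpha> j = 0\<close> the truncated subtraction does no harm, since the factor in front is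
  0.\<close>

definition monomial_pd :: "'n \<Rightarrow> ('n \<Rightarrow> nat) \<Rightarrow> complex ^ 'n::finite \<Rightarrow> complex" where
  "monomial_pd j \<alpha> z = of_nat (\<alpha> j) * monomial (\<alpha>(j := \<alpha> j - 1)) z"

lemma monomial_upd_remove:
  "monomial (\<alpha>(i := m)) z = (z $ i) ^ m * (\<Prod>l\<in>UNIV - {i}. (z $ l) ^ \<alpha> l)"
  unfolding monomial_def by (subst prod.remove[of _ i]) (auto intro!: prod.cong)

lemma has_derivative_monomial:
  "(monomial \<alpha> has_derivative (\<lambda>h. \<Sum>j\<in>UNIV. monomial_pd j \<alpha> z * h $ j)) (at z)"
proof -
  have "((\<lambda>z. \<Prod>j\<in>UNIV. (z $ j) ^ \<alpha> j) has_derivative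
      (\<lambda>h. \<Sum>j\<in>UNIV. (of_nat (\<alpha> j) * h $ j * (z $ j) ^ (\<alpha> j - 1)) * (\<Prod>l\<in>UNIV - {j}. (z $ l) ^ \<alpha> l))) (at z)"
    by (intro has_derivative_prod has_derivative_power bounded_linear_imp_has_derivative bounded_linear_vec_nth)
  moreover have "(\<lambda>z. \<Prod>j\<in>UNIV. (z $ j) ^ \<alpha> j) = monomial \<alpha>"
    by (simp add: fun_eq_iff monomial_def)
  ultimately show ?thesis
    by (simp add: monomial_pd_def monomial_upd_remove mult_ac)
qed

lemma matrix_nth: "matrix f $ i $ j = f (axis j 1) $ i"
  by (simp add: matrix_def)

text \<open>The chain rule changes only row i of the Jacobian matrix, by a linear combination of the
  rows. The coefficient of row i itself is the derivative of the monomial in direction i, which is 0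
  because \<open>\<alpha> i = 0\<close>, so the determinant stays the same.\<close>

lemma shear_unimodular:
  assumes F: "(F has_derivative D) (at z)" "det (matrix D) = 1" and \<alpha>: "\<alpha> i = 0"
  shows "\<exists>D'. ((\<lambda>z. shear i \<alpha> c (F z)) has_derivative D') (at z) \<and> det (matrix D') = 1"
proof -
  let ?p = "\<lambda>j. c * monomial_pd j \<alpha> (F z)"
  let ?D = "\<lambda>h. \<chi> l. D h $ l + (if l = i then \<Sum>j\<in>UNIV. ?p j * D h $ j else 0)"
  have "((\<lambda>z. monomial \<alpha> (F z)) has_derivative (\<lambda>h. \<Sum>j\<in>UNIV. monomial_pd j \<alpha> (F z) * D h $ j)) (at z)"
    by (rule has_derivative_compose[OF F(1) has_derivative_monomial])
  then have m: "((\<lambda>z. c * monomial \<alpha> (F z)) has_derivative (\<lambda>h. \<Sum>j\<in>UNIV. ?p j * D h $ j)) (at z)"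
    by (auto dest: has_derivative_mult_right[of _ _ _ c] simp: sum_distrib_left mult_ac)
  have Fi: "((\<lambda>z. F z $ l) has_derivative (\<lambda>h. D h $ l)) (at z)" for l
    using F(1) has_derivative_cvec_iff by blast
  have "((\<lambda>z. shear i \<alpha> c (F z)) has_derivative ?D) (at z)"
    unfolding has_derivative_cvec_iff shear_nth vec_lambda_beta
  proof
    fix l show "((\<lambda>z. F z $ l + (if l = i then c * monomial \<alpha> (F z) else 0)) has_derivative
        (\<lambda>h. D h $ l + (if l = i then \<Sum>j\<in>UNIV. ?p j * D h $ j else 0))) (at z)"
      using has_derivative_add[OF Fi m, of l] Fi[of l] by (cases "l = i") simp_all
  qed
  moreover have "det (matrix ?D) = det (matrix D)"
  proof -
    let ?x = "\<Sum>j\<in>UNIV - {i}. ?p j *s row j (matrix D)"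
    have "?p i = 0" using \<alpha> by (simp add: monomial_pd_def)
    then have "matrix ?D = (\<chi> k. if k = i then row i (matrix D) + ?x else row k (matrix D))"
      by (auto simp: vec_eq_iff matrix_nth row_def sum_component sum.remove[of UNIV i])
    moreover have "?x \<in> vec.span {row j (matrix D) |j. j \<noteq> i}"
      by (intro vec.span_sum vec.span_scale vec.span_base) auto
    ultimately show ?thesis by (simp only: det_row_span)
  qed
  ultimately show ?thesis using F(2) by auto
qed


section \<open>Holomorphic families generated by shears and overshears\<close>

text \<open>The flag vp restricts to volume preserving families.\<close>

inductive aut_family :: "('a, 'i) cspace \<Rightarrow> bool \<Rightarrow> ('a \<Rightarrow> complex ^ 'n::finite \<Rightarrow> complex ^ 'n) \<Rightarrow> bool"
  for X vp where
  aut_family_id: "aut_family X vp (\<lambda>x z. z)"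
| aut_family_shear: "aut_family X vp F \<Longrightarrow> holomorphic_fun X c \<Longrightarrow> \<alpha> i = 0 \<Longrightarrow> mdegree \<alpha> \<ge> 1 \<Longrightarrow>
    aut_family X vp (\<lambda>x z. shear i \<alpha> (c x) (F x z))"
| aut_family_overshear: "\<not> vp \<Longrightarrow> aut_family X vp F \<Longrightarrow> holomorphic_fun X c \<Longrightarrow> \<alpha> i = 0 \<Longrightarrow>
    mdegree \<alpha> \<ge> 1 \<Longrightarrow> aut_family X vp (\<lambda>x z. overshear i \<alpha> (c x) (F x z))"

lemma aut_family_stable_aut: "aut_family X vp F \<Longrightarrow> stable_aut (F x)"
  by (induction rule: aut_family.induct)
     (auto intro: stable_aut_id stable_aut_compose[OF stable_aut_shear]
       stable_aut_compose[OF stable_aut_overshear])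

lemma holomorphic_fun_param:
  "holomorphic_fun X c \<Longrightarrow> holomorphic_fun (prod_cspace X affine_cspace) (\<lambda>p. c (fst p))"
  using holomorphic_fun_fst[OF _ charts_in_coord_space_affine] by (simp add: case_prod_unfold)

lemma aut_family_holomorphic:
  assumes X: "charts_in_coord_space X" and F: "aut_family X vp F"
  shows "holomorphic_map (prod_cspace X affine_cspace) (\<lambda>p. F (fst p) (snd p))"
  using F
proof (induction rule: aut_family.induct)
  case aut_family_id
  show ?case
    unfolding holomorphic_map_def
    by (intro allI holomorphic_fun_snd_coordinate[OF X, unfolded case_prod_unfold])
next
  case aut_family_shear
  then show ?case
    by (intro holomorphic_map_shear holomorphic_fun_param charts_in_coord_space_prod X
        charts_in_coord_space_affine)
next
  case aut_family_overshear
  then show ?case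
    by (intro holomorphic_map_overshear holomorphic_fun_param charts_in_coord_space_prod X
        charts_in_coord_space_affine)
qed

lemma vanishes_monomial_compose:
  assumes "\<And>i. vanishes 1 (\<lambda>z. F z $ i)"
  shows "vanishes (mdegree \<alpha>) (\<lambda>z. monomial \<alpha> (F z))"
  unfolding monomial_def by (rule vanishes_prod) (use vanishes_power[OF assms, of "\<alpha> i" i for i] in simp)

text \<open>Positive degree of the monomials keeps the origin fixed. This makes the arguments of the
  exponentials vanish at the origin, as \<open>has_jets_exp\<close> demands.\<close>

lemma aut_family_vanishes: "aut_family X vp F \<Longrightarrow> vanishes 1 (\<lambda>z. F x z $ i)"
proof (induction arbitrary: i rule: aut_family.induct)
  case aut_family_id
  show ?case by (rule vanishes_coordinate)
next
  case (aut_family_shear F c \<alpha> j)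
  have "vanishes 1 (\<lambda>z. monomial \<alpha> (F x z))"
    using vanishes_monomial_compose[of "F x" \<alpha>] aut_family_shear by (auto intro: vanishes_mono)
  from vanishes_add[OF aut_family_shear.IH vanishes_cmult[OF this]]
  show ?case
    using aut_family_shear by (cases "i = j") (simp_all add: shear_nth)
next
  case (aut_family_overshear F c \<alpha> j)
  have "vanishes 1 (\<lambda>z. monomial \<alpha> (F x z))"
    using vanishes_monomial_compose[of "F x" \<alpha>] aut_family_overshear by (auto intro: vanishes_mono)
  then have "vanishes 1 (\<lambda>z. exp (c x * monomial \<alpha> (F x z)) - 1)"
    using vanishes_exp_remainder[of 1 _ 0] vanishes_cmult by fastforce
  then have "vanishes 0 (\<lambda>z. exp (c x * monomial \<alpha> (F x z)) - 1 + 1)"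
    by (intro vanishes_add vanishes_const) (auto intro: vanishes_mono)
  then have "vanishes (1 + 0) (\<lambda>z. F x z $ i * exp (c x * monomial \<alpha> (F x z)))"
    using aut_family_overshear by (intro vanishes_mult) auto
  then show ?case
    using aut_family_overshear by (cases "i = j") (auto simp: overshear_nth)
qed

lemma aut_family_has_jets:
  assumes X: "charts_in_coord_space X" and F: "aut_family X vp F"
  shows "has_jets X (\<lambda>x z. F x z $ i)"
  using F
proof (induction arbitrary: i rule: aut_family.induct)
  case aut_family_id
  show ?case by (intro family_poly_has_jets family_poly_coordinate X)
next
  case (aut_family_shear F c \<alpha> j)
  have "has_jets X (\<lambda>x z. c x * monomial \<alpha> (F x z))"
    using aut_family_shear by (intro has_jets_mult has_jets_param has_jets_monomial_compose X)
  then show ?case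
    using aut_family_shear has_jets_add by (cases "i = j") (auto simp: shear_nth)
next
  case (aut_family_overshear F c \<alpha> j)
  have "has_jets X (\<lambda>x z. exp (c x * monomial \<alpha> (F x z)))"
  proof (rule has_jets_exp[OF X])
    show "has_jets X (\<lambda>x z. c x * monomial \<alpha> (F x z))"
      using aut_family_overshear by (intro has_jets_mult has_jets_param has_jets_monomial_compose X)
    show "vanishes 1 (\<lambda>z. c x * monomial \<alpha> (F x z))" for x
      using vanishes_monomial_compose[OF aut_family_vanishes[OF aut_family_overshear(2)], of \<alpha> x]
        aut_family_overshear(5) by (intro vanishes_cmult) (rule vanishes_mono)
  qed
  then show ?case
    using aut_family_overshear has_jets_mult by (cases "i = j") (auto simp: overshear_nth)
qed

text \<open>Without overshears no exponential occurs. Exact polynomiality is what later allows the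
  Jacobian of such a family to be compared with that of a jet.\<close>

lemma aut_family_volume_preserving_poly:
  assumes X: "charts_in_coord_space X" and "aut_family X True F"
  shows "family_poly X (\<lambda>x z. F x z $ i)"
  using assms(2)
proof (induction F arbitrary: i rule: aut_family.induct)
  case aut_family_id
  show ?case by (intro family_poly_coordinate X)
next
  case (aut_family_shear F c \<alpha> j)
  have "family_poly X (\<lambda>x z. c x * monomial \<alpha> (F x z))"
    using aut_family_shear by (intro family_poly_mult family_poly_param family_poly_monomial_compose X)
  then show ?case
    using aut_family_shear family_poly_add by (cases "i = j") (auto simp: shear_nth)
qed simp

lemma aut_family_unimodular:
  assumes "aut_family X True F"
  shows "\<exists>D. (F x has_derivative D) (at z) \<and> det (matrix D) = 1"
  using assms
proof (induction F rule: aut_family.induct)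
  case aut_family_id
  have "matrix (\<lambda>z. z) = (mat 1 :: complex ^ 'c ^ 'c)"
    by (simp add: vec_eq_iff matrix_nth mat_def axis_def)
  then show ?case by (intro exI[of _ "\<lambda>h. h"]) simp
next
  case aut_family_shear
  then show ?case using shear_unimodular by blast
qed simp

section \<open>Prescribing homogeneous terms\<close>

definition tangent_family ::
    "('a, 'i) cspace \<Rightarrow> bool \<Rightarrow> ('a \<Rightarrow> complex ^ 'n::finite \<Rightarrow> complex ^ 'n) \<Rightarrow> bool" where
  "tangent_family X vp F \<longleftrightarrow> aut_family X vp F \<and>
     (\<forall>x \<in> topspace (cs_top X). \<forall>i. leading 1 (\<lambda>z. F x z $ i) (\<lambda>z. z $ i))"

text \<open>Quantifying over every starting family \<open>F\<close>, and not only the identity, lets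
  corrections be applied one after the other. This is why reachable fields can be added.\<close>

definition reachable ::
    "('a, 'i) cspace \<Rightarrow> bool \<Rightarrow> nat \<Rightarrow> ('a \<Rightarrow> complex ^ 'n::finite \<Rightarrow> complex ^ 'n) \<Rightarrow> bool" where
  "reachable X vp d V \<longleftrightarrow> (\<forall>F. tangent_family X vp F \<longrightarrow>
     (\<exists>F'. tangent_family X vp F' \<and>
       (\<forall>x \<in> topspace (cs_top X). vanishes (Suc d) (\<lambda>z. F' x z - (F x z + V x z)))))"

text \<open>The field is constant in x while its coefficient is an arbitrary holomorphic function.
  Such fields form a complex vector space, so linear algebra over the constants applies to
  them.\<close>

definition reachable_field ::
    "('a, 'i) cspace \<Rightarrow> bool \<Rightarrow> nat \<Rightarrow> (complex ^ 'n::finite \<Rightarrow> complex ^ 'n) \<Rightarrow> bool" where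
  "reachable_field X vp d W \<longleftrightarrow>
     (\<forall>c. holomorphic_fun X c \<longrightarrow> reachable X vp d (\<lambda>x z. c x *s W z))"

lemma tangent_family_id: "tangent_family X vp (\<lambda>x z. z)"
  using vanishes_coordinate by (auto simp: tangent_family_def leading_def intro: aut_family_id)

lemma reachable_zero: "reachable X vp d (\<lambda>x z. 0)"
  unfolding reachable_def by (auto intro!: exI)

lemma reachable_add:
  fixes V W :: "'a \<Rightarrow> complex ^ 'n::finite \<Rightarrow> complex ^ 'n"
  assumes "reachable X vp d V" "reachable X vp d W"
  shows "reachable X vp d (\<lambda>x z. V x z + W x z)"
  unfolding reachable_def
proof (intro allI impI)
  fix F :: "'a \<Rightarrow> complex ^ 'n \<Rightarrow> complex ^ 'n"
  assume "tangent_family X vp F"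
  then obtain G where G: "tangent_family X vp G"
    "\<forall>x \<in> topspace (cs_top X). vanishes (Suc d) (\<lambda>z. G x z - (F x z + V x z))"
    using assms(1) unfolding reachable_def by blast
  obtain H where H: "tangent_family X vp H"
    "\<forall>x \<in> topspace (cs_top X). vanishes (Suc d) (\<lambda>z. H x z - (G x z + W x z))"
    using assms(2) G(1) unfolding reachable_def by blast
  have "vanishes (Suc d) (\<lambda>z. H x z - (F x z + (V x z + W x z)))" if x: "x \<in> topspace (cs_top X)" for x
    using vanishes_add[OF H(2)[rule_format, OF x] G(2)[rule_format, OF x]]
    by (simp add: algebra_simps)
  then show "\<exists>F'. tangent_family X vp F' \<and> (\<forall>x \<in> topspace (cs_top X).
      vanishes (Suc d) (\<lambda>z. F' x z - (F x z + (V x z + W x z))))"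
    using H(1) by blast
qed

lemma reachable_sum:
  "(\<And>i. i \<in> S \<Longrightarrow> reachable X vp d (V i)) \<Longrightarrow> reachable X vp d (\<lambda>x z. \<Sum>i\<in>S. V i x z)"
  by (induction S rule: infinite_finite_induct) (auto intro: reachable_zero reachable_add)

lemma reachable_cong:
  assumes "reachable X vp d V" "\<And>x z. x \<in> topspace (cs_top X) \<Longrightarrow> V x z = W x z"
  shows "reachable X vp d W"
  using assms unfolding reachable_def by simp

lemma reachable_field_add:
  "reachable_field X vp d V \<Longrightarrow> reachable_field X vp d W \<Longrightarrow> reachable_field X vp d (\<lambda>z. V z + W z)"
  unfolding reachable_field_def by (auto simp: vector_add_ldistrib intro: reachable_add)

lemma reachable_field_cmult:
  assumes X: "charts_in_coord_space X" and "reachable_field X vp d W"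
  shows "reachable_field X vp d (\<lambda>z. s *s W z)"
  unfolding reachable_field_def
proof (intro allI impI)
  fix c assume "holomorphic_fun X c"
  then have "holomorphic_fun X (\<lambda>x. c x * s)"
    by (intro holomorphic_fun_mult holomorphic_fun_const X)
  then have "reachable X vp d (\<lambda>x z. (c x * s) *s W z)"
    using assms(2) unfolding reachable_field_def by blast
  then show "reachable X vp d (\<lambda>x z. c x *s (s *s W z))"
    by (simp add: vector_smult_assoc)
qed

lemma reachable_field_zero: "reachable_field X vp d (\<lambda>z. 0)"
  by (simp add: reachable_field_def reachable_zero)

lemma reachable_field_diff:
  assumes "charts_in_coord_space X" "reachable_field X vp d V" "reachable_field X vp d W"
  shows "reachable_field X vp d (\<lambda>z. V z - W z)"
  using reachable_field_add[OF assms(2) reachable_field_cmult[OF assms(1,3), of "- 1"]] by simp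

lemma reachable_field_sum:
  "(\<And>i. i \<in> S \<Longrightarrow> reachable_field X vp d (V i)) \<Longrightarrow> reachable_field X vp d (\<lambda>z. \<Sum>i\<in>S. V i z)"
  by (induction S rule: infinite_finite_induct) (auto intro: reachable_field_zero reachable_field_add)

text \<open>Combining the values at t and 2 t eliminates the leading coefficient.\<close>

lemma reachable_field_coefficient:
  assumes X: "charts_in_coord_space X"
    and "\<And>t. reachable_field X vp d (\<lambda>z. \<Sum>s\<le>m. t ^ s *s w s z)" and "s \<le> m"
  shows "reachable_field X vp d (w s)"
  using assms(2,3)
proof (induction m arbitrary: w s)
  case 0
  then show ?case using "0.prems"(1)[of 1] by simp
next
  case (Suc m)
  have lower: "reachable_field X vp d (w s)" if "s \<le> m" for s
  proof -
    let ?c = "\<lambda>s. 2 ^ s - 2 ^ Suc m :: complex"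
    have eq: "(\<Sum>s\<le>Suc m. (2 * t) ^ s *s w s z) - 2 ^ Suc m *s (\<Sum>s\<le>Suc m. t ^ s *s w s z) =
        (\<Sum>s\<le>m. t ^ s *s (?c s *s w s z))" for t z
      by (simp add: vec_eq_iff sum_component sum_distrib_left sum_subtractf[symmetric]
          power_mult_distrib algebra_simps)
    have "reachable_field X vp d (\<lambda>z. \<Sum>s\<le>m. t ^ s *s (?c s *s w s z))" for t
      using reachable_field_diff[OF X Suc.prems(1)[of "2 * t"]
          reachable_field_cmult[OF X Suc.prems(1)[of t], of "2 ^ Suc m"]]
      unfolding eq .
    then have "reachable_field X vp d (\<lambda>z. ?c s *s w s z)"
      by (rule Suc.IH[where w = "\<lambda>s z. ?c s *s w s z"]) (rule that)
    from reachable_field_cmult[OF X this, of "inverse (?c s)"]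
    have "reachable_field X vp d (\<lambda>z. (inverse (?c s) * ?c s) *s w s z)"
      by (simp only: vector_smult_assoc)
    moreover have "?c s \<noteq> 0"
    proof
      assume "?c s = 0"
      then have "norm (2 ^ s :: complex) = norm (2 ^ Suc m :: complex)" by simp
      then have "(2 :: real) ^ s = 2 ^ Suc m" by (simp add: norm_power norm_mult)
      then show False using that by (simp del: power_Suc)
    qed
    ultimately show ?thesis by simp
  qed
  \<comment> \<open>The top coefficient is the value at t = 1 minus all lower coefficients.\<close>
  have "reachable_field X vp d (\<lambda>z. (\<Sum>s\<le>Suc m. 1 ^ s *s w s z) - (\<Sum>s\<le>m. w s z))"
    by (intro reachable_field_diff X Suc.prems reachable_field_sum lower) simp
  then have "reachable_field X vp d (w (Suc m))"
    by simp
  then show ?case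
    using lower Suc.prems(2) by (cases "s = Suc m") auto
qed

section \<open>Fields produced by single shears and by conjugated shears and overshears\<close>

definition monomial_field :: "'n \<Rightarrow> ('n \<Rightarrow> nat) \<Rightarrow> complex ^ 'n::finite \<Rightarrow> complex ^ 'n" where
  "monomial_field i \<alpha> z = (\<chi> l. if l = i then monomial \<alpha> z else 0)"

lemma monomial_field_nth: "monomial_field i \<alpha> z $ l = (if l = i then monomial \<alpha> z else 0)"
  by (simp add: monomial_field_def)

text \<open>Here \<open>G\<close> is the exact increment caused by one composition and
  \<open>V\<close> its leading part. An increment of order at least 2 leaves the family tangent to
  the identity.\<close>

lemma tangent_family_step:
  assumes F: "tangent_family X vp F" and F': "aut_family X vp F'" and d: "d \<ge> 2"
    and eq: "\<And>x z. F' x z = F x z + G x z"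
    and G: "\<And>x i. x \<in> topspace (cs_top X) \<Longrightarrow> leading d (\<lambda>z. G x z $ i) (\<lambda>z. V x z $ i)"
  shows "tangent_family X vp F' \<and>
    (\<forall>x \<in> topspace (cs_top X). vanishes (Suc d) (\<lambda>z. F' x z - (F x z + V x z)))"
proof (intro conjI ballI)
  show "tangent_family X vp F'"
    unfolding tangent_family_def
  proof (intro conjI ballI allI F')
    fix x i assume x: "x \<in> topspace (cs_top X)"
    have "vanishes (Suc 1) (\<lambda>z. G x z $ i)"
      using leading_vanishes[OF G[OF x]] by (rule vanishes_mono) (use d in simp)
    moreover have F1: "leading 1 (\<lambda>z. F x z $ i) (\<lambda>z. z $ i)"
      using F x by (auto simp: tangent_family_def)
    ultimately have "vanishes (Suc 1) (\<lambda>z. (F x z $ i - z $ i) + G x z $ i)"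
      by (intro vanishes_add) (auto simp: leading_def)
    then show "leading 1 (\<lambda>z. F' x z $ i) (\<lambda>z. z $ i)"
      using F1 by (simp add: leading_def eq algebra_simps)
  qed
  fix x assume x: "x \<in> topspace (cs_top X)"
  show "vanishes (Suc d) (\<lambda>z. F' x z - (F x z + V x z))"
    using G[OF x] by (simp add: vanishes_vec_iff leading_def eq)
qed

text \<open>The increment is the monomial evaluated at F x z instead of z. Tangency of F x to the
  identity makes the two agree up to order d + 1.\<close>

lemma reachable_field_shear:
  fixes X :: "('a, 'i) cspace" and i :: "'n::finite"
  assumes "\<alpha> i = 0" "mdegree \<alpha> = d" "d \<ge> 2"
  shows "reachable_field X vp d (monomial_field i \<alpha>)"
  unfolding reachable_field_def reachable_def
proof (intro allI impI exI)
  fix c and F :: "'a \<Rightarrow> complex ^ 'n \<Rightarrow> complex ^ 'n"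
  assume c: "holomorphic_fun X c" and F: "tangent_family X vp F"
  show "tangent_family X vp (\<lambda>x z. shear i \<alpha> (c x) (F x z)) \<and> (\<forall>x \<in> topspace (cs_top X).
      vanishes (Suc d) (\<lambda>z. shear i \<alpha> (c x) (F x z) - (F x z + c x *s monomial_field i \<alpha> z)))"
  proof (rule tangent_family_step[OF F, where G = "\<lambda>x z. c x *s monomial_field i \<alpha> (F x z)"])
    show "aut_family X vp (\<lambda>x z. shear i \<alpha> (c x) (F x z))"
      using assms F by (intro aut_family_shear c) (auto simp: tangent_family_def)
    show "shear i \<alpha> (c x) (F x z) = F x z + c x *s monomial_field i \<alpha> (F x z)" for x z
      by (simp add: vec_eq_iff shear_nth monomial_field_nth)
    fix x l assume "x \<in> topspace (cs_top X)"
    then have "leading d (\<lambda>z. monomial \<alpha> (F x z)) (monomial \<alpha>)"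
      using leading_monomial[of "F x" \<alpha>] F assms(2) by (auto simp: tangent_family_def)
    then show "leading d (\<lambda>z. (c x *s monomial_field i \<alpha> (F x z)) $ l) (\<lambda>z. (c x *s monomial_field i \<alpha> z) $ l)"
      by (cases "l = i") (simp_all add: monomial_field_nth leading_cmult, simp add: leading_def)
  qed (use assms in auto)
qed

lemma leading_sheared_power:
  assumes "\<And>l. leading 1 (\<lambda>z. F z $ l) (\<lambda>z. z $ l)" "N + mdegree \<beta> = d"
  shows "leading d (\<lambda>z. (F z $ i + t * F z $ j) ^ N * monomial \<beta> (F z))
    (\<lambda>z. (z $ i + t * z $ j) ^ N * monomial \<beta> z)"
proof -
  have "leading (N * 1) (\<lambda>z. (F z $ i + t * F z $ j) ^ N) (\<lambda>z. (z $ i + t * z $ j) ^ N)"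
    by (intro leading_power leading_add leading_cmult assms)
  from leading_mult[OF this leading_monomial[OF assms(1), of \<beta>]] assms(2)
  show ?thesis by simp
qed

lemma monomial_upd_shear:
  assumes "\<beta> i = 0" "i \<noteq> j"
  shows "monomial (\<beta>(i := N)) (shear i (unit_index j) t w) = (w $ i + t * w $ j) ^ N * monomial \<beta> w"
proof -
  have "\<beta>(i := 0) = \<beta>" using assms(1) by auto
  then show ?thesis
    using monomial_upd[of \<beta> i N] monomial_shear[of \<beta> i] assms by (simp only: shear_nth monomial_unit_index) simp
qed

lemma leading_zero [simp]: "leading m (\<lambda>z. 0) (\<lambda>z. 0)"
  by (simp add: leading_def)

text \<open>The shear of coordinate j by a power of coordinate i, conjugated by adding t times coordinate
  j to coordinate i.\<close>

lemma reachable_field_conjugate_shear: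
  fixes X :: "('a, 'i) cspace" and i j :: "'n::finite"
  assumes X: "charts_in_coord_space X" and ij: "i \<noteq> j" "\<beta> i = 0" "\<beta> j = 0"
    and d: "N + mdegree \<beta> = d" "d \<ge> 2"
  shows "reachable_field X vp d (\<lambda>z. (\<chi> l. if l = i then t * ((z $ i + t * z $ j) ^ N * monomial \<beta> z)
    else if l = j then - ((z $ i + t * z $ j) ^ N * monomial \<beta> z) else 0))"
    (is "reachable_field X vp d (\<lambda>z. ?W z)")
  unfolding reachable_field_def reachable_def
proof (intro allI impI exI)
  fix c and F :: "'a \<Rightarrow> complex ^ 'n \<Rightarrow> complex ^ 'n"
  assume c: "holomorphic_fun X c" and F: "tangent_family X vp F"
  \<comment> \<open>With m the monomial at the sheared point, coordinate j loses c m; undoing the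
    linear shear then turns -t times this loss into a gain t c m in coordinate i. The linear shears
    need not be tangent to the identity, but the whole conjugate followed by \<open>F\<close>
    is.\<close>
  let ?S = "\<lambda>x. shear j (\<beta>(i := N)) (- c x)"
  let ?F = "\<lambda>x z. shear i (unit_index j) (- t) (?S x (shear i (unit_index j) t (F x z)))"
  have deg: "mdegree (\<beta>(i := N)) = d"
    using mdegree_upd[of \<beta> i N] d ij by (simp add: fun_upd_idem)
  show "tangent_family X vp ?F \<and> (\<forall>x \<in> topspace (cs_top X).
      vanishes (Suc d) (\<lambda>z. ?F x z - (F x z + c x *s ?W z)))"
  proof (rule tangent_family_step[OF F, where G = "\<lambda>x z. c x *s ?W (F x z)"])
    have "holomorphic_fun X (\<lambda>x. - c x)"
      using holomorphic_fun_mult[OF holomorphic_fun_const[OF X, of "- 1"] c] by simp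
    then show "aut_family X vp ?F"
      using F ij d deg by (intro aut_family_shear holomorphic_fun_const X) (auto simp: tangent_family_def)
    show "?F x z = F x z + c x *s ?W (F x z)" for x z
      using ij monomial_upd_shear[of \<beta> i j N t "F x z"]
      by (simp add: vec_eq_iff shear_nth algebra_simps)
    fix x l assume "x \<in> topspace (cs_top X)"
    then have "leading d (\<lambda>z. (F x z $ i + t * F x z $ j) ^ N * monomial \<beta> (F x z))
        (\<lambda>z. (z $ i + t * z $ j) ^ N * monomial \<beta> z)"
      using F d by (intro leading_sheared_power) (auto simp: tangent_family_def)
    from leading_cmult[OF this, of "c x * t"] leading_cmult[OF this, of "- c x"]
    show "leading d (\<lambda>z. (c x *s ?W (F x z)) $ l) (\<lambda>z. (c x *s ?W z) $ l)"
      using ij by (cases "l = i"; cases "l = j") (simp_all add: mult.assoc)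
  qed (use d in auto)
qed

text \<open>The same conjugation applied to an overshear of coordinate j. Its increment there is z_j
  (exp (c m) - 1) at F x z, with leading part c z_j m; as d is at least 2, m has positive order,
  which \<open>leading_exp_minus_one\<close> requires. The factor z_j explains the
  \<open>Suc\<close> in the degree.\<close>

lemma reachable_field_conjugate_overshear:
  fixes X :: "('a, 'i) cspace" and i j :: "'n::finite"
  assumes X: "charts_in_coord_space X" and ij: "i \<noteq> j" "\<beta> i = 0" "\<beta> j = 0"
    and d: "Suc (N + mdegree \<beta>) = d" "d \<ge> 2"
  shows "reachable_field X False d (\<lambda>z. (\<chi> l. if l = i then - t * (z $ j * ((z $ i + t * z $ j) ^ N * monomial \<beta> z))
    else if l = j then z $ j * ((z $ i + t * z $ j) ^ N * monomial \<beta> z) else 0))"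
    (is "reachable_field X False d (\<lambda>z. ?W z)")
  unfolding reachable_field_def reachable_def
proof (intro allI impI exI)
  fix c and F :: "'a \<Rightarrow> complex ^ 'n \<Rightarrow> complex ^ 'n"
  assume c: "holomorphic_fun X c" and F: "tangent_family X False F"
  let ?S = "\<lambda>x. overshear j (\<beta>(i := N)) (c x)"
  let ?F = "\<lambda>x z. shear i (unit_index j) (- t) (?S x (shear i (unit_index j) t (F x z)))"
  let ?m = "\<lambda>z. (z $ i + t * z $ j) ^ N * monomial \<beta> z"
  let ?e = "\<lambda>x z. exp (c x * ?m (F x z)) - 1"
  have deg: "Suc (mdegree (\<beta>(i := N))) = d"
    using mdegree_upd[of \<beta> i N] d ij by (simp add: fun_upd_idem)
  show "tangent_family X False ?F \<and> (\<forall>x \<in> topspace (cs_top X).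
      vanishes (Suc d) (\<lambda>z. ?F x z - (F x z + c x *s ?W z)))"
  proof (rule tangent_family_step[OF F, where
        G = "\<lambda>x z. \<chi> l. if l = i then - t * (F x z $ j * ?e x z) else if l = j then F x z $ j * ?e x z else 0"])
    show "aut_family X False ?F"
      using F ij d deg c
      by (intro aut_family_shear aut_family_overshear holomorphic_fun_const X)
        (auto simp: tangent_family_def)
    show "?F x z = F x z + (\<chi> l. if l = i then - t * (F x z $ j * ?e x z)
        else if l = j then F x z $ j * ?e x z else 0)" for x z
      using ij monomial_upd_shear[of \<beta> i j N t "F x z"]
      by (simp add: vec_eq_iff shear_nth overshear_nth algebra_simps)
    fix x l assume x: "x \<in> topspace (cs_top X)"
    then have "leading (N + mdegree \<beta>) (\<lambda>z. ?m (F x z)) ?m"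
      using F d by (intro leading_sheared_power) (auto simp: tangent_family_def)
    then have "leading (N + mdegree \<beta>) (\<lambda>z. ?e x z) (\<lambda>z. c x * ?m z)"
      using d by (intro leading_exp_minus_one leading_cmult) auto
    moreover have "leading 1 (\<lambda>z. F x z $ j) (\<lambda>z. z $ j)"
      using F x by (auto simp: tangent_family_def)
    ultimately have "leading d (\<lambda>z. F x z $ j * ?e x z) (\<lambda>z. z $ j * (c x * ?m z))"
      using leading_mult d by fastforce
    from this leading_cmult[OF this, of "- t"]
    show "leading d (\<lambda>z. (\<chi> l. if l = i then - t * (F x z $ j * ?e x z)
        else if l = j then F x z $ j * ?e x z else 0) $ l) (\<lambda>z. (c x *s ?W z) $ l)"
      using ij by (cases "l = i"; cases "l = j") (simp_all add: mult_ac)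
  qed (use d in auto)
qed

section \<open>Monomial fields as coefficients of powers of t\<close>

lemma monomial_split_pair:
  assumes "i \<noteq> j"
  shows "monomial \<gamma> z = z $ i ^ \<gamma> i * (z $ j ^ \<gamma> j * monomial (\<gamma>(i := 0, j := 0)) z)"
  using monomial_upd[of \<gamma> i "\<gamma> i" z] monomial_upd[of "\<gamma>(i := 0)" j "\<gamma> j" z] assms by (simp add: fun_upd_idem)

lemma mdegree_split_pair:
  assumes "i \<noteq> j"
  shows "mdegree \<gamma> = \<gamma> i + (\<gamma> j + mdegree (\<gamma>(i := 0, j := 0)))"
  using mdegree_upd[of \<gamma> i "\<gamma> i"] mdegree_upd[of "\<gamma>(i := 0)" j "\<gamma> j"] assms by (simp add: fun_upd_idem)

lemma binomial_neighbour: "Suc k * (n choose Suc k) = (n - k) * (n choose k)"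
  using binomial_absorption[of k n] binomial_absorb_comp[of n k] by simp

text \<open>The factor t in the i-component shifts the coefficients by one, so that both components
  become sums over the same range of powers.\<close>

lemma sum_atMost_Suc_merge:
  fixes a b :: "nat \<Rightarrow> complex"
  shows "t * (\<Sum>s\<le>N. t ^ s * a s) = (\<Sum>s\<le>Suc N. t ^ s * (case s of 0 \<Rightarrow> 0 | Suc r \<Rightarrow> a r))"
  by (subst sum.atMost_Suc_shift) (simp add: sum_distrib_left mult_ac)

lemma binomial_expand:
  fixes t u v :: complex
  shows "(u + t * v) ^ N * m = (\<Sum>s\<le>N. t ^ s * (of_nat (N choose s) * u ^ (N - s) * v ^ s * m))"
proof -
  have "(u + t * v) ^ N = (t * v + u) ^ N" by (simp add: add.commute)
  also have "\<dots> = (\<Sum>s\<le>N. of_nat (N choose s) * (t * v) ^ s * u ^ (N - s))" by (rule binomial_ring)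
  finally show ?thesis
    by (simp add: sum_distrib_right sum_distrib_left power_mult_distrib mult_ac)
qed

text \<open>This is the Hamiltonian field in the (z_i, z_j)-plane of the monomial whose exponents
  are \<beta> raised by one at i and at j. Up to a scalar it is one t-coefficient of the conjugated
  shear, because neighbouring binomial coefficients have the ratio of its two factors.\<close>

lemma reachable_field_pair:
  fixes X :: "('a, 'i) cspace" and i j :: "'n::finite"
  assumes X: "charts_in_coord_space X" and ij: "i \<noteq> j" and d: "Suc (mdegree \<beta>) = d" "d \<ge> 2"
  shows "reachable_field X vp d (\<lambda>z. of_nat (Suc (\<beta> j)) *s monomial_field i (\<beta>(i := Suc (\<beta> i))) z -
    of_nat (Suc (\<beta> i)) *s monomial_field j (\<beta>(j := Suc (\<beta> j))) z)"
proof -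
  let ?\<gamma> = "\<beta>(i := 0, j := 0)"
  \<comment> \<open>The joint degree in z_i and z_j of both target monomials.\<close>
  let ?N = "Suc (\<beta> i + \<beta> j)"
  let ?a = "\<lambda>s z. of_nat (?N choose s) * z $ i ^ (?N - s) * z $ j ^ s * monomial ?\<gamma> z"
  \<comment> \<open>\<open>w s\<close> is the coefficient of t^s. The sum runs up to
    \<open>Suc ?N\<close> because of the shift in the i-component; there the j-component is 0, as
    its binomial coefficient vanishes.\<close>
  define w :: "nat \<Rightarrow> complex ^ 'n \<Rightarrow> complex ^ 'n" where
    "w s z = (\<chi> l. if l = i then case s of 0 \<Rightarrow> 0 | Suc r \<Rightarrow> ?a r z else if l = j then - ?a s z else 0)" for s z
  have deg: "?N + mdegree ?\<gamma> = d"
    using mdegree_split_pair[OF ij, of \<beta>] d by simp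
  have "reachable_field X vp d (\<lambda>z. \<Sum>s\<le>Suc ?N. t ^ s *s w s z)" for t
  proof -
    have "(\<chi> l. if l = i then t * ((z $ i + t * z $ j) ^ ?N * monomial ?\<gamma> z)
      else if l = j then - ((z $ i + t * z $ j) ^ ?N * monomial ?\<gamma> z) else 0) = (\<Sum>s\<le>Suc ?N. t ^ s *s w s z)" for z
      unfolding binomial_expand sum_atMost_Suc_merge
      using ij by (simp add: vec_eq_iff sum_component w_def sum_negf del: sum.atMost_Suc)
        (simp add: binomial_eq_0)
    then show ?thesis
      using reachable_field_conjugate_shear[OF X ij _ _ deg d(2), of vp t] ij by simp
  qed
  \<comment> \<open>At this power of t the components carry the monomials
    \<open>\<beta>(i := Suc (\<beta> i))\<close> and
    \<open>\<beta>(j := Suc (\<beta> j))\<close>.\<close>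
  then have "reachable_field X vp d (w (Suc (\<beta> j)))"
    by (rule reachable_field_coefficient[OF X]) simp
  then have *: "reachable_field X vp d (\<lambda>z. (of_nat (Suc (\<beta> j)) / of_nat (?N choose \<beta> j)) *s w (Suc (\<beta> j)) z)"
    by (rule reachable_field_cmult[OF X])
  have nz: "(of_nat (?N choose \<beta> j) :: complex) \<noteq> 0"
    by simp
  have "Suc (\<beta> j) * (?N choose Suc (\<beta> j)) = Suc (\<beta> i) * (?N choose \<beta> j)"
    using binomial_neighbour[of "\<beta> j" ?N] by simp
  then have ratio: "(of_nat (Suc (\<beta> j)) :: complex) * of_nat (?N choose Suc (\<beta> j)) =
      of_nat (Suc (\<beta> i)) * of_nat (?N choose \<beta> j)"
    by (metis of_nat_mult)
  have "(of_nat (Suc (\<beta> j)) / of_nat (?N choose \<beta> j)) *s w (Suc (\<beta> j)) z =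
      of_nat (Suc (\<beta> j)) *s monomial_field i (\<beta>(i := Suc (\<beta> i))) z -
      of_nat (Suc (\<beta> i)) *s monomial_field j (\<beta>(j := Suc (\<beta> j))) z" (is "?L = ?R") for z
  proof -
    have mi: "monomial (\<beta>(i := Suc (\<beta> i))) z = z $ i ^ Suc (\<beta> i) * (z $ j ^ \<beta> j * monomial ?\<gamma> z)"
      using monomial_split_pair[OF ij, of "\<beta>(i := Suc (\<beta> i))" z] ij by simp
    have mj: "monomial (\<beta>(j := Suc (\<beta> j))) z = z $ i ^ \<beta> i * (z $ j ^ Suc (\<beta> j) * monomial ?\<gamma> z)"
      using monomial_split_pair[OF ij, of "\<beta>(j := Suc (\<beta> j))" z] ij by (simp add: fun_upd_twist)
    have "?L $ i = ?R $ i"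
      using nz ij by (simp add: w_def monomial_field_nth mi Suc_diff_le del: of_nat_Suc power_Suc)
    moreover have "?L $ j = ?R $ j"
    proof -
      have "?L $ j = - ((of_nat (Suc (\<beta> j)) * of_nat (?N choose Suc (\<beta> j))) / of_nat (?N choose \<beta> j) *
          (z $ i ^ \<beta> i * z $ j ^ Suc (\<beta> j) * monomial ?\<gamma> z))"
        using ij by (simp add: w_def del: of_nat_Suc power_Suc binomial_Suc_Suc)
      also have "\<dots> = ?R $ j"
        unfolding ratio using nz ij by (simp add: monomial_field_nth mj del: of_nat_Suc power_Suc)
      finally show ?thesis .
    qed
    moreover have "?L $ l = ?R $ l" if "l \<noteq> i" "l \<noteq> j" for l
      using that by (simp add: w_def monomial_field_nth)
    ultimately show ?thesis
      unfolding vec_eq_iff by metis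
  qed
  with * show ?thesis by simp
qed

text \<open>The coefficient of t^(\<beta> j) in the conjugated overshear involves the same two
  monomials as the pair field. A multiple of the pair field cancels the i-component. In the
  j-component, after scaling by \<beta> j + 1, the binomial coefficient is left with the factor
  (\<beta> j + 1) - \<beta> j = 1, so it can be divided out.\<close>

lemma reachable_field_diagonal:
  fixes X :: "('a, 'i) cspace" and i j :: "'n::finite"
  assumes X: "charts_in_coord_space X" and ij: "i \<noteq> j" and d: "Suc (mdegree \<beta>) = d" "d \<ge> 2"
  shows "reachable_field X False d (monomial_field j (\<beta>(j := Suc (\<beta> j))))"
proof -
  let ?\<gamma> = "\<beta>(i := 0, j := 0)"
  let ?N = "\<beta> i + \<beta> j"
  let ?a = "\<lambda>s z. of_nat (?N choose s) * z $ i ^ (?N - s) * z $ j ^ s * (z $ j * monomial ?\<gamma> z)"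
  \<comment> \<open>The binomial coefficient one step below \<beta> j. The case distinction gives 0
    for \<open>\<beta> j = 0\<close>, whereas truncated subtraction would give
    \<open>?N choose 0 = 1\<close>.\<close>
  let ?C = "case \<beta> j of 0 \<Rightarrow> 0 | Suc r \<Rightarrow> ?N choose r"
  define w :: "nat \<Rightarrow> complex ^ 'n \<Rightarrow> complex ^ 'n" where
    "w s z = (\<chi> l. if l = i then - (case s of 0 \<Rightarrow> 0 | Suc r \<Rightarrow> ?a r z) else if l = j then ?a s z else 0)" for s z
  have deg: "Suc (?N + mdegree ?\<gamma>) = d"
    using mdegree_split_pair[OF ij, of \<beta>] d by simp
  have "reachable_field X False d (\<lambda>z. \<Sum>s\<le>Suc ?N. t ^ s *s w s z)" for t
  proof -
    have m: "z $ j * ((z $ i + t * z $ j) ^ ?N * monomial ?\<gamma> z) =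
        (\<Sum>s\<le>?N. t ^ s * ?a s z)" for z
      using binomial_expand[of "z $ i" t "z $ j" ?N "z $ j * monomial ?\<gamma> z"] by (simp add: mult_ac)
    have "(\<chi> l. if l = i then - t * (z $ j * ((z $ i + t * z $ j) ^ ?N * monomial ?\<gamma> z))
      else if l = j then z $ j * ((z $ i + t * z $ j) ^ ?N * monomial ?\<gamma> z) else 0) = (\<Sum>s\<le>Suc ?N. t ^ s *s w s z)" for z
      unfolding m mult_minus_left sum_atMost_Suc_merge
      using ij by (simp add: vec_eq_iff sum_component w_def sum_negf del: sum.atMost_Suc)
        (simp add: binomial_eq_0)
    then show ?thesis
      using reachable_field_conjugate_overshear[OF X ij _ _ deg d(2), of t] ij by simp
  qed
  then have "reachable_field X False d (w (\<beta> j))"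
    by (rule reachable_field_coefficient[OF X]) simp
  then have *: "reachable_field X False d (\<lambda>z. inverse (of_nat (?N choose \<beta> j)) *s
      (of_nat (Suc (\<beta> j)) *s w (\<beta> j) z + of_nat ?C *s
       (of_nat (Suc (\<beta> j)) *s monomial_field i (\<beta>(i := Suc (\<beta> i))) z -
        of_nat (Suc (\<beta> i)) *s monomial_field j (\<beta>(j := Suc (\<beta> j))) z)))"
    by (intro reachable_field_cmult reachable_field_add reachable_field_pair X ij d)
  have nz: "(of_nat (?N choose \<beta> j) :: complex) \<noteq> 0"
    by simp
  have "?C * Suc (\<beta> i) = \<beta> j * (?N choose \<beta> j)"
  proof (cases "\<beta> j")
    case (Suc r)
    then show ?thesis using binomial_neighbour[of r ?N] by (simp add: mult.commute)
  qed simp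
  then have ratio: "(of_nat ?C :: complex) * of_nat (Suc (\<beta> i)) = of_nat (\<beta> j) * of_nat (?N choose \<beta> j)"
    by (metis of_nat_mult)
  have "inverse (of_nat (?N choose \<beta> j)) *s
      (of_nat (Suc (\<beta> j)) *s w (\<beta> j) z + of_nat ?C *s
       (of_nat (Suc (\<beta> j)) *s monomial_field i (\<beta>(i := Suc (\<beta> i))) z -
        of_nat (Suc (\<beta> i)) *s monomial_field j (\<beta>(j := Suc (\<beta> j))) z)) =
      monomial_field j (\<beta>(j := Suc (\<beta> j))) z" (is "?L = ?R") for z
  proof -
    have mi: "monomial (\<beta>(i := Suc (\<beta> i))) z = z $ i ^ Suc (\<beta> i) * (z $ j ^ \<beta> j * monomial ?\<gamma> z)"
      using monomial_split_pair[OF ij, of "\<beta>(i := Suc (\<beta> i))" z] ij by simp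
    have mj: "monomial (\<beta>(j := Suc (\<beta> j))) z = z $ i ^ \<beta> i * (z $ j ^ Suc (\<beta> j) * monomial ?\<gamma> z)"
      using monomial_split_pair[OF ij, of "\<beta>(j := Suc (\<beta> j))" z] ij by (simp add: fun_upd_twist)
    have "w (\<beta> j) z $ i = - (of_nat ?C * monomial (\<beta>(i := Suc (\<beta> i))) z)"
      using ij by (cases "\<beta> j") (simp_all add: w_def mi mult_ac del: binomial_Suc_Suc)
    then have "?L $ i = ?R $ i"
      using ij by (simp add: monomial_field_nth)
    moreover have "?L $ j = ?R $ j"
    proof -
      have "?L $ j = inverse (of_nat (?N choose \<beta> j)) *
          (of_nat (Suc (\<beta> j)) * of_nat (?N choose \<beta> j) - of_nat ?C * of_nat (Suc (\<beta> i))) *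
          monomial (\<beta>(j := Suc (\<beta> j))) z"
        using ij by (simp add: w_def monomial_field_nth mj algebra_simps del: of_nat_Suc)
      also have "\<dots> = ?R $ j"
        unfolding ratio using nz ij by (simp add: monomial_field_nth algebra_simps)
      finally show ?thesis .
    qed
    moreover have "?L $ l = ?R $ l" if "l \<noteq> i" "l \<noteq> j" for l
      using that by (simp add: w_def monomial_field_nth)
    ultimately show ?thesis
      unfolding vec_eq_iff by metis
  qed
  with * show ?thesis by simp
qed

lemma reachable_field_monomial:
  fixes \<alpha> :: "'n::finite \<Rightarrow> nat"
  assumes X: "charts_in_coord_space X" and "CARD('n) > 1" and d: "mdegree \<alpha> = d" "d \<ge> 2"
  shows "reachable_field X False d (monomial_field j \<alpha>)"
proof (cases "\<alpha> j")
  case 0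
  then show ?thesis by (rule reachable_field_shear[OF _ d])
next
  case (Suc r)
  \<comment> \<open>The monomial contains z_j, so no shear in direction j produces it directly; a
    second coordinate is needed for the conjugation.\<close>
  obtain i where i: "i \<noteq> j"
    using assms(2) by (metis (full_types) is_singletonI' is_singleton_altdef less_numeral_extra(4) UNIV_not_empty)
  let ?\<beta> = "\<alpha>(j := r)"
  have \<alpha>: "?\<beta>(j := Suc (?\<beta> j)) = \<alpha>" using Suc by auto
  then have "Suc (mdegree ?\<beta>) = d" using mdegree_upd_Suc[of ?\<beta> j] d by simp
  from reachable_field_diagonal[OF X i this d(2)] show ?thesis unfolding \<alpha> .
qed

section \<open>Homogeneous fields and divergence free homogeneous fields\<close>

text \<open>Exponents with \<open>\<alpha> i = 0\<close> belong to plain shears in direction i. The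
  others survive differentiation in direction i and are indexed by the exponent left after it, so
  the same splitting serves for fields and for divergences.\<close>

lemma sum_mdegree_Suc:
  fixes f :: "('n::finite \<Rightarrow> nat) \<Rightarrow> 'b::comm_monoid_add"
  shows "(\<Sum>\<alpha> | mdegree \<alpha> = Suc e. f \<alpha>) =
    (\<Sum>\<alpha> | mdegree \<alpha> = Suc e \<and> \<alpha> i = 0. f \<alpha>) + (\<Sum>\<beta> | mdegree \<beta> = e. f (\<beta>(i := Suc (\<beta> i))))"
proof -
  have fin: "finite {\<alpha> :: 'n \<Rightarrow> nat. mdegree \<alpha> = Suc e}"
    by (rule finite_subset[OF _ finite_mdegree_le[of "Suc e"]]) auto
  have "(\<Sum>\<alpha> | mdegree \<alpha> = Suc e. f \<alpha>) =
      (\<Sum>\<alpha>\<in>{\<alpha>. mdegree \<alpha> = Suc e \<and> \<alpha> i = 0} \<union> {\<alpha>. mdegree \<alpha> = Suc e \<and> \<alpha> i \<noteq> 0}. f \<alpha>)"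
    by (intro sum.cong) auto
  also have "\<dots> = (\<Sum>\<alpha> | mdegree \<alpha> = Suc e \<and> \<alpha> i = 0. f \<alpha>) + (\<Sum>\<alpha> | mdegree \<alpha> = Suc e \<and> \<alpha> i \<noteq> 0. f \<alpha>)"
    by (intro sum.union_disjoint) (auto intro: finite_subset[OF _ fin])
  also have "(\<Sum>\<alpha> | mdegree \<alpha> = Suc e \<and> \<alpha> i \<noteq> 0. f \<alpha>) = (\<Sum>\<beta> | mdegree \<beta> = e. f (\<beta>(i := Suc (\<beta> i))))"
  proof (rule sum.reindex_bij_witness[where i = "\<lambda>\<beta>. \<beta>(i := Suc (\<beta> i))" and j = "\<lambda>\<alpha>. \<alpha>(i := \<alpha> i - 1)"])
    fix \<alpha> :: "'n \<Rightarrow> nat" assume \<alpha>: "\<alpha> \<in> {\<alpha>. mdegree \<alpha> = Suc e \<and> \<alpha> i \<noteq> 0}"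
    then show eq: "(\<alpha>(i := \<alpha> i - 1))(i := Suc ((\<alpha>(i := \<alpha> i - 1)) i)) = \<alpha>"
      by auto
    show "\<alpha>(i := \<alpha> i - 1) \<in> {\<beta>. mdegree \<beta> = e}"
      using mdegree_upd_Suc[of "\<alpha>(i := \<alpha> i - 1)" i] \<alpha> unfolding eq by simp
    show "f ((\<alpha>(i := \<alpha> i - 1))(i := Suc ((\<alpha>(i := \<alpha> i - 1)) i))) = f \<alpha>"
      unfolding eq ..
  next
    fix \<beta> :: "'n \<Rightarrow> nat" assume "\<beta> \<in> {\<beta>. mdegree \<beta> = e}"
    then show "\<beta>(i := Suc (\<beta> i)) \<in> {\<alpha>. mdegree \<alpha> = Suc e \<and> \<alpha> i \<noteq> 0}"
      using mdegree_upd_Suc[of \<beta> i] by simp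
    show "(\<beta>(i := Suc (\<beta> i)))(i := (\<beta>(i := Suc (\<beta> i))) i - 1) = \<beta>"
      by auto
  qed
  finally show ?thesis .
qed

lemma sum_monomial_field:
  "(\<Sum>\<alpha>\<in>S. monomial \<alpha> z *s v \<alpha>) = (\<Sum>l\<in>UNIV. \<Sum>\<alpha>\<in>S. v \<alpha> $ l *s monomial_field l \<alpha> z)"
  unfolding vec_eq_iff
proof
  fix i
  have "(\<Sum>l\<in>UNIV. \<Sum>\<alpha>\<in>S. v \<alpha> $ l *s monomial_field l \<alpha> z) $ i =
      (\<Sum>l\<in>UNIV. if l = i then \<Sum>\<alpha>\<in>S. v \<alpha> $ l * monomial \<alpha> z else 0)"
    unfolding sum_component by (intro sum.cong) (auto simp: monomial_field_nth)
  then show "(\<Sum>\<alpha>\<in>S. monomial \<alpha> z *s v \<alpha>) $ i = (\<Sum>l\<in>UNIV. \<Sum>\<alpha>\<in>S. v \<alpha> $ l *s monomial_field l \<alpha> z) $ i"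
    by (simp add: sum_component mult.commute)
qed

lemma reachable_homogeneous:
  fixes v :: "'a \<Rightarrow> ('n::finite \<Rightarrow> nat) \<Rightarrow> complex ^ 'n"
  assumes X: "charts_in_coord_space X" and card: "CARD('n) > 1" and e: "e \<ge> 1"
    and v: "\<And>\<alpha> l. holomorphic_fun X (\<lambda>x. v x \<alpha> $ l)"
  shows "reachable X False (Suc e) (\<lambda>x z. \<Sum>\<alpha> | mdegree \<alpha> = Suc e. monomial \<alpha> z *s v x \<alpha>)"
  unfolding sum_monomial_field
proof (intro reachable_sum)
  fix l and \<alpha> :: "'n \<Rightarrow> nat" assume "\<alpha> \<in> {\<alpha>. mdegree \<alpha> = Suc e}"
  then have "reachable_field X False (Suc e) (monomial_field l \<alpha>)"
    using e by (intro reachable_field_monomial X card) auto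
  then show "reachable X False (Suc e) (\<lambda>x z. v x \<alpha> $ l *s monomial_field l \<alpha> z)"
    using v unfolding reachable_field_def by blast
qed

text \<open>The hypothesis \<open>div\<close> is the vanishing of the coefficient of z^\<beta> in
  the divergence. Grouping the terms by \<beta>, each group satisfies one linear equation, and the
  solutions are spanned by the pair fields through a fixed direction i. Terms with
  \<open>\<alpha> l = 0\<close> are divergence free by themselves.\<close>

lemma reachable_divergence_free:
  fixes v :: "'a \<Rightarrow> ('n::finite \<Rightarrow> nat) \<Rightarrow> complex ^ 'n"
  assumes X: "charts_in_coord_space X" and e: "e \<ge> 1"
    and v: "\<And>\<alpha> l. holomorphic_fun X (\<lambda>x. v x \<alpha> $ l)"
    and div: "\<And>x \<beta>. x \<in> topspace (cs_top X) \<Longrightarrow> mdegree \<beta> = e \<Longrightarrow>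
      (\<Sum>l\<in>UNIV. of_nat (Suc (\<beta> l)) * v x (\<beta>(l := Suc (\<beta> l))) $ l) = 0"
  shows "reachable X vp (Suc e) (\<lambda>x z. \<Sum>\<alpha> | mdegree \<alpha> = Suc e. monomial \<alpha> z *s v x \<alpha>)"
proof -
  let ?up = "\<lambda>\<beta> l. \<beta>(l := Suc (\<beta> l))"
  have split: "(\<Sum>\<alpha> | mdegree \<alpha> = Suc e. monomial \<alpha> z *s v x \<alpha>) =
      (\<Sum>l\<in>UNIV. \<Sum>\<alpha> | mdegree \<alpha> = Suc e \<and> \<alpha> l = 0. v x \<alpha> $ l *s monomial_field l \<alpha> z) +
      (\<Sum>\<beta> | mdegree \<beta> = e. \<Sum>l\<in>UNIV. v x (?up \<beta> l) $ l *s monomial_field l (?up \<beta> l) z)" for x z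
  proof -
    have "(\<Sum>\<alpha> | mdegree \<alpha> = Suc e. monomial \<alpha> z *s v x \<alpha>) =
        (\<Sum>l\<in>UNIV. (\<Sum>\<alpha> | mdegree \<alpha> = Suc e \<and> \<alpha> l = 0. v x \<alpha> $ l *s monomial_field l \<alpha> z) +
          (\<Sum>\<beta> | mdegree \<beta> = e. v x (?up \<beta> l) $ l *s monomial_field l (?up \<beta> l) z))"
      unfolding sum_monomial_field by (intro sum.cong refl sum_mdegree_Suc)
    moreover have "(\<Sum>l\<in>UNIV. \<Sum>\<beta> | mdegree \<beta> = e. v x (?up \<beta> l) $ l *s monomial_field l (?up \<beta> l) z) =
        (\<Sum>\<beta> | mdegree \<beta> = e. \<Sum>l\<in>UNIV. v x (?up \<beta> l) $ l *s monomial_field l (?up \<beta> l) z)"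
      by (rule sum.swap)
    ultimately show ?thesis
      by (simp only: sum.distrib)
  qed
  have "reachable X vp (Suc e) (\<lambda>x z. v x \<alpha> $ l *s monomial_field l \<alpha> z)"
    if "mdegree \<alpha> = Suc e" "\<alpha> l = 0" for \<alpha> l
    using reachable_field_shear[OF that(2,1), of X vp] e v unfolding reachable_field_def by simp
  then have 1: "reachable X vp (Suc e)
      (\<lambda>x z. \<Sum>l\<in>UNIV. \<Sum>\<alpha> | mdegree \<alpha> = Suc e \<and> \<alpha> l = 0. v x \<alpha> $ l *s monomial_field l \<alpha> z)"
    by (intro reachable_sum) auto
  have 2: "reachable X vp (Suc e)
      (\<lambda>x z. \<Sum>l\<in>UNIV. v x (?up \<beta> l) $ l *s monomial_field l (?up \<beta> l) z)" if \<beta>: "mdegree \<beta> = e" for \<beta>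
  proof -
    \<comment> \<open>Any direction can serve as reference: the equation determines its coefficient
      from the others.\<close>
    fix i :: 'n
    let ?s = "inverse (of_nat (Suc (\<beta> i))) :: complex"
    let ?pair = "\<lambda>l z. of_nat (Suc (\<beta> i)) *s monomial_field l (?up \<beta> l) z -
      of_nat (Suc (\<beta> l)) *s monomial_field i (?up \<beta> i) z"
    have "reachable X vp (Suc e) (\<lambda>x z. (?s * v x (?up \<beta> l) $ l) *s ?pair l z)" if "l \<noteq> i" for l
    proof -
      have "holomorphic_fun X (\<lambda>x. ?s * v x (?up \<beta> l) $ l)"
        by (intro holomorphic_fun_mult holomorphic_fun_const X v)
      moreover have "reachable_field X vp (Suc e) (?pair l)"
        using reachable_field_pair[OF X that, of \<beta> "Suc e" vp] \<beta> e by simp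
      ultimately show ?thesis
        unfolding reachable_field_def by blast
    qed
    then have "reachable X vp (Suc e) (\<lambda>x z. \<Sum>l\<in>UNIV - {i}. (?s * v x (?up \<beta> l) $ l) *s ?pair l z)"
      by (intro reachable_sum) auto
    then show ?thesis
    proof (rule reachable_cong)
      fix x z assume x: "x \<in> topspace (cs_top X)"
      let ?c = "\<lambda>l. v x (?up \<beta> l) $ l"
      have "(\<Sum>l\<in>UNIV - {i}. of_nat (Suc (\<beta> l)) * ?c l) = - (of_nat (Suc (\<beta> i)) * ?c i)"
        using div[OF x \<beta>] by (simp add: sum.remove[of UNIV i] eq_neg_iff_add_eq_0 add.commute del: of_nat_Suc)
      then have ci: "?s * (\<Sum>l\<in>UNIV - {i}. of_nat (Suc (\<beta> l)) * ?c l) = - ?c i"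
        by (simp del: of_nat_Suc)
      have "s * c * (n * m - p * u) = c * m - s * (p * c) * u" if "n * s = 1" for s c n m p u :: complex
        using that by algebra
      moreover have "of_nat (Suc (\<beta> i)) * ?s = 1"
        by (simp del: of_nat_Suc)
      ultimately have pair: "(?s * ?c l) *s ?pair l z = ?c l *s monomial_field l (?up \<beta> l) z -
          (?s * (of_nat (Suc (\<beta> l)) * ?c l)) *s monomial_field i (?up \<beta> i) z" for l
        by (simp only: vec_eq_iff vector_minus_component vector_smult_component) blast
      have "(\<Sum>l\<in>UNIV - {i}. (?s * ?c l) *s ?pair l z) =
          (\<Sum>l\<in>UNIV - {i}. ?c l *s monomial_field l (?up \<beta> l) z) -
          (?s * (\<Sum>l\<in>UNIV - {i}. of_nat (Suc (\<beta> l)) * ?c l)) *s monomial_field i (?up \<beta> i) z"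
        unfolding pair sum_subtractf sum_distrib_left vec.scale_sum_left ..
      also have "\<dots> = (\<Sum>l\<in>UNIV. ?c l *s monomial_field l (?up \<beta> l) z)"
        unfolding ci by (simp add: sum.remove[of UNIV i])
      finally show "(\<Sum>l\<in>UNIV - {i}. (?s * ?c l) *s ?pair l z) =
          (\<Sum>l\<in>UNIV. ?c l *s monomial_field l (?up \<beta> l) z)" .
    qed
  qed
  show ?thesis
    unfolding split by (rule reachable_add[OF 1], rule reachable_sum, rule 2) simp
qed


section \<open>Jacobians of jets\<close>

definition jet_pd :: "nat \<Rightarrow> 'n::finite jet \<Rightarrow> 'n \<Rightarrow> 'n \<Rightarrow> complex ^ 'n \<Rightarrow> complex" where
  "jet_pd k a i j z = (\<Sum>\<alpha> | mdegree \<alpha> \<le> k. a \<alpha> $ i * monomial_pd j \<alpha> z)"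

lemma jet_poly_nth: "jet_poly k a z $ i = (\<Sum>\<alpha> | mdegree \<alpha> \<le> k. a \<alpha> $ i * monomial \<alpha> z)"
  by (simp add: jet_poly_def monomial_def sum_component mult.commute)

lemma has_derivative_jet_poly:
  "(jet_poly k a has_derivative (\<lambda>h. \<chi> i. \<Sum>j\<in>UNIV. jet_pd k a i j z * h $ j)) (at z)"
  unfolding has_derivative_cvec_iff jet_poly_nth vec_lambda_beta
proof
  fix i
  have "((\<lambda>z. \<Sum>\<alpha> | mdegree \<alpha> \<le> k. a \<alpha> $ i * monomial \<alpha> z) has_derivative
      (\<lambda>h. \<Sum>\<alpha> | mdegree \<alpha> \<le> k. a \<alpha> $ i * (\<Sum>j\<in>UNIV. monomial_pd j \<alpha> z * h $ j))) (at z)"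
    by (intro has_derivative_sum has_derivative_mult_right has_derivative_monomial)
  moreover have "(\<Sum>\<alpha> | mdegree \<alpha> \<le> k. a \<alpha> $ i * (\<Sum>j\<in>UNIV. monomial_pd j \<alpha> z * h $ j)) =
      (\<Sum>j\<in>UNIV. jet_pd k a i j z * h $ j)" for h :: "complex ^ 'a"
    unfolding jet_pd_def sum_distrib_left sum_distrib_right by (subst sum.swap) (simp add: mult.assoc)
  ultimately show "((\<lambda>z. \<Sum>\<alpha> | mdegree \<alpha> \<le> k. a \<alpha> $ i * monomial \<alpha> z) has_derivative
      (\<lambda>h. \<Sum>j\<in>UNIV. jet_pd k a i j z * h $ j)) (at z)"
    by simp
qed

lemma jacobian_det_eq:
  assumes "(f has_derivative D) (at z)"
  shows "jacobian_det f z = det (matrix D)"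
  using frechet_derivative_at[OF assms] by (simp add: jacobian_det_def)

lemma jacobian_det_jet_poly: "jacobian_det (jet_poly k a) z = det (\<chi> i j. jet_pd k a i j z)"
proof -
  have "matrix (\<lambda>h. \<chi> i. \<Sum>j\<in>UNIV. jet_pd k a i j z * h $ j) = (\<chi> i j. jet_pd k a i j z)"
    by (simp add: vec_eq_iff matrix_nth axis_def if_distrib cong: if_cong)
  then show ?thesis
    using jacobian_det_eq[OF has_derivative_jet_poly, of k a z] by simp
qed

lemma vanishes_monomial_pd: "vanishes (mdegree \<alpha> - 1) (monomial_pd j \<alpha>)"
proof (cases "\<alpha> j")
  case (Suc r)
  then have "(\<alpha>(j := r))(j := Suc ((\<alpha>(j := r)) j)) = \<alpha>" by auto
  then have "mdegree (\<alpha>(j := r)) = mdegree \<alpha> - 1"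
    using mdegree_upd_Suc[of "\<alpha>(j := r)" j] by simp
  then have "vanishes (mdegree \<alpha> - 1) (\<lambda>z. of_nat (\<alpha> j) * monomial (\<alpha>(j := r)) z)"
    using vanishes_cmult[OF vanishes_monomial, of "\<alpha>(j := r)"] by simp
  then show ?thesis
    using Suc by (simp add: monomial_pd_def[abs_def])
qed (simp add: monomial_pd_def[abs_def])

text \<open>A monomial that contains z_j and differs from z_j has degree at least 2, so its
  derivative vanishes at the origin. Only the linear coefficient remains.\<close>

lemma vanishes_jet_pd_linear:
  assumes "k \<ge> 1"
  shows "vanishes 1 (\<lambda>z. jet_pd k a i j z - a (unit_index j) $ i)"
proof -
  have "jet_pd k a i j z - a (unit_index j) $ i =
      (\<Sum>\<alpha>\<in>{\<alpha>. mdegree \<alpha> \<le> k} - {unit_index j}. a \<alpha> $ i * monomial_pd j \<alpha> z)" for z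
  proof -
    have "monomial_pd j (unit_index j) z = 1"
      by (simp add: monomial_pd_def fun_upd_idem)
    then show ?thesis
      unfolding jet_pd_def using assms
      by (subst sum.remove[OF finite_mdegree_le, of "unit_index j"]) auto
  qed
  moreover have "vanishes 1 (\<lambda>z. \<Sum>\<alpha>\<in>{\<alpha>. mdegree \<alpha> \<le> k} - {unit_index j}. a \<alpha> $ i * monomial_pd j \<alpha> z)"
  proof (intro vanishes_sum vanishes_cmult)
    fix \<alpha> assume "\<alpha> \<in> {\<alpha>. mdegree \<alpha> \<le> k} - {unit_index j}"
    then have ne: "\<alpha> \<noteq> unit_index j" by auto
    show "vanishes 1 (monomial_pd j \<alpha>)"
    proof (cases "\<alpha> j = 0")
      case True
      then show ?thesis by (simp add: monomial_pd_def[abs_def])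
    next
      case False
      then have "\<alpha> \<noteq> (\<lambda>_. 0)" by auto
      moreover have "\<alpha> \<noteq> unit_index l" for l
        using ne False by (cases "l = j") auto
      ultimately have "\<not> mdegree \<alpha> \<le> 1"
        using mdegree_le_1_cases by blast
      then show ?thesis
        by (intro vanishes_mono[OF vanishes_monomial_pd]) simp
    qed
  qed
  ultimately show ?thesis by simp
qed

text \<open>Every term beyond the first order expansion contains at least two of the perturbations
  \<open>n i\<close>, while all other factors are bounded. In the induction the new remainder is (a
  k + n k) times the old one plus n k times the old first order part.\<close>

lemma vanishes_prod_perturbation:
  fixes a n :: "'i \<Rightarrow> complex ^ 'n::finite \<Rightarrow> complex"
  assumes "finite S" "\<And>i. i \<in> S \<Longrightarrow> vanishes 0 (a i)" "\<And>i. i \<in> S \<Longrightarrow> vanishes d (n i)"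
  shows "vanishes (d + d) (\<lambda>z. (\<Prod>i\<in>S. a i z + n i z) - (\<Prod>i\<in>S. a i z) - (\<Sum>i\<in>S. n i z * (\<Prod>j\<in>S - {i}. a j z)))"
  using assms
proof (induction S rule: finite_induct)
  case (insert k S)
  let ?R = "\<lambda>z. (\<Prod>i\<in>S. a i z + n i z) - (\<Prod>i\<in>S. a i z) - (\<Sum>i\<in>S. n i z * (\<Prod>j\<in>S - {i}. a j z))"
  let ?T = "\<lambda>z. \<Sum>i\<in>S. n i z * (\<Prod>j\<in>S - {i}. a j z)"
  have T: "vanishes d ?T"
  proof (rule vanishes_sum)
    fix i assume i: "i \<in> S"
    have "vanishes 0 (\<lambda>z. \<Prod>j\<in>S - {i}. a j z)"
      using vanishes_prod[of "S - {i}" "\<lambda>_. 0" a] insert.prems(1) by simp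
    then show "vanishes d (\<lambda>z. n i z * (\<Prod>j\<in>S - {i}. a j z))"
      using vanishes_mult[of d "n i" 0] insert.prems(2) i by simp
  qed
  have "vanishes (0 + (d + d)) (\<lambda>z. (a k z + n k z) * ?R z)"
    using insert by (intro vanishes_mult vanishes_add) (auto intro: vanishes_mono)
  moreover have "vanishes (d + d) (\<lambda>z. n k z * ?T z)"
    using insert by (intro vanishes_mult T) auto
  ultimately have "vanishes (d + d) (\<lambda>z. (a k z + n k z) * ?R z + n k z * ?T z)"
    by (intro vanishes_add) simp_all
  moreover have "(\<Prod>i\<in>insert k S. a i z + n i z) - (\<Prod>i\<in>insert k S. a i z) -
      (\<Sum>i\<in>insert k S. n i z * (\<Prod>j\<in>insert k S - {i}. a j z)) = (a k z + n k z) * ?R z + n k z * ?T z" for z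
  proof -
    have "(\<Sum>i\<in>S. n i z * (\<Prod>j\<in>insert k S - {i}. a j z)) = a k z * ?T z"
      unfolding sum_distrib_left
    proof (intro sum.cong refl)
      fix i assume i: "i \<in> S"
      then have "insert k S - {i} = insert k (S - {i})" using insert.hyps by auto
      then show "n i z * (\<Prod>j\<in>insert k S - {i}. a j z) = a k z * (n i z * (\<Prod>j\<in>S - {i}. a j z))"
        using insert.hyps by simp
    qed
    then show ?thesis
      using insert.hyps by (simp add: algebra_simps)
  qed
  ultimately show ?case by simp
qed simp

text \<open>No permutation moves exactly one point: if i is moved, so is p i. After row i is
  deleted, a Leibniz term of a nontrivial permutation thus still has an off-diagonal factor.\<close>

lemma permutes_moves_other:
  assumes "p permutes UNIV" "p \<noteq> id"
  obtains j where "j \<noteq> i" "p j \<noteq> j"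
proof (cases "p i = i")
  case True
  with assms(2) that show ?thesis by (metis eq_id_iff)
next
  case False
  then have "p (p i) \<noteq> p i"
    using permutes_inj[OF assms(1)] by (simp add: inj_eq)
  with False that show ?thesis by blast
qed

text \<open>In the Leibniz formula, terms with two entries of N have order 2 d, which is at least d
  + 1. Among those with one entry, the identity permutation contributes the trace up to a factor 1 +
  O(|z|), and any other permutation supplies an additional off-diagonal entry of M, which is
  O(|z|).\<close>

lemma vanishes_det_perturbation:
  fixes M N :: "complex ^ 'n::finite \<Rightarrow> complex ^ 'n ^ 'n"
  assumes M: "\<And>i j. vanishes 1 (\<lambda>z. M z $ i $ j - (if i = j then 1 else 0))"
    and N: "\<And>i j. vanishes d (\<lambda>z. N z $ i $ j)" and d: "d \<ge> 1"
  shows "vanishes (Suc d) (\<lambda>z. det (M z + N z) - det (M z) - (\<Sum>i\<in>UNIV. N z $ i $ i))"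
proof -
  have M0: "vanishes 0 (\<lambda>z. M z $ i $ j)" for i j
    using vanishes_add[OF vanishes_mono[OF M[of i j]] vanishes_const[of "if i = j then 1 else 0"]] by simp
  let ?T = "\<lambda>p z. \<Sum>i\<in>UNIV. N z $ i $ p i * (\<Prod>j\<in>UNIV - {i}. M z $ j $ p j)"
  let ?R = "\<lambda>p z. (\<Prod>i\<in>UNIV. M z $ i $ p i + N z $ i $ p i) - (\<Prod>i\<in>UNIV. M z $ i $ p i) - ?T p z"
  let ?t = "\<lambda>p z. if p = id then \<Sum>i\<in>UNIV. N z $ i $ i else 0"
  let ?P = "{p. p permutes (UNIV :: 'n set)}"
  have R: "vanishes (Suc d) (?R p)" for p
    using vanishes_prod_perturbation[of UNIV "\<lambda>i z. M z $ i $ p i" d "\<lambda>i z. N z $ i $ p i"] M0 N d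
    by (auto intro: vanishes_mono)
  have T: "vanishes (Suc d) (\<lambda>z. of_int (sign p) * ?T p z - ?t p z)" if p: "p permutes UNIV" for p
  proof (cases "p = id")
    case True
    have "vanishes (d + 1) (\<lambda>z. N z $ i $ i * ((\<Prod>j\<in>UNIV - {i}. M z $ j $ j) - 1))" for i
    proof (rule vanishes_mult[OF N])
      have "leading 0 (\<lambda>z. M z $ j $ j) (\<lambda>z. 1)" for j
        using M[of j j] by (simp add: leading_def vanishes_const)
      then show "vanishes 1 (\<lambda>z. (\<Prod>j\<in>UNIV - {i}. M z $ j $ j) - 1)"
        using leading_prod[of "UNIV - {i}" "\<lambda>_. 0" "\<lambda>j z. M z $ j $ j" "\<lambda>j z. 1"]
        by (simp add: leading_def)
    qed
    then have "vanishes (Suc d) (\<lambda>z. \<Sum>i\<in>UNIV. N z $ i $ i * ((\<Prod>j\<in>UNIV - {i}. M z $ j $ j) - 1))"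
      by (intro vanishes_sum) simp
    then show ?thesis
      using True by (simp add: sum_subtractf right_diff_distrib sign_id)
  next
    case False
    have "vanishes (d + 1) (\<lambda>z. N z $ i $ p i * (\<Prod>j\<in>UNIV - {i}. M z $ j $ p j))" for i
    proof (rule vanishes_mult[OF N])
      obtain j where j: "j \<noteq> i" "p j \<noteq> j" using permutes_moves_other[OF p False] .
      have "vanishes (1 + 0) (\<lambda>z. M z $ j $ p j * (\<Prod>l\<in>UNIV - {i} - {j}. M z $ l $ p l))"
      proof (rule vanishes_mult)
        show "vanishes 1 (\<lambda>z. M z $ j $ p j)" using M[of j "p j"] j(2) by auto
        show "vanishes 0 (\<lambda>z. \<Prod>l\<in>UNIV - {i} - {j}. M z $ l $ p l)"
          using vanishes_prod[of "UNIV - {i} - {j}" "\<lambda>_. 0" "\<lambda>l z. M z $ l $ p l"] M0 by simp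
      qed
      then show "vanishes 1 (\<lambda>z. \<Prod>j\<in>UNIV - {i}. M z $ j $ p j)"
        using j(1) by (simp add: prod.remove[of "UNIV - {i}" j])
    qed
    then have "vanishes (Suc d) (?T p)"
      by (intro vanishes_sum) simp
    then show ?thesis
      using False by (simp add: vanishes_cmult)
  qed
  have "vanishes (Suc d) (\<lambda>z. \<Sum>p\<in>?P. of_int (sign p) * ?R p z + (of_int (sign p) * ?T p z - ?t p z))"
    by (intro vanishes_sum vanishes_add vanishes_cmult R T) simp
  moreover have "(\<Sum>p\<in>?P. of_int (sign p) * ?R p z + (of_int (sign p) * ?T p z - ?t p z)) =
      det (M z + N z) - det (M z) - (\<Sum>i\<in>UNIV. N z $ i $ i)" for z
  proof -
    have "(\<Sum>p\<in>?P. ?t p z) = (\<Sum>i\<in>UNIV. N z $ i $ i)"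
      by (subst sum.delta) (simp_all add: finite_permutations permutes_id)
    then show ?thesis
      by (simp add: det_def sum_subtractf sum.distrib right_diff_distrib sum_negf)
  qed
  ultimately show ?thesis by simp
qed

text \<open>The Jacobian matrices of the two jets differ by a matrix of order e. To first order the
  determinants then differ by its trace, whose terms of degree e form the divergence of the degree e
  + 1 part of q - b. As the Jacobians agree up to O(|z|^(e+1)), uniqueness of coefficients makes
  this divergence vanish.\<close>

lemma divergence_free_of_unimodular:
  fixes q b :: "'n::finite jet"
  assumes "k \<ge> Suc e" "e \<ge> 1"
    and lin: "\<And>i j. b (unit_index j) $ i = (if i = j then 1 else 0)"
    and agree: "\<And>\<alpha>. mdegree \<alpha> \<le> e \<Longrightarrow> q \<alpha> = b \<alpha>"
    and jac: "vanishes (Suc e) (\<lambda>z. jacobian_det (jet_poly k q) z - jacobian_det (jet_poly k b) z)"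
    and \<beta>: "mdegree \<beta> = e"
  shows "(\<Sum>l\<in>UNIV. of_nat (Suc (\<beta> l)) * (q (\<beta>(l := Suc (\<beta> l))) - b (\<beta>(l := Suc (\<beta> l)))) $ l) = 0"
proof -
  let ?M = "\<lambda>z. \<chi> i j. jet_pd k b i j z"
  let ?c = "\<lambda>\<alpha>. q \<alpha> - b \<alpha>"
  let ?N = "\<lambda>z. \<chi> i j. jet_pd k ?c i j z"
  let ?D = "\<lambda>\<beta>. \<Sum>l\<in>UNIV. of_nat (Suc (\<beta> l)) * ?c (\<beta>(l := Suc (\<beta> l))) $ l"
  have sum_eq: "jet_pd k q i j z = jet_pd k b i j z + jet_pd k ?c i j z" for i j z
    by (simp add: jet_pd_def sum.distrib[symmetric] algebra_simps)
  have N: "vanishes e (\<lambda>z. jet_pd k ?c i j z)" for i j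
    unfolding jet_pd_def
  proof (rule vanishes_sum)
    fix \<alpha> :: "'n \<Rightarrow> nat"
    show "vanishes e (\<lambda>z. ?c \<alpha> $ i * monomial_pd j \<alpha> z)"
    proof (cases "mdegree \<alpha> \<le> e")
      case False
      then show ?thesis
        by (intro vanishes_cmult vanishes_mono[OF vanishes_monomial_pd]) simp
    qed (simp add: agree)
  qed
  have "vanishes (Suc e) (\<lambda>z. det (?M z + ?N z) - det (?M z) - (\<Sum>i\<in>UNIV. ?N z $ i $ i))"
  proof (rule vanishes_det_perturbation)
    show "vanishes 1 (\<lambda>z. ?M z $ i $ j - (if i = j then 1 else 0))" for i j
      using vanishes_jet_pd_linear[of k b i j] assms(1) by (simp add: lin[unfolded One_nat_def])
  qed (use N assms(2) in auto)
  moreover have "?M z + ?N z = (\<chi> i j. jet_pd k q i j z)" for z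
    by (simp add: vec_eq_iff sum_eq)
  ultimately have "vanishes (Suc e) (\<lambda>z. (jacobian_det (jet_poly k q) z - jacobian_det (jet_poly k b) z) -
      (\<Sum>i\<in>UNIV. jet_pd k ?c i i z))"
    by (simp add: jacobian_det_jet_poly)
  from vanishes_diff[OF jac this] have tr: "vanishes (Suc e) (\<lambda>z. \<Sum>i\<in>UNIV. jet_pd k ?c i i z)"
    by simp
  \<comment> \<open>Terms of degree at most e cancel by agreement, and derivatives of terms of
    degree at least e + 2 have order at least e + 1.\<close>
  have tail: "vanishes (Suc e) (\<lambda>z. jet_pd k ?c i i z - (\<Sum>\<alpha> | mdegree \<alpha> = Suc e. ?c \<alpha> $ i * monomial_pd i \<alpha> z))" for i
  proof -
    have "jet_pd k ?c i i z - (\<Sum>\<alpha> | mdegree \<alpha> = Suc e. ?c \<alpha> $ i * monomial_pd i \<alpha> z) =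
        (\<Sum>\<alpha>\<in>{\<alpha>. mdegree \<alpha> \<le> k} - {\<alpha>. mdegree \<alpha> = Suc e}. ?c \<alpha> $ i * monomial_pd i \<alpha> z)" for z
      unfolding jet_pd_def using assms(1) finite_mdegree_le by (subst sum_diff) auto
    moreover have "vanishes (Suc e)
        (\<lambda>z. \<Sum>\<alpha>\<in>{\<alpha>. mdegree \<alpha> \<le> k} - {\<alpha>. mdegree \<alpha> = Suc e}. ?c \<alpha> $ i * monomial_pd i \<alpha> z)"
    proof (rule vanishes_sum)
      fix \<alpha> assume \<alpha>: "\<alpha> \<in> {\<alpha> :: 'n \<Rightarrow> nat. mdegree \<alpha> \<le> k} - {\<alpha>. mdegree \<alpha> = Suc e}"
      show "vanishes (Suc e) (\<lambda>z. ?c \<alpha> $ i * monomial_pd i \<alpha> z)"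
      proof (cases "mdegree \<alpha> \<le> e")
        case False
        then show ?thesis
          using \<alpha> by (intro vanishes_cmult vanishes_mono[OF vanishes_monomial_pd]) auto
      qed (simp add: agree)
    qed
    ultimately show ?thesis by simp
  qed
  have "vanishes (Suc e) (\<lambda>z. (\<Sum>i\<in>UNIV. jet_pd k ?c i i z) -
      (\<Sum>i\<in>UNIV. jet_pd k ?c i i z - (\<Sum>\<alpha> | mdegree \<alpha> = Suc e. ?c \<alpha> $ i * monomial_pd i \<alpha> z)))"
    by (intro vanishes_diff tr vanishes_sum tail)
  moreover have "(\<Sum>\<alpha> | mdegree \<alpha> = Suc e. ?c \<alpha> $ i * monomial_pd i \<alpha> z) =
      (\<Sum>\<beta> | mdegree \<beta> = e. of_nat (Suc (\<beta> i)) * ?c (\<beta>(i := Suc (\<beta> i))) $ i * monomial \<beta> z)" for i z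
    unfolding sum_mdegree_Suc[of _ e i] by (simp add: monomial_pd_def mult_ac del: of_nat_Suc)
  ultimately have "vanishes (Suc e) (\<lambda>z. \<Sum>i\<in>UNIV. \<Sum>\<beta> | mdegree \<beta> = e.
      of_nat (Suc (\<beta> i)) * ?c (\<beta>(i := Suc (\<beta> i))) $ i * monomial \<beta> z)"
    by (simp add: sum_subtractf del: of_nat_Suc)
  then have "vanishes (Suc e) (\<lambda>z. \<Sum>\<beta> | mdegree \<beta> = e. ?D \<beta> * monomial \<beta> z)"
    unfolding sum_distrib_right by (subst (asm) sum.swap)
  moreover have "finite {\<beta> :: 'n \<Rightarrow> nat. mdegree \<beta> = e}"
    by (rule finite_subset[OF _ finite_mdegree_le[of e]]) auto
  ultimately show ?thesis
    using \<beta> by (intro vanishes_polynomial_imp_zero[of "{\<beta>. mdegree \<beta> = e}" e ?D]) auto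
qed

section \<open>Holomorphic families with prescribed jets\<close>

lemma jet_poly_expand_vanishes:
  assumes "\<And>i. vanishes m (\<lambda>z. F z $ i - (\<Sum>\<alpha> | mdegree \<alpha> \<le> k. b \<alpha> $ i * monomial \<alpha> z))"
  shows "vanishes m (\<lambda>z. F z - jet_poly k b z)"
  using assms by (simp add: vanishes_vec_iff jet_poly_nth)

lemma vanishes_jet_poly_tail: "k \<le> M \<Longrightarrow> vanishes (Suc k) (\<lambda>z. jet_poly M b z - jet_poly k b z)"
  unfolding vanishes_vec_iff vector_minus_component jet_poly_nth
  by (intro allI vanishes_polynomial_tail)

lemma jet_poly_truncate:
  assumes "\<And>\<alpha>. mdegree \<alpha> > k \<Longrightarrow> a \<alpha> = 0" "k \<le> M"
  shows "jet_poly M a z = jet_poly k a z"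
  unfolding jet_poly_def
proof (rule sum.mono_neutral_right)
  show "finite {\<alpha>. mdegree \<alpha> \<le> M}" by (rule finite_mdegree_le)
qed (use assms in auto)

lemma jet_poly_vanishes_imp_eq:
  assumes "vanishes (Suc k) (\<lambda>z. jet_poly k a z - jet_poly k b z)" "mdegree \<alpha> \<le> k"
  shows "a \<alpha> = b \<alpha>"
  unfolding vec_eq_iff
proof
  fix i
  have "vanishes (Suc k) (\<lambda>z. \<Sum>\<alpha> | mdegree \<alpha> \<le> k. (a \<alpha> $ i - b \<alpha> $ i) * monomial \<alpha> z)"
    using assms(1) by (simp add: vanishes_vec_iff jet_poly_nth left_diff_distrib sum_subtractf)
  then have "a \<alpha> $ i - b \<alpha> $ i = 0"
    using assms(2)
    by (intro vanishes_polynomial_imp_zero[OF finite_mdegree_le[of k], where c = "\<lambda>\<alpha>. a \<alpha> $ i - b \<alpha> $ i"]) auto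
  then show "a \<alpha> $ i = b \<alpha> $ i" by simp
qed

text \<open>In the volume preserving case a single coefficient family serves both as the jet and,
  since the maps are polynomial, as an exact expansion at every large order.\<close>

lemma tangent_family_expand:
  fixes F :: "'a \<Rightarrow> complex ^ 'n::finite \<Rightarrow> complex ^ 'n"
  assumes X: "charts_in_coord_space X" and F: "tangent_family X vp F"
  obtains b where "\<And>\<alpha> l. holomorphic_fun X (\<lambda>x. b x \<alpha> $ l)"
    "\<And>x. x \<in> topspace (cs_top X) \<Longrightarrow> vanishes (Suc k) (\<lambda>z. F x z - jet_poly k (b x) z)"
    "\<And>x. vp \<Longrightarrow> \<exists>N. \<forall>M\<ge>N. \<forall>z. F x z = jet_poly M (b x) z"
proof (cases vp)
  case False
  have "\<forall>i. \<exists>b. (\<forall>\<alpha>. holomorphic_fun X (\<lambda>x. b x \<alpha>)) \<and> (\<forall>x \<in> topspace (cs_top X).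
     vanishes (Suc k) (\<lambda>z. F x z $ i - (\<Sum>\<alpha> | mdegree \<alpha> \<le> k. b x \<alpha> * monomial \<alpha> z)))"
    using F by (intro allI has_jets_expand X aut_family_has_jets[of X vp]) (simp add: tangent_family_def)
  from choice[OF this] obtain b where "\<forall>i. (\<forall>\<alpha>. holomorphic_fun X (\<lambda>x. b i x \<alpha>)) \<and>
    (\<forall>x \<in> topspace (cs_top X).
     vanishes (Suc k) (\<lambda>z. F x z $ i - (\<Sum>\<alpha> | mdegree \<alpha> \<le> k. b i x \<alpha> * monomial \<alpha> z)))" ..
  then have b: "\<And>i \<alpha>. holomorphic_fun X (\<lambda>x. b i x \<alpha>)"
    "\<And>i x. x \<in> topspace (cs_top X) \<Longrightarrow>
      vanishes (Suc k) (\<lambda>z. F x z $ i - (\<Sum>\<alpha> | mdegree \<alpha> \<le> k. b i x \<alpha> * monomial \<alpha> z))"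
    by simp_all
  show ?thesis
  proof (rule that[of "\<lambda>x \<alpha>. \<chi> i. b i x \<alpha>"])
    show "vanishes (Suc k) (\<lambda>z. F x z - jet_poly k (\<lambda>\<alpha>. \<chi> i. b i x \<alpha>) z)"
      if "x \<in> topspace (cs_top X)" for x
      using b(2)[OF that] by (intro jet_poly_expand_vanishes) simp
  qed (use b(1) False in simp_all)
next
  case True
  have "\<forall>i. \<exists>b N. (\<forall>\<alpha>. holomorphic_fun X (\<lambda>x. b x \<alpha>)) \<and>
    (\<forall>M\<ge>N. \<forall>x z. F x z $ i = (\<Sum>\<alpha> | mdegree \<alpha> \<le> M. b x \<alpha> * monomial \<alpha> z))"
    using F True by (intro allI family_poly_expand X aut_family_volume_preserving_poly) (simp add: tangent_family_def)
  from choice[OF this] obtain b where "\<forall>i. \<exists>N. (\<forall>\<alpha>. holomorphic_fun X (\<lambda>x. b i x \<alpha>)) \<and>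
    (\<forall>M\<ge>N. \<forall>x z. F x z $ i = (\<Sum>\<alpha> | mdegree \<alpha> \<le> M. b i x \<alpha> * monomial \<alpha> z))" ..
  from choice[OF this] obtain N where N: "\<forall>i. (\<forall>\<alpha>. holomorphic_fun X (\<lambda>x. b i x \<alpha>)) \<and>
    (\<forall>M\<ge>N i. \<forall>x z. F x z $ i = (\<Sum>\<alpha> | mdegree \<alpha> \<le> M. b i x \<alpha> * monomial \<alpha> z))" ..
  then have b: "holomorphic_fun X (\<lambda>x. b i x \<alpha>)"
    "M \<ge> N i \<Longrightarrow> F x z $ i = (\<Sum>\<alpha> | mdegree \<alpha> \<le> M. b i x \<alpha> * monomial \<alpha> z)" for i \<alpha> M x z
    by blast+
  let ?b = "\<lambda>x \<alpha>. \<chi> i. b i x \<alpha>"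
  have eq: "F x z = jet_poly M (?b x) z" if "M \<ge> Max (range N)" for M x z
  proof -
    have "M \<ge> N i" for i
      using that by (meson Max_ge finite finite_imageI order_trans rangeI)
    then show ?thesis
      using b(2) by (simp add: vec_eq_iff jet_poly_nth)
  qed
  show ?thesis
  proof (rule that[of ?b])
    show "vanishes (Suc k) (\<lambda>z. F x z - jet_poly k (?b x) z)" for x
      using vanishes_jet_poly_tail[of k "max k (Max (range N))" "?b x"]
        eq[of "max k (Max (range N))" x] by simp
    show "\<exists>N. \<forall>M\<ge>N. \<forall>z. F x z = jet_poly M (?b x) z" for x
      using eq by blast
  qed (use b(1) in simp)
qed

lemma jacobian_det_tangent_family:
  assumes "tangent_family X True F"
  shows "jacobian_det (F x) z = 1"
proof -
  obtain D where "(F x has_derivative D) (at z)" "det (matrix D) = 1"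
    using aut_family_unimodular[of X F x z] assms unfolding tangent_family_def by blast
  then show ?thesis by (simp add: jacobian_det_eq)
qed

lemma sum_mdegree_le_Suc:
  fixes f :: "('n::finite \<Rightarrow> nat) \<Rightarrow> 'b::comm_monoid_add"
  shows "(\<Sum>\<alpha> | mdegree \<alpha> \<le> Suc e. f \<alpha>) = (\<Sum>\<alpha> | mdegree \<alpha> \<le> e. f \<alpha>) + (\<Sum>\<alpha> | mdegree \<alpha> = Suc e. f \<alpha>)"
proof -
  have "{\<alpha> :: 'n \<Rightarrow> nat. mdegree \<alpha> \<le> Suc e} = {\<alpha>. mdegree \<alpha> \<le> e} \<union> {\<alpha>. mdegree \<alpha> = Suc e}" by auto
  moreover have "finite {\<alpha> :: 'n \<Rightarrow> nat. mdegree \<alpha> = Suc e}"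
    by (rule finite_subset[OF _ finite_mdegree_le[of "Suc e"]]) auto
  ultimately show ?thesis
    using finite_mdegree_le by (simp only:) (subst sum.union_disjoint, auto)
qed

text \<open>The jets \<open>b\<close> of F are holomorphic in x, hence so is the error q - b, whose
  terms of degree e + 1 are the next field to be reached.\<close>

lemma tangent_family_improve:
  fixes F :: "'a \<Rightarrow> complex ^ 'n::finite \<Rightarrow> complex ^ 'n" and q :: "'a \<Rightarrow> 'n jet"
  assumes X: "charts_in_coord_space X" and card: "CARD('n) > 1" and e: "1 \<le> e" "e < k"
    and q: "\<And>\<alpha> l. holomorphic_fun X (\<lambda>x. q x \<alpha> $ l)"
    and q_deg: "\<And>x \<alpha>. x \<in> topspace (cs_top X) \<Longrightarrow> mdegree \<alpha> > k \<Longrightarrow> q x \<alpha> = 0"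
    and q_lin: "\<And>x i j. x \<in> topspace (cs_top X) \<Longrightarrow> q x (unit_index j) $ i = (if i = j then 1 else 0)"
    and jac: "\<And>x. vp \<Longrightarrow> x \<in> topspace (cs_top X) \<Longrightarrow>
      vanishes (Suc k) (\<lambda>z. jacobian_det (jet_poly k (q x)) z - 1)"
    and F: "tangent_family X vp F"
    and F_jet: "\<And>x. x \<in> topspace (cs_top X) \<Longrightarrow> vanishes (Suc e) (\<lambda>z. F x z - jet_poly k (q x) z)"
  shows "\<exists>F'. tangent_family X vp F' \<and>
    (\<forall>x \<in> topspace (cs_top X). vanishes (Suc (Suc e)) (\<lambda>z. F' x z - jet_poly k (q x) z))"
proof -
  obtain b where b: "\<And>\<alpha> l. holomorphic_fun X (\<lambda>x. b x \<alpha> $ l)"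
    "\<And>x. x \<in> topspace (cs_top X) \<Longrightarrow> vanishes (Suc (Suc e)) (\<lambda>z. F x z - jet_poly (Suc e) (b x) z)"
    "\<And>x. vp \<Longrightarrow> \<exists>N. \<forall>M\<ge>N. \<forall>z. F x z = jet_poly M (b x) z"
    using tangent_family_expand[OF X F, of "Suc e"] by blast
  let ?v = "\<lambda>x \<alpha>. q x \<alpha> - b x \<alpha>"
  let ?V = "\<lambda>x z. \<Sum>\<alpha> | mdegree \<alpha> = Suc e. monomial \<alpha> z *s ?v x \<alpha>"
  have agree: "q x \<alpha> = b x \<alpha>" if x: "x \<in> topspace (cs_top X)" and \<alpha>: "mdegree \<alpha> \<le> e" for x \<alpha>
  proof -
    \<comment> \<open>The terms with F cancel, leaving the difference of the two truncations at
      order e; its coefficients vanish by uniqueness.\<close>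
    have "vanishes (Suc e) (\<lambda>z. (jet_poly (Suc e) (b x) z - jet_poly e (b x) z) - (jet_poly k (q x) z - jet_poly e (q x) z)
        + (F x z - jet_poly (Suc e) (b x) z) - (F x z - jet_poly k (q x) z))"
      using e by (intro vanishes_diff vanishes_add vanishes_jet_poly_tail F_jet x vanishes_mono[OF b(2)[OF x]]) auto
    then have "vanishes (Suc e) (\<lambda>z. jet_poly e (q x) z - jet_poly e (b x) z)"
      by simp
    then show ?thesis
      using \<alpha> by (rule jet_poly_vanishes_imp_eq)
  qed
  have v: "holomorphic_fun X (\<lambda>x. ?v x \<alpha> $ l)" for \<alpha> l
    using holomorphic_fun_add[OF q holomorphic_fun_mult[OF holomorphic_fun_const[OF X, of "- 1"] b(1)]]
    by simp
  have "reachable X vp (Suc e) ?V"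
  proof (cases vp)
    case False
    then show ?thesis
      using reachable_homogeneous[OF X card e(1), of ?v] v by simp
  next
    case True
    show ?thesis
    proof (rule reachable_divergence_free[OF X e(1) v])
      fix x and \<beta> :: "'n \<Rightarrow> nat"
      assume x: "x \<in> topspace (cs_top X)" and \<beta>: "mdegree \<beta> = e"
      from b(3)[OF True] obtain N where N: "\<forall>M\<ge>N. \<forall>z. F x z = jet_poly M (b x) z" ..
      \<comment> \<open>At this order both F x and the target jet are exactly of the form
        \<open>jet_poly ?M\<close>, so the Jacobian of F x can be used without differentiating an
        O-term.\<close>
      let ?M = "max k N"
      have "jet_poly ?M (b x) z = F x z" for z
        using N[rule_format, of ?M z] by simp
      then have "jet_poly ?M (b x) = F x" ..
      moreover have "jet_poly ?M (q x) z = jet_poly k (q x) z" for z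
        by (rule jet_poly_truncate[OF q_deg[OF x]]) simp_all
      then have "jet_poly ?M (q x) = jet_poly k (q x)" ..
      moreover have "vanishes (Suc e) (\<lambda>z. jacobian_det (jet_poly k (q x)) z - 1)"
        using jac[OF True x] by (rule vanishes_mono) (use e in simp)
      ultimately have "vanishes (Suc e) (\<lambda>z. jacobian_det (jet_poly ?M (q x)) z - jacobian_det (jet_poly ?M (b x)) z)"
        using jacobian_det_tangent_family[of X F x] F True by simp
      then show "(\<Sum>l\<in>UNIV. of_nat (Suc (\<beta> l)) * ?v x (\<beta>(l := Suc (\<beta> l))) $ l) = 0"
      proof (rule divergence_free_of_unimodular[rotated 4])
        show "b x (unit_index j) $ i = (if i = j then 1 else 0)" for i j
          using agree[OF x, of "unit_index j"] q_lin[OF x, of j i] e by simp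
      qed (use agree x \<beta> e in auto)
    qed
  qed
  then obtain F' where F': "tangent_family X vp F'"
    "\<And>x. x \<in> topspace (cs_top X) \<Longrightarrow> vanishes (Suc (Suc e)) (\<lambda>z. F' x z - (F x z + ?V x z))"
    using F unfolding reachable_def by blast
  have "vanishes (Suc (Suc e)) (\<lambda>z. F' x z - jet_poly k (q x) z)" if x: "x \<in> topspace (cs_top X)" for x
  proof -
    have V: "jet_poly (Suc e) (q x) z = jet_poly (Suc e) (b x) z + ?V x z" for z
    proof -
      have "jet_poly e (q x) z = jet_poly e (b x) z"
        unfolding jet_poly_def using agree[OF x] by (intro sum.cong) auto
      then show ?thesis
        unfolding jet_poly_def sum_mdegree_le_Suc
        by (simp add: monomial_def sum.distrib[symmetric] vector_add_ldistrib[symmetric])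
    qed
    have "vanishes (Suc (Suc e)) (\<lambda>z. (F' x z - (F x z + ?V x z)) + (F x z - jet_poly (Suc e) (b x) z)
        - (jet_poly k (q x) z - jet_poly (Suc e) (q x) z))"
      using e by (intro vanishes_diff vanishes_add vanishes_jet_poly_tail F' b x) auto
    then show ?thesis
      unfolding V by (simp add: algebra_simps)
  qed
  then show ?thesis using F'(1) by blast
qed

text \<open>The conditions on the constant and linear coefficients say that the 1-jet is that of the
  identity, so the identity family starts the induction at degree 1.\<close>

lemma tangent_family_with_jets:
  fixes q :: "'a \<Rightarrow> 'n::finite jet"
  assumes X: "charts_in_coord_space X" and card: "CARD('n) > 1" and k: "k \<ge> 1"
    and q: "\<And>\<alpha> l. holomorphic_fun X (\<lambda>x. q x \<alpha> $ l)"
    and q_deg: "\<And>x \<alpha>. x \<in> topspace (cs_top X) \<Longrightarrow> mdegree \<alpha> > k \<Longrightarrow> q x \<alpha> = 0"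
    and q_zero: "\<And>x. x \<in> topspace (cs_top X) \<Longrightarrow> q x (\<lambda>_. 0) = 0"
    and q_lin: "\<And>x i j. x \<in> topspace (cs_top X) \<Longrightarrow> q x (unit_index j) $ i = (if i = j then 1 else 0)"
    and jac: "\<And>x. vp \<Longrightarrow> x \<in> topspace (cs_top X) \<Longrightarrow>
      vanishes (Suc k) (\<lambda>z. jacobian_det (jet_poly k (q x)) z - 1)"
  shows "\<exists>F. tangent_family X vp F \<and>
    (\<forall>x \<in> topspace (cs_top X). vanishes (Suc k) (\<lambda>z. F x z - jet_poly k (q x) z))"
proof -
  have "\<exists>F. tangent_family X vp F \<and>
    (\<forall>x \<in> topspace (cs_top X). vanishes (Suc e) (\<lambda>z. F x z - jet_poly k (q x) z))" if "1 \<le> e" "e \<le> k" for e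
    using that
  proof (induction e rule: nat_induct_at_least)
    case base
    show ?case
    proof (intro exI conjI ballI)
      show "tangent_family X vp (\<lambda>x z. z)" by (rule tangent_family_id)
      fix x assume x: "x \<in> topspace (cs_top X)"
      have id: "jet_poly 1 (q x) z = z" for z
      proof -
        have "{\<alpha> :: 'n \<Rightarrow> nat. mdegree \<alpha> \<le> 1} = insert (\<lambda>_. 0) (range unit_index)"
          using mdegree_le_1_cases by (auto simp: image_iff)
        moreover have "inj (unit_index :: 'n \<Rightarrow> 'n \<Rightarrow> nat)"
          by (auto simp: inj_def fun_eq_iff split: if_splits)
        moreover have "(\<lambda>_. 0) \<notin> range (unit_index :: 'n \<Rightarrow> 'n \<Rightarrow> nat)"
        proof
          assume "(\<lambda>_. 0) \<in> range (unit_index :: 'n \<Rightarrow> 'n \<Rightarrow> nat)"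
          then obtain j :: 'n where "(\<lambda>_. 0) = unit_index j" by blast
          from fun_cong[OF this, of j] show False by simp
        qed
        ultimately have "jet_poly 1 (q x) z $ i = (\<Sum>j\<in>UNIV. q x (unit_index j) $ i * z $ j)" for i
          unfolding jet_poly_nth
          by (simp add: q_zero[OF x] sum.reindex del: One_nat_def fun_upd_apply)
        then show ?thesis
          by (simp add: vec_eq_iff q_lin[OF x, unfolded One_nat_def] if_distrib[of "\<lambda>u. u * _"] cong: if_cong)
      qed
      show "vanishes (Suc 1) (\<lambda>z. z - jet_poly k (q x) z)"
        using vanishes_minus[OF vanishes_jet_poly_tail[OF k, of "q x"]] unfolding id by simp
    qed
  next
    case (Suc e)
    then obtain F where "tangent_family X vp F"
      "\<And>x. x \<in> topspace (cs_top X) \<Longrightarrow> vanishes (Suc e) (\<lambda>z. F x z - jet_poly k (q x) z)"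
      by auto
    with Suc show ?case
      by (intro tangent_family_improve[OF X card _ _ q q_deg q_lin jac]) auto
  qed
  from this[OF k] show ?thesis by simp
qed

text \<open>Cramer's rule, spelled out so that the entries are visibly polynomial in those of A
  divided by det A, hence holomorphic in x.\<close>

definition adjugate_inverse :: "complex ^ 'n ^ 'n \<Rightarrow> complex ^ 'n::finite ^ 'n" where
  "adjugate_inverse A = (\<chi> l j. det (\<chi> i m. if m = l then (if i = j then 1 else 0) else A $ i $ m) * inverse (det A))"

lemma adjugate_inverse:
  assumes "det A \<noteq> 0"
  shows "A ** adjugate_inverse A = mat 1" "adjugate_inverse A ** A = mat 1"
proof -
  show "A ** adjugate_inverse A = mat 1"
    unfolding vec_eq_iff
  proof (intro allI)
    fix i j
    have "A *v column j (adjugate_inverse A) = axis j 1"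
      unfolding cramer[OF assms]
      by (simp add: vec_eq_iff column_def adjugate_inverse_def axis_def divide_inverse cong: if_cong)
    then have "(A *v column j (adjugate_inverse A)) $ i = mat 1 $ i $ j"
      by (simp add: axis_def mat_def)
    then show "(A ** adjugate_inverse A) $ i $ j = mat 1 $ i $ j"
      by (simp add: matrix_matrix_mult_def matrix_vector_mult_def column_def)
  qed
  then show "adjugate_inverse A ** A = mat 1"
    by (simp add: matrix_left_right_inverse)
qed

lemma holomorphic_fun_adjugate_inverse:
  assumes X: "charts_in_coord_space X" and A: "\<And>i j. holomorphic_fun X (\<lambda>x. A x $ i $ j)"
    and det: "\<And>x. x \<in> topspace (cs_top X) \<Longrightarrow> det (A x) \<noteq> 0"
  shows "holomorphic_fun X (\<lambda>x. adjugate_inverse (A x) $ l $ j)"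
proof -
  have "holomorphic_fun X (\<lambda>x. (\<chi> i m. if m = l then (if i = j then 1 else 0) else A x $ i $ m) $ i $ m)" for i m
    using A holomorphic_fun_const[OF X] by (cases "m = l") simp_all
  from holomorphic_fun_det[OF X this] show ?thesis
    unfolding adjugate_inverse_def vec_lambda_beta
    by (rule holomorphic_fun_mult) (intro holomorphic_fun_inverse holomorphic_fun_det X A det)
qed

lemma vanishes_matrix_vector_mult:
  fixes M :: "complex ^ 'n::finite ^ 'n"
  assumes "vanishes m f"
  shows "vanishes m (\<lambda>z. M *v f z)"
  using assms by (simp add: vanishes_vec_iff matrix_vector_mult_def vanishes_sum vanishes_cmult)

lemma jet_poly_matrix: "jet_poly k (\<lambda>\<alpha>. M *v a \<alpha>) z = M *v jet_poly k a z"
  unfolding vec_eq_iff jet_poly_nth matrix_vector_mult_def vec_lambda_beta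
  by (intro allI, simp only: sum_distrib_left sum_distrib_right, subst sum.swap, simp only: mult.assoc)

lemma jacobian_det_linear_compose:
  assumes "(f has_derivative D) (at z)"
  shows "jacobian_det (\<lambda>z. M *v f z) z = det M * jacobian_det f z"
proof -
  have "((\<lambda>z. M *v f z) has_derivative (\<lambda>h. M *v D h)) (at z)"
    using bounded_linear.has_derivative[OF matrix_vector_mul_bounded_linear assms] .
  moreover have "matrix (\<lambda>h. M *v D h) = M ** matrix D"
    by (simp add: vec_eq_iff matrix_nth matrix_matrix_mult_def matrix_vector_mult_def)
  ultimately show ?thesis
    using assms by (simp add: jacobian_det_eq det_mul)
qed

text \<open>The hypothesis constrains only a punctured neighbourhood, so the value at the origin is
  recovered as a limit: the entries of the Jacobian matrix tend to the linear part.\<close>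

lemma det_linear_part_eq_1:
  assumes "k \<ge> 1" "vanishes (Suc k) (\<lambda>z. jacobian_det (jet_poly k a) z - 1)"
  shows "det (jet_linear_part a) = 1"
proof -
  have "((\<lambda>z. jet_pd k a i j z - a (unit_index j) $ i) \<longlongrightarrow> 0) (at 0)" for i j
    using vanishes_jet_pd_linear[OF assms(1), of a i j] by (intro vanishes_imp_tendsto[of 0]) simp
  then have pd: "((\<lambda>z. jet_pd k a i j z) \<longlongrightarrow> jet_linear_part a $ i $ j) (at 0)" for i j
    by (subst Lim_null) (simp add: jet_linear_part_def)
  have "((\<lambda>z. jacobian_det (jet_poly k a) z) \<longlongrightarrow> det (jet_linear_part a)) (at 0)"
    unfolding jacobian_det_jet_poly det_def vec_lambda_beta by (intro tendsto_intros pd)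
  moreover have "((\<lambda>z. jacobian_det (jet_poly k a) z) \<longlongrightarrow> 1) (at 0)"
    using vanishes_imp_tendsto[OF assms(2)] by (subst Lim_null)
  ultimately show ?thesis
    by (rule tendsto_unique[rotated]) simp
qed

text \<open>Both halves of the theorem, selected by \<open>vp\<close>. Multiplication by the linear
  part from the left preserves O(|z|^(k+1)); when \<open>vp\<close> holds its determinant is 1, so
  it also preserves volume.\<close>

lemma family_with_jets:
  fixes X :: "('a, nat) cspace" and P :: "'a \<Rightarrow> 'n::finite jet"
  assumes X: "charts_in_coord_space X" and k: "k \<ge> 1" and card: "CARD('n) > 1"
    and P: "holomorphic_jet_family X k P"
    and jac: "\<And>x. vp \<Longrightarrow> x \<in> topspace (cs_top X) \<Longrightarrow>
      vanishes (Suc k) (\<lambda>z. jacobian_det (jet_poly k (P x)) z - 1)"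
  shows "\<exists>F. holomorphic_Aut_family X F \<and> (\<forall>x \<in> topspace (cs_top X).
    vanishes (Suc k) (\<lambda>z. F x z - jet_poly k (P x) z) \<and> (vp \<longrightarrow> volume_preserving (F x)))"
proof -
  let ?A = "\<lambda>x. jet_linear_part (P x)"
  let ?B = "\<lambda>x. adjugate_inverse (?A x)"
  let ?q = "\<lambda>x \<alpha>. ?B x *v P x \<alpha>"
  have P_nd: "P x \<in> nondegenerate_jets_00 k" if "x \<in> topspace (cs_top X)" for x
    using P that by (simp add: holomorphic_jet_family_def)
  have P_hol: "holomorphic_fun X (\<lambda>x. P x \<alpha> $ l)" for \<alpha> l
    using P by (simp add: holomorphic_jet_family_def holomorphic_map_def)
  have det: "det (?A x) \<noteq> 0" if "x \<in> topspace (cs_top X)" for x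
    using P_nd[OF that] by (simp add: nondegenerate_jets_00_def)
  have A_hol: "holomorphic_fun X (\<lambda>x. ?A x $ i $ j)" for i j
    using P_hol by (simp add: jet_linear_part_def)
  have AB: "?A x ** ?B x = mat 1" "?B x ** ?A x = mat 1" if "x \<in> topspace (cs_top X)" for x
    using adjugate_inverse[OF det[OF that]] by auto
  have q_poly: "jet_poly k (?q x) = (\<lambda>z. ?B x *v jet_poly k (P x) z)" for x
    by (simp add: fun_eq_iff jet_poly_matrix)
  have det_A: "det (?A x) = 1" if "vp" "x \<in> topspace (cs_top X)" for x
    using det_linear_part_eq_1[OF k jac[OF that]] .
  have "\<exists>F. tangent_family X vp F \<and>
    (\<forall>x \<in> topspace (cs_top X). vanishes (Suc k) (\<lambda>z. F x z - jet_poly k (?q x) z))"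
  proof (rule tangent_family_with_jets[OF X card k])
    show "holomorphic_fun X (\<lambda>x. ?q x \<alpha> $ l)" for \<alpha> l
      unfolding matrix_vector_mult_def vec_lambda_beta
      by (intro holomorphic_fun_sum holomorphic_fun_mult holomorphic_fun_adjugate_inverse X A_hol det P_hol)
    fix x assume x: "x \<in> topspace (cs_top X)"
    show "?q x \<alpha> = 0" if "mdegree \<alpha> > k" for \<alpha>
      using P_nd[OF x] that by (simp add: nondegenerate_jets_00_def)
    \<comment> \<open>Since 0^0 = 1, evaluating the jet at the origin returns the constant
      coefficient, which is thus 0.\<close>
    have "monomial \<alpha> 0 = (if \<alpha> = (\<lambda>_. 0) then 1 else 0)" for \<alpha> :: "'n \<Rightarrow> nat"
      by (auto simp: monomial_def fun_eq_iff)
    then have "jet_poly k (P x) 0 $ i = P x (\<lambda>_. 0) $ i" for i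
      unfolding jet_poly_nth
      by (simp add: if_distrib[of "\<lambda>u. _ * u"] finite_mdegree_le cong: if_cong)
    then show "?q x (\<lambda>_. 0) = 0"
      using P_nd[OF x] by (simp add: nondegenerate_jets_00_def vec_eq_iff matrix_vector_mult_def)
    show "?q x (unit_index j) $ i = (if i = j then 1 else 0)" for i j
    proof -
      have "?q x (unit_index j) $ i = (?B x ** ?A x) $ i $ j"
        by (simp add: matrix_vector_mult_def matrix_matrix_mult_def jet_linear_part_def)
      then show ?thesis
        unfolding AB(2)[OF x] by (simp add: mat_def)
    qed
    show "vanishes (Suc k) (\<lambda>z. jacobian_det (jet_poly k (?q x)) z - 1)" if vp
    proof -
      \<comment> \<open>The normalised jets inherit the Jacobian condition because the matrix they
        are multiplied by has determinant 1.\<close>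
      have "det (?B x) = 1"
        using det_mul[of "?A x" "?B x"] AB(1)[OF x] det_A[OF that x] by simp
      then have "jacobian_det (jet_poly k (?q x)) z = jacobian_det (jet_poly k (P x)) z" for z
        unfolding q_poly jacobian_det_linear_compose[OF has_derivative_jet_poly] by simp
      then show ?thesis using jac[OF that x] by simp
    qed
  qed
  then obtain F where F: "tangent_family X vp F"
    "\<And>x. x \<in> topspace (cs_top X) \<Longrightarrow> vanishes (Suc k) (\<lambda>z. F x z - jet_poly k (?q x) z)"
    by blast
  have aut: "aut_family X vp F" using F(1) by (simp add: tangent_family_def)
  let ?F = "\<lambda>x z. ?A x *v F x z"
  show ?thesis
  proof (intro exI conjI ballI impI)
    show "holomorphic_Aut_family X ?F"
      unfolding holomorphic_Aut_family_def
    proof (intro conjI ballI)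
      fix x assume "x \<in> topspace (cs_top X)"
      from AB[OF this] have "stable_aut (?F x)"
        by (rule stable_aut_compose[OF stable_aut_linear aut_family_stable_aut[OF aut]])
      then show "?F x \<in> Aut" by (rule stable_aut_imp_Aut)
    next
      show "holomorphic_map (prod_cspace X affine_cspace) (\<lambda>(x, z). ?F x z)"
        unfolding case_prod_unfold
        by (intro holomorphic_map_matrix_vector_mult charts_in_coord_space_prod X
            charts_in_coord_space_affine aut_family_holomorphic[OF X aut] holomorphic_fun_param A_hol)
    qed
    fix x assume x: "x \<in> topspace (cs_top X)"
    have "?A x *v (F x z - jet_poly k (?q x) z) = ?F x z - jet_poly k (P x) z" for z
      unfolding q_poly using AB(1)[OF x]
      by (simp add: matrix_vector_mult_diff_distrib matrix_vector_mul_assoc)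
    then show "vanishes (Suc k) (\<lambda>z. ?F x z - jet_poly k (P x) z)"
      using vanishes_matrix_vector_mult[OF F(2)[OF x], of "?A x"] by simp
    show "volume_preserving (?F x)" if vp
      unfolding volume_preserving_def
    proof
      fix z
      have "aut_family X True F" using aut that by simp
      then obtain D where "(F x has_derivative D) (at z)" "det (matrix D) = 1"
        using aut_family_unimodular[of X F x z] by blast
      then show "jacobian_det (?F x) z = 1"
        using det_A[OF that x] by (simp add: jacobian_det_linear_compose jacobian_det_eq)
    qed
  qed
qed

theorem proposition1p2:
  fixes X :: "('a, nat) cspace"
    and k :: nat
    and P :: "'a \<Rightarrow> 'n::finite jet"
  assumes "reduced_stein_space X"
    and "k \<ge> 1"
    and "CARD('n) > 1"
    and "holomorphic_jet_family X k P"
  shows "(\<exists>F :: 'a \<Rightarrow> complex ^ 'n \<Rightarrow> complex ^ 'n.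
            holomorphic_Aut_family X F \<and>
            (\<forall>x \<in> topspace (cs_top X).
               (\<lambda>z. norm (F x z - jet_poly k (P x) z)) \<in> O[at 0](\<lambda>z. norm z ^ (k + 1)))) \<and>
         ((\<forall>x \<in> topspace (cs_top X).
             (\<lambda>z. norm (jacobian_det (jet_poly k (P x)) z - 1)) \<in> O[at 0](\<lambda>z. norm z ^ (k + 1))) \<longrightarrow>
          (\<exists>F :: 'a \<Rightarrow> complex ^ 'n \<Rightarrow> complex ^ 'n.
            holomorphic_Aut_family X F \<and>
            (\<forall>x \<in> topspace (cs_top X).
               (\<lambda>z. norm (F x z - jet_poly k (P x) z)) \<in> O[at 0](\<lambda>z. norm z ^ (k + 1)) \<and>
               volume_preserving (F x))))"
proof -
  have X: "charts_in_coord_space X"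
    using assms(1) by (simp add: reduced_stein_space_def charts_in_coord_space_reduced)
  show ?thesis
    unfolding vanishes_iff_bigo[symmetric]
    using family_with_jets[OF X assms(2-4), of False] family_with_jets[OF X assms(2-4), of True]
    by auto
qed

end
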